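(* Let $n\ge 3$ and let $V=(v_1,\dots,v_n)$ be a configuration of $n$ vectors in $\mathbb{R}^3$ in general position. Then for every $s\le n$, \[ f^*_{s,0}(V)\le f^*_{s,0}(V') \quad\text{and}\quad f^*_{s,\le 1}(V)\le f^*_{s,\le 1}(V') \] for every coneighborly configuration $V'$ of $n$ vectors in $\mathbb{R}^3$ in general position; that is, among all configurations of $n$ vectors in general position in $\mathbb{R}^3$, the numbers $f^*_{s,0}$ and $f^*_{s,\le 1}$ are maximized by coneighborly configurations.
   Context: A configuration $V=(v_1,\dots,v_n)$ of vectors in $\mathbb{R}^3$ is in general position if any $3$ of the vectors are linearly independent. For a sign vector $F\in\{-1,0,+1\}^n$, let $F_+,F_0,F_-\subseteq[n]$ be the sets of indices $i$ with $F_i=+1$, $0$, $-1$, respectively. The set of dependency patterns $\mathcal{F}^*(V)$ is the set of sign vectors $(\operatorname{sgn}\lambda_1,\dots,\operatorname{sgn}\lambda_n)$ over all nontrivial linear dependencies $\sum_{i=1}^n\lambda_i v_i=0$ (real $\lambda_i$, not all zero). For integers $s,t$, $f^*_{s,t}(V)$ is the number of $F\in\mathcal{F}^*(V)$ with $|F_-|=t$ and $|F_+|=s-t$ (i.e., $t$ negative and $s$ nonzero entries), and $f^*_{s,\le 1}(V):=f^*_{s,0}(V)+f^*_{s,1}(V)$. $V$ is coneighborly if every open linear halfspace of $\mathbb{R}^3$ (bounded by a plane through the origin) contains at least $\lfloor (n-2)/2\rfloor$ of the vectors of $V$. *)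

theory Defs
  imports "HOL-Analysis.Analysis"
begin

(* A configuration of n vectors is a function v :: nat => real^3, of which only the
   values on the index set {1..n} are relevant. *)

definition general_position :: "nat \<Rightarrow> (nat \<Rightarrow> real^3) \<Rightarrow> bool" where
  "general_position n v \<longleftrightarrow>
     (\<forall>I \<subseteq> {1..n}. card I = 3 \<longrightarrow> inj_on v I \<and> independent (v ` I))"

(* Sign vectors in {-1,0,1}^n are functions restricted to {1..n} (undefined elsewhere), so
   that two of them are equal iff they agree on {1..n}. *)

definition dependency_patterns :: "nat \<Rightarrow> (nat \<Rightarrow> real^3) \<Rightarrow> (nat \<Rightarrow> real) set" where
  "dependency_patterns n v =
     {\<lambda>i\<in>{1..n}. sgn (l i) | l.
        (\<exists>i\<in>{1..n}. l i \<noteq> 0) \<and> (\<Sum>i\<in>{1..n}. l i *\<^sub>R v i) = 0}"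

definition pos_part :: "nat \<Rightarrow> (nat \<Rightarrow> real) \<Rightarrow> nat set" where
  "pos_part n F = {i\<in>{1..n}. F i = 1}"

definition neg_part :: "nat \<Rightarrow> (nat \<Rightarrow> real) \<Rightarrow> nat set" where
  "neg_part n F = {i\<in>{1..n}. F i = -1}"

definition fstar :: "nat \<Rightarrow> (nat \<Rightarrow> real^3) \<Rightarrow> int \<Rightarrow> int \<Rightarrow> nat" where
  "fstar n v s t =
     card {F \<in> dependency_patterns n v.
             int (card (neg_part n F)) = t \<and> int (card (pos_part n F)) = s - t}"

definition fstar_le1 :: "nat \<Rightarrow> (nat \<Rightarrow> real^3) \<Rightarrow> int \<Rightarrow> nat" where
  "fstar_le1 n v s = fstar n v s 0 + fstar n v s 1"

(* The open linear halfspaces are the sets {x. u \<bullet> x > 0} with u \<noteq> 0. Truncated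
   subtraction is harmless: for n < 2 the bound is vacuous either way. *)

definition coneighborly :: "nat \<Rightarrow> (nat \<Rightarrow> real^3) \<Rightarrow> bool" where
  "coneighborly n v \<longleftrightarrow>
     (\<forall>u. u \<noteq> 0 \<longrightarrow> (n - 2) div 2 \<le> card {i\<in>{1..n}. u \<bullet> v i > 0})"

lemma finite_dependency_patterns: "finite (dependency_patterns n v)"
proof (rule finite_subset)
  show "dependency_patterns n v \<subseteq> {1..n} \<rightarrow>\<^sub>E {-1, 0, 1}"
    by (auto simp: dependency_patterns_def sgn_if split: if_splits)
  show "finite ({1..n} \<rightarrow>\<^sub>E {-1, 0, 1 :: real})"
    by (intro finite_PiE) auto
qed

end

theory Submission
  imports Defs
begin

text \<open>
  A sign vector with positive part \<open>A\<close> and negative part \<open>B\<close> is a dependency pattern iff no plane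
  through the origin strictly separates \<open>A\<close> from \<open>B\<close>. So \<open>f\<^sup>*\<^sub>s\<^sub>,\<^sub>0\<close> and \<open>f\<^sup>*\<^sub>s\<^sub>,\<^sub>1\<close> are determined by the number
  \<open>P\<^sub>s\<close> of pointed \<open>s\<close>-subsets (contained in an open halfspace) and the number \<open>Q\<^sub>s\<close> of \<open>s\<close>-subsets
  with a marked element that a plane separates from the rest, and these have to be bounded below.

  Colour the vectors red and blue by the side of a generic plane on which they lie. A pointed set with
  both colours has exactly one supporting plane through a red \<open>a\<close> and a blue \<open>b\<close> that leaves it on
  the left of \<open>(a, b)\<close>. This expresses \<open>P\<^sub>s\<close>, and similarly \<open>Q\<^sub>s\<close>, by binomial coefficients of the
  numbers \<open>l\<close> of vectors to the left of the pairs \<open>(a, b)\<close>. With a halving plane, each term is least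
  when all \<open>l\<close> are as close as possible to \<open>(n - 2)/2\<close>, which is what coneighborliness says, by
  convexity. The only exception is \<open>P\<^sub>4 + Q\<^sub>4\<close>, where the pairs of different colours enter with
  the wrong sign. There one needs that for every \<open>j < n/2 - 1\<close> the pairs of equal colours with
  \<open>l \<le> j\<close> are at least as many as those from red to blue.

  That inequality is proved by rotating a direction in the affine picture: along the rotation the order
  of the points changes by adjacent swaps, and each pair occurs as a swap once in each direction. A
  relation \<open>linked\<close> between red and blue points is switched on by a low swap of a blue and a red
  point, and it can be switched off before the rotation closes only by a low swap of two points of
  equal colours, which switches off at most one relation.
\<close>

section \<open>Levels in a two-coloured order\<close>

text \<open>Marking an element of every s-set yields Q_s + s P_s = (n + 1 - s) P_{s-1} + sum of C(l,
  s - 2) over all ordered pairs. In P_s + Q_s a red-blue pair therefore carries (n + 1 - s) C(l, s -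
  3) - (s - 3) C(l, s - 2), symmetrized under l -> n - 2 - l. The subtracted term is largest away
  from the middle. From s = 5 on the first term outweighs it. At s = 4 the symmetrized first term is
  constant, because C(l, 1) + C(n - 2 - l, 1) = n - 2, and only the pairs of equal colours can pay
  for the rest. They do so layer by layer in \<open>j\<close>, which is the reason for the sweep.
  The halving plane has two uses: it makes the sizes of the colour classes depend on n alone, so
  that both configurations obey the same bound, and it leaves more than \<open>j\<close> vectors of
  either colour, so that the layer inequality applies to \<open>w\<close> and to \<open>- w\<close>.
  The relation \<open>linked\<close> compares ranks among active points of one colour. A swap of a
  red and a blue point that deactivates both happens where these ranks agree, so it disturbs no
  other pair.\<close>

definition strict_order_on :: "'a set \<Rightarrow> ('a \<Rightarrow> 'a \<Rightarrow> bool) \<Rightarrow> bool" where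
  "strict_order_on I r \<longleftrightarrow>
     (\<forall>u\<in>I. \<not> r u u) \<and> (\<forall>u\<in>I. \<forall>v\<in>I. \<forall>w\<in>I. r u v \<longrightarrow> r v w \<longrightarrow> r u w) \<and>
     (\<forall>u\<in>I. \<forall>v\<in>I. u \<noteq> v \<longrightarrow> r u v \<or> r v u)"

lemma strict_order_on_irrefl: "strict_order_on I r \<Longrightarrow> u \<in> I \<Longrightarrow> \<not> r u u"
  by (simp add: strict_order_on_def)

lemma strict_order_on_total:
  "strict_order_on I r \<Longrightarrow> u \<in> I \<Longrightarrow> v \<in> I \<Longrightarrow> u \<noteq> v \<Longrightarrow> r u v \<or> r v u"
  unfolding strict_order_on_def by (elim conjE) meson

lemma strict_order_on_trans:
  assumes "strict_order_on I r" "u \<in> I" "v \<in> I" "w \<in> I" "r u v" "r v w"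
  shows "r u w"
proof -
  have "\<forall>u\<in>I. \<forall>v\<in>I. \<forall>w\<in>I. r u v \<longrightarrow> r v w \<longrightarrow> r u w"
    using assms(1) unfolding strict_order_on_def by (elim conjE)
  then show ?thesis using assms(2-) by meson
qed

lemma strict_order_on_asym:
  "strict_order_on I r \<Longrightarrow> u \<in> I \<Longrightarrow> v \<in> I \<Longrightarrow> r u v \<Longrightarrow> \<not> r v u"
  using strict_order_on_irrefl[of I r u] strict_order_on_trans[of I r u v u] by blast

lemma strict_order_on_max:
  assumes "strict_order_on I r" "finite D" "D \<noteq> {}" "D \<subseteq> I"
  shows "\<exists>m\<in>D. \<forall>u\<in>D. u \<noteq> m \<longrightarrow> r u m"
  using assms(2-4)
proof (induction D rule: finite_ne_induct)
  case (singleton x)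
  then show ?case by simp
next
  case (insert x F)
  then obtain m where m: "m \<in> F" "\<forall>u\<in>F. u \<noteq> m \<longrightarrow> r u m" by auto
  show ?case
  proof (cases "r m x")
    case True
    have "r u x" if "u \<in> F" for u
      using strict_order_on_trans[OF assms(1), of u m x] m True insert.prems that
      by (cases "u = m") auto
    then show ?thesis by auto
  next
    case False
    then have "r x m"
      using strict_order_on_total[OF assms(1), of m x] m insert.prems insert.hyps by auto
    then show ?thesis using m by auto
  qed
qed

locale two_coloured =
  fixes I :: "'a set" and red :: "'a \<Rightarrow> bool" and j :: nat
  assumes finI: "finite I"
    and many_red: "j < card {u \<in> I. red u}"
begin

text \<open>A blue vector is a negative multiple of its affine point. So this counts the original
  vectors strictly on one side of a plane through \<open>v\<close>: reds whose points lie above it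
  and blues whose points lie below it.\<close>

definition lev :: "('a \<Rightarrow> 'a \<Rightarrow> bool) \<Rightarrow> 'a \<Rightarrow> nat" where
  "lev r v = card {u \<in> I. red u \<and> r v u} + card {u \<in> I. \<not> red u \<and> r u v}"

definition Areds :: "('a \<Rightarrow> 'a \<Rightarrow> bool) \<Rightarrow> 'a \<Rightarrow> nat" where
  "Areds r v = card {u \<in> I. red u \<and> r u v \<and> lev r u \<le> j}"

definition Ablues :: "('a \<Rightarrow> 'a \<Rightarrow> bool) \<Rightarrow> 'a \<Rightarrow> nat" where
  "Ablues r v = card {u \<in> I. \<not> red u \<and> r u v \<and> lev r u \<le> j}"

text \<open>
  A point is active if its level is at most \<open>j\<close>. The pairs in \<open>linked\<close> are those that the sweep has to
  track: they change only when two points of low level are swapped.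
\<close>

definition linked :: "('a \<Rightarrow> 'a \<Rightarrow> bool) \<Rightarrow> 'a \<Rightarrow> 'a \<Rightarrow> bool" where
  "linked r x e \<longleftrightarrow> x \<in> I \<and> e \<in> I \<and> red x \<and> \<not> red e \<and> r x e \<and> lev r x \<le> j \<and> lev r e \<le> j \<and>
     Ablues r e \<le> Areds r x"

text \<open>Scan the order upwards and let e be the number of reds not yet passed plus the number of
  blues passed. A red lowers e by one, a blue raises it by one, and the level of the passed point is
  the smaller of the two values of e. So the point is active exactly when max 0 (j + 1 - e) changes,
  and then it changes by one.\<close>

lemma active_balance:
  assumes so: "strict_order_on I r"
    and D: "D \<subseteq> I" "\<And>u u'. u \<in> D \<Longrightarrow> u' \<in> I \<Longrightarrow> r u' u \<Longrightarrow> u' \<in> D"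
  shows "int (card {u \<in> D. red u \<and> lev r u \<le> j}) - int (card {u \<in> D. \<not> red u \<and> lev r u \<le> j}) =
    max 0 (int j + 1 - int (card {u \<in> I - D. red u} + card {u \<in> D. \<not> red u}))"
  using D
proof (induction "card D" arbitrary: D)
  case 0
  then have "D = {}" using finI finite_subset by fastforce
  \<comment> \<open>Before the scan e is the number of reds; having more than \<open>j\<close> of
    them makes the right-hand side start at 0.\<close>
  then show ?case using many_red by simp
next
  case (Suc k)
  have finD: "finite D" using Suc.prems(1) finI finite_subset by blast
  have "D \<noteq> {}" using Suc.hyps(2) by auto
  then obtain m where m: "m \<in> D" "\<And>u. u \<in> D \<Longrightarrow> u \<noteq> m \<Longrightarrow> r u m"
    using strict_order_on_max[OF so finD _ Suc.prems(1)] by auto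
  define D' where "D' = D - {m}"
  have mI: "m \<in> I" using m Suc.prems by auto
  have irr: "\<not> r u u" if "u \<in> I" for u
    using strict_order_on_irrefl[OF so that] .
  have asym: "\<not> r v u" if "u \<in> I" "v \<in> I" "r u v" for u v
    using strict_order_on_asym[OF so] that by blast
  have tot: "r u v \<or> r v u" if "u \<in> I" "v \<in> I" "u \<noteq> v" for u v
    using strict_order_on_total[OF so] that by blast
  have D: "D = insert m D'" "m \<notin> D'" "finite D'" "D' \<subseteq> I"
    using m finD Suc.prems(1) by (auto simp: D'_def)
  have down': "u' \<in> D'" if "u \<in> D'" "u' \<in> I" "r u' u" for u u'
  proof -
    have "u' \<in> D" using Suc.prems(2)[of u u'] that D by auto
    moreover have "u' \<noteq> m" using asym[of u m] m(2)[of u] that D mI by auto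
    ultimately show ?thesis by (simp add: D'_def)
  qed
  have IH: "int (card {u \<in> D'. red u \<and> lev r u \<le> j}) - int (card {u \<in> D'. \<not> red u \<and> lev r u \<le> j}) =
    max 0 (int j + 1 - int (card {u \<in> I - D'. red u} + card {u \<in> D'. \<not> red u}))"
    using Suc.hyps(1)[of D'] Suc.hyps(2) D down' by simp
  have "{u \<in> I. red u \<and> r m u} = {u \<in> I - D. red u}"
  proof (intro Collect_cong)
    fix u
    have "r m u \<longleftrightarrow> u \<notin> D" if "u \<in> I"
    proof
      assume "r m u" then show "u \<notin> D" using asym[of m u] m(2)[of u] irr[of m] mI that by blast
    next
      assume "u \<notin> D" then show "r m u" using tot[of u m] Suc.prems(2)[of m u] m(1) mI that by blast
    qed
    then show "u \<in> I \<and> red u \<and> r m u \<longleftrightarrow> u \<in> I - D \<and> red u" by blast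
  qed
  moreover have "{u \<in> I. \<not> red u \<and> r u m} = {u \<in> D'. \<not> red u}"
  proof (intro Collect_cong)
    fix u
    have "r u m \<longleftrightarrow> u \<in> D'" if "u \<in> I"
      using Suc.prems(2)[of m u] m irr[of m] mI that by (auto simp: D'_def)
    then show "u \<in> I \<and> \<not> red u \<and> r u m \<longleftrightarrow> u \<in> D' \<and> \<not> red u" using D by blast
  qed
  ultimately have levm: "lev r m = card {u \<in> I - D. red u} + card {u \<in> D'. \<not> red u}"
    by (simp add: lev_def)
  show ?case
  proof (cases "red m")
    case True
    have "{u \<in> I - D'. red u} = insert m {u \<in> I - D. red u}" using True mI D by auto
    then have 1: "card {u \<in> I - D'. red u} = Suc (card {u \<in> I - D. red u})"
      using finI m by simp
    have 2: "{u \<in> D. \<not> red u} = {u \<in> D'. \<not> red u}" "{u \<in> D. \<not> red u \<and> lev r u \<le> j} = {u \<in> D'. \<not> red u \<and> lev r u \<le> j}"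
      using D True by auto
    have "{u \<in> D. red u \<and> lev r u \<le> j} = (if lev r m \<le> j then insert m {u \<in> D'. red u \<and> lev r u \<le> j} else {u \<in> D'. red u \<and> lev r u \<le> j})"
      using D True by auto
    then have 3: "card {u \<in> D. red u \<and> lev r u \<le> j} = (if lev r m \<le> j then 1 else 0) + card {u \<in> D'. red u \<and> lev r u \<le> j}"
      using D by auto
    have aux: "int a' - int b = max 0 (int j + 1 - int (c + d))"
      if "int a - int b = max 0 (int j + 1 - int (Suc c + d))" "l = c + d"
        "a' = (if l \<le> j then 1 else 0) + a" for a a' b c d l :: nat
      using that by (auto split: if_splits)
    show ?thesis
      unfolding 2 by (rule aux[OF IH[unfolded 1] levm 3])
  next
    case False
    have 1: "{u \<in> I - D'. red u} = {u \<in> I - D. red u}" "{u \<in> D. red u \<and> lev r u \<le> j} = {u \<in> D'. red u \<and> lev r u \<le> j}"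
       using False mI D by auto
    have "{u \<in> D. \<not> red u} = insert m {u \<in> D'. \<not> red u}" using D False by auto
    then have 2: "card {u \<in> D. \<not> red u} = Suc (card {u \<in> D'. \<not> red u})" using D by simp
    have "{u \<in> D. \<not> red u \<and> lev r u \<le> j} = (if lev r m \<le> j then insert m {u \<in> D'. \<not> red u \<and> lev r u \<le> j} else {u \<in> D'. \<not> red u \<and> lev r u \<le> j})"
      using D False by auto
    then have 3: "card {u \<in> D. \<not> red u \<and> lev r u \<le> j} = (if lev r m \<le> j then 1 else 0) + card {u \<in> D'. \<not> red u \<and> lev r u \<le> j}"
      using D by auto
    have aux: "int a - int b' = max 0 (int j + 1 - int (c + Suc d))"
      if "int a - int b = max 0 (int j + 1 - int (c + d))" "l = c + d"
        "b' = (if l \<le> j then 1 else 0) + b" for a b b' c d l :: nat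
      using that by (auto split: if_splits)
    show ?thesis
      unfolding 1(2) 2 by (rule aux[OF IH[unfolded 1(1)] levm 3])
  qed
qed

text \<open>The balance for the points below \<open>v\<close>; a red \<open>v\<close> is itself
  among the reds not yet passed, whence the shift between the colours. At level \<open>j\<close> the
  two ranks are equal for a red point and differ by one for a blue one, which decides the borderline
  swaps.\<close>

lemma active_balance_below:
  assumes so: "strict_order_on I r" and v: "v \<in> I" and act: "lev r v \<le> j"
  shows "Areds r v = Ablues r v + (if red v then j - lev r v else Suc j - lev r v)"
proof -
  define D where "D = {u \<in> I. r u v}"
  have tr: "r u w" if "u \<in> I" "u' \<in> I" "w \<in> I" "r u u'" "r u' w" for u u' w
    by (rule strict_order_on_trans[OF so that])
  have irr: "\<not> r v v" using strict_order_on_irrefl[OF so v] .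
  have bal: "int (card {u \<in> D. red u \<and> lev r u \<le> j}) - int (card {u \<in> D. \<not> red u \<and> lev r u \<le> j}) =
    max 0 (int j + 1 - int (card {u \<in> I - D. red u} + card {u \<in> D. \<not> red u}))"
  proof (rule active_balance[OF so])
    fix u u' assume "u \<in> D" "u' \<in> I" "r u' u"
    then show "u' \<in> D" using tr[of u' u v] v by (simp add: D_def)
  qed (simp add: D_def)
  have A: "{u \<in> D. red u \<and> lev r u \<le> j} = {u \<in> I. red u \<and> r u v \<and> lev r u \<le> j}"
    and B: "{u \<in> D. \<not> red u \<and> lev r u \<le> j} = {u \<in> I. \<not> red u \<and> r u v \<and> lev r u \<le> j}"
    and C: "{u \<in> D. \<not> red u} = {u \<in> I. \<not> red u \<and> r u v}"
    by (auto simp: D_def)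
  have tot: "r u v \<or> r v u" if "u \<in> I" "u \<noteq> v" for u
    using strict_order_on_total[OF so] that v by blast
  have asym: "\<not> r v u" if "u \<in> I" "r u v" for u
    using strict_order_on_asym[OF so] that v by blast
  have "{u \<in> I - D. red u} = (if red v then insert v {u \<in> I. red u \<and> r v u} else {u \<in> I. red u \<and> r v u})"
    using tot asym v irr by (auto simp: D_def)
  then have card_upper: "card {u \<in> I - D. red u} = (if red v then 1 else 0) + card {u \<in> I. red u \<and> r v u}"
    using finI irr by auto
  have aux: "a = b + (if P then j - l else Suc j - l)"
    if "int a - int b = max 0 (int j + 1 - int (c + d))" "c = (if P then 1 else 0) + c'" "l = c' + d" "l \<le> j"
    for a b c d l c' :: nat and P
    using that by (cases P) auto
  show ?thesis
    unfolding Areds_def Ablues_def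
    by (rule aux[OF bal[unfolded A B C] card_upper _ act]) (simp add: lev_def)
qed

end

section \<open>Adjacent swaps and their effect on levels, ranks and links\<close>

context two_coloured
begin

definition swap_step :: "('a \<Rightarrow> 'a \<Rightarrow> bool) \<Rightarrow> ('a \<Rightarrow> 'a \<Rightarrow> bool) \<Rightarrow> 'a \<Rightarrow> 'a \<Rightarrow> bool" where
  "swap_step r r' a b \<longleftrightarrow> strict_order_on I r \<and> strict_order_on I r' \<and> a \<in> I \<and> b \<in> I \<and> a \<noteq> b \<and>
     r a b \<and> r' b a \<and> (\<forall>u\<in>I. \<forall>v\<in>I. {u, v} \<noteq> {a, b} \<longrightarrow> r' u v = r u v)"

text \<open>The level at which the adjacent pair \<open>a, b\<close> is swapped, the pair itself being ignored.\<close>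

definition swap_lev :: "('a \<Rightarrow> 'a \<Rightarrow> bool) \<Rightarrow> 'a \<Rightarrow> 'a \<Rightarrow> nat" where
  "swap_lev r a b = card {u \<in> I - {a, b}. red u \<and> r a u} + card {u \<in> I - {a, b}. \<not> red u \<and> r u a}"

lemma swap_step_sym: "swap_step r r' a b \<Longrightarrow> swap_step r' r b a"
  unfolding swap_step_def by (auto simp: insert_commute)

lemma swap_step_same:
  "swap_step r r' a b \<Longrightarrow> u \<in> I \<Longrightarrow> v \<in> I \<Longrightarrow> u \<notin> {a, b} \<or> v \<notin> {a, b} \<Longrightarrow> r' u v = r u v"
  unfolding swap_step_def by blast

lemma swap_step_not: "swap_step r r' a b \<Longrightarrow> \<not> r b a"
  unfolding swap_step_def using strict_order_on_asym[of I r a b] by blast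

text \<open>A third point between \<open>a\<close> and \<open>b\<close> in \<open>r\<close> would
  still lie above \<open>a\<close> and below \<open>b\<close> in \<open>r'\<close>, although
  \<open>r'\<close> puts \<open>b\<close> below \<open>a\<close>.\<close>

lemma swap_step_adjacent:
  assumes s: "swap_step r r' a b" and u: "u \<in> I" "u \<noteq> a" "u \<noteq> b"
  shows "r a u = r b u" "r u a = r u b"
proof -
  have so: "strict_order_on I r" "strict_order_on I r'" and ab: "a \<in> I" "b \<in> I" "r a b"
    using s by (auto simp: swap_step_def)
  have "\<not> r' a b" using swap_step_not[OF swap_step_sym[OF s]] .
  then have no: "\<not> (r a u \<and> r u b)"
    using strict_order_on_trans[OF so(2), of a u b] swap_step_same[OF s, of a u] swap_step_same[OF s, of u b] ab u
    by auto
  show "r a u = r b u"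
    using no strict_order_on_total[OF so(1), of u b] strict_order_on_trans[OF so(1), of a b u] ab u
      strict_order_on_asym[OF so(1), of u b] by blast
  show "r u a = r u b"
    using no strict_order_on_total[OF so(1), of u a] strict_order_on_trans[OF so(1), of u a b] ab u
      strict_order_on_asym[OF so(1), of u a] by blast
qed

lemma swap_lev_sym:
  assumes s: "swap_step r r' a b"
  shows "swap_lev r' b a = swap_lev r a b"
proof -
  have ab: "a \<in> I" "b \<in> I" using s by (auto simp: swap_step_def)
  have "r' b u = r a u" "r' u b = r u a" if "u \<in> I - {a, b}" for u
    using swap_step_adjacent[OF s, of u] swap_step_same[OF s, of b u] swap_step_same[OF s, of u b] that ab
    by auto
  then have "{u \<in> I - {b, a}. red u \<and> r' b u} = {u \<in> I - {a, b}. red u \<and> r a u}"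
    "{u \<in> I - {b, a}. \<not> red u \<and> r' u b} = {u \<in> I - {a, b}. \<not> red u \<and> r u a}"
    by auto
  then show ?thesis by (simp add: swap_lev_def)
qed

lemma lev_swap_before:
  assumes s: "swap_step r r' a b"
  shows "lev r a = swap_lev r a b + (if red b then 1 else 0)"
    and "lev r b = swap_lev r a b + (if red a then 0 else 1)"
proof -
  have so: "strict_order_on I r" and ab: "a \<in> I" "b \<in> I" "r a b" "a \<noteq> b"
    using s by (auto simp: swap_step_def)
  have irr: "\<not> r a a" "\<not> r b b" "\<not> r b a"
    using strict_order_on_irrefl[OF so] ab swap_step_not[OF s] by auto
  have "{u \<in> I. red u \<and> r a u} = (if red b then insert b {u \<in> I - {a, b}. red u \<and> r a u} else {u \<in> I - {a, b}. red u \<and> r a u})"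
    "{u \<in> I. \<not> red u \<and> r u a} = {u \<in> I - {a, b}. \<not> red u \<and> r u a}"
    using ab irr by auto
  then show "lev r a = swap_lev r a b + (if red b then 1 else 0)"
    using finI by (simp add: lev_def swap_lev_def)
  have "{u \<in> I. \<not> red u \<and> r u b} = (if red a then {u \<in> I - {a, b}. \<not> red u \<and> r u a} else insert a {u \<in> I - {a, b}. \<not> red u \<and> r u a})"
    "{u \<in> I. red u \<and> r b u} = {u \<in> I - {a, b}. red u \<and> r a u}"
    using ab irr swap_step_adjacent[OF s] by auto
  then show "lev r b = swap_lev r a b + (if red a then 0 else 1)"
    using finI by (simp add: lev_def swap_lev_def)
qed

lemma lev_swap_after:
  assumes s: "swap_step r r' a b"
  shows "lev r' a = swap_lev r a b + (if red b then 0 else 1)"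
    and "lev r' b = swap_lev r a b + (if red a then 1 else 0)"
  using lev_swap_before[OF swap_step_sym[OF s]] swap_lev_sym[OF s] by auto

lemma lev_swap_other:
  assumes s: "swap_step r r' a b" and v: "v \<in> I" "v \<noteq> a" "v \<noteq> b"
  shows "lev r' v = lev r v"
proof -
  have "r' u v = r u v" "r' v u = r v u" if "u \<in> I" for u
    using swap_step_same[OF s] v that by auto
  then have "{u \<in> I. red u \<and> r' v u} = {u \<in> I. red u \<and> r v u}"
    "{u \<in> I. \<not> red u \<and> r' u v} = {u \<in> I. \<not> red u \<and> r u v}"
    by auto
  then show ?thesis by (simp add: lev_def)
qed

lemma Areds_mono:
  assumes so: "strict_order_on I r" and "u \<in> I" "v \<in> I" "r u v"
  shows "Areds r u \<le> Areds r v" "Ablues r u \<le> Ablues r v"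
proof -
  have tr: "r w v" if "w \<in> I" "r w u" for w
    by (rule strict_order_on_trans[OF so that(1) assms(2,3) that(2) assms(4)])
  show "Areds r u \<le> Areds r v" "Ablues r u \<le> Ablues r v"
    unfolding Areds_def Ablues_def using tr finI by (auto intro!: card_mono)
qed

lemma Areds_strict_mono:
  assumes so: "strict_order_on I r" and u: "u \<in> I" "v \<in> I" "r u v" "red u" "lev r u \<le> j"
  shows "Areds r u < Areds r v"
  unfolding Areds_def
proof (rule psubset_card_mono)
  have tr: "r w v" if "w \<in> I" "r w u" for w
    by (rule strict_order_on_trans[OF so that(1) u(1,2) that(2) u(3)])
  show "finite {w \<in> I. red w \<and> r w v \<and> lev r w \<le> j}" using finI by simp
  have "u \<in> {w \<in> I. red w \<and> r w v \<and> lev r w \<le> j} - {w \<in> I. red w \<and> r w u \<and> lev r w \<le> j}"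
    using u strict_order_on_irrefl[OF so, of u] by simp
  moreover have "{w \<in> I. red w \<and> r w u \<and> lev r w \<le> j} \<subseteq> {w \<in> I. red w \<and> r w v \<and> lev r w \<le> j}"
    using tr by auto
  ultimately show "{w \<in> I. red w \<and> r w u \<and> lev r w \<le> j} \<subset> {w \<in> I. red w \<and> r w v \<and> lev r w \<le> j}"
    by blast
qed

lemma Ablues_strict_mono:
  assumes so: "strict_order_on I r" and u: "u \<in> I" "v \<in> I" "r u v" "\<not> red u" "lev r u \<le> j"
  shows "Ablues r u < Ablues r v"
  unfolding Ablues_def
proof (rule psubset_card_mono)
  have tr: "r w v" if "w \<in> I" "r w u" for w
    by (rule strict_order_on_trans[OF so that(1) u(1,2) that(2) u(3)])
  show "finite {w \<in> I. \<not> red w \<and> r w v \<and> lev r w \<le> j}" using finI by simp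
  have "u \<in> {w \<in> I. \<not> red w \<and> r w v \<and> lev r w \<le> j} - {w \<in> I. \<not> red w \<and> r w u \<and> lev r w \<le> j}"
    using u strict_order_on_irrefl[OF so, of u] by simp
  moreover have "{w \<in> I. \<not> red w \<and> r w u \<and> lev r w \<le> j} \<subseteq> {w \<in> I. \<not> red w \<and> r w v \<and> lev r w \<le> j}"
    using tr by auto
  ultimately show "{w \<in> I. \<not> red w \<and> r w u \<and> lev r w \<le> j} \<subset> {w \<in> I. \<not> red w \<and> r w v \<and> lev r w \<le> j}"
    by blast
qed

lemma Areds_inj:
  assumes so: "strict_order_on I r" and "u \<in> I" "v \<in> I" "red u" "red v" "lev r u \<le> j" "lev r v \<le> j"
    "Areds r u = Areds r v"
  shows "u = v"
  using strict_order_on_total[OF so, of u v] Areds_strict_mono[OF so, of u v]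
    Areds_strict_mono[OF so, of v u] assms by (metis less_irrefl)

lemma Ablues_inj:
  assumes so: "strict_order_on I r" and "u \<in> I" "v \<in> I" "\<not> red u" "\<not> red v" "lev r u \<le> j" "lev r v \<le> j"
    "Ablues r u = Ablues r v"
  shows "u = v"
  using strict_order_on_total[OF so, of u v] Ablues_strict_mono[OF so, of u v]
    Ablues_strict_mono[OF so, of v u] assms by (metis less_irrefl)

text \<open>Both points are inactive before and after the swap, and \<open>linked\<close> depends
  only on the set of active points and on comparisons whose lower member is active.\<close>

lemma linked_swap_high:
  assumes s: "swap_step r r' a b" and high: "j < swap_lev r a b"
  shows "linked r' x e = linked r x e"
proof -
  have inact: "\<not> lev r a \<le> j" "\<not> lev r b \<le> j" "\<not> lev r' a \<le> j" "\<not> lev r' b \<le> j"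
    using lev_swap_before[OF s] lev_swap_after[OF s] high by auto
  have act: "lev r' v \<le> j \<longleftrightarrow> lev r v \<le> j" if "v \<in> I" for v
    using lev_swap_other[OF s that] inact by metis
  have ord: "r' u v \<longleftrightarrow> r u v" if "u \<in> I" "v \<in> I" "lev r u \<le> j" for u v
    using swap_step_same[OF s that(1,2)] inact that by auto
  have "Areds r' x = Areds r x" if "x \<in> I"
    unfolding Areds_def using act ord that by (intro arg_cong[where f=card]) auto
  moreover have "Ablues r' e = Ablues r e" if "e \<in> I"
    unfolding Ablues_def using act ord that by (intro arg_cong[where f=card]) auto
  ultimately show ?thesis
    unfolding linked_def using act ord by metis
qed

end

lemma card_add_two:
  assumes "S = C \<union> ((if p then {a} else {}) \<union> (if q then {b} else {}))"
    and "finite C" "a \<notin> C" "b \<notin> C" "a \<noteq> b"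
  shows "card S = card C + (if p then 1 else 0) + (if q then 1 else 0)"
  using assms by (cases p; cases q) auto

context two_coloured
begin

lemma swap_step_same_pair:
  "swap_step r r' a b \<Longrightarrow> u \<in> I \<Longrightarrow> v \<in> I \<Longrightarrow> {u, v} \<noteq> {a, b} \<Longrightarrow> r' u v = r u v"
  unfolding swap_step_def by blast

text \<open>Both points move from level \<open>swap_lev r a b\<close> to the next one, so they stay
  active or, at \<open>j\<close>, become inactive together. Ranks compare points of one colour only,
  hence the new order of \<open>a\<close> and \<open>b\<close> by itself affects no other
  pair.\<close>

lemma linked_swap_cross:
  assumes s: "swap_step r r' a b" and col: "red a" "\<not> red b" and low: "swap_lev r a b \<le> j"
  shows "linked r a b" and "\<not> linked r' a b"
    and "(x, e) \<noteq> (a, b) \<Longrightarrow> linked r' x e = linked r x e"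
proof -
  have so: "strict_order_on I r" and ab: "a \<in> I" "b \<in> I" "r a b" "a \<noteq> b"
    using s by (auto simp: swap_step_def)
  have levs: "lev r a = swap_lev r a b" "lev r b = swap_lev r a b"
    "lev r' a = Suc (swap_lev r a b)" "lev r' b = Suc (swap_lev r a b)"
    using lev_swap_before[OF s] lev_swap_after[OF s] col by auto
  have "r w b \<longleftrightarrow> r w a" if "w \<in> I" "\<not> red w" for w
    using swap_step_adjacent(2)[OF s that(1)] strict_order_on_irrefl[OF so ab(2)] swap_step_not[OF s]
      that(2) col by (cases "w = b") auto
  then have "{w \<in> I. \<not> red w \<and> r w b \<and> lev r w \<le> j} = {w \<in> I. \<not> red w \<and> r w a \<and> lev r w \<le> j}"
    by blast
  then have Bab: "Ablues r b = Ablues r a" by (simp add: Ablues_def)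
  have bal: "Areds r a = Ablues r a + (j - swap_lev r a b)"
    using active_balance_below[OF so ab(1)] levs low col by simp
  show "linked r a b" using ab col levs low Bab bal by (simp add: linked_def)
  show "\<not> linked r' a b"
    using swap_step_not[OF swap_step_sym[OF s]] by (simp add: linked_def)
  assume ne: "(x, e) \<noteq> (a, b)"
  have act_other: "lev r' v \<le> j \<longleftrightarrow> lev r v \<le> j" if "v \<in> I" "v \<noteq> a" "v \<noteq> b" for v
    using lev_swap_other[OF s that] by simp
  have ord: "r' u v \<longleftrightarrow> r u v" if "u \<in> I" "v \<in> I" "red u \<longleftrightarrow> red v" for u v
    using swap_step_same_pair[OF s that(1,2)] that(3) col by (metis doubleton_eq_iff)
  have ordxe: "r' x e \<longleftrightarrow> r x e" if "x \<in> I" "e \<in> I" "red x" "\<not> red e"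
    using swap_step_same_pair[OF s that(1,2)] that ne col by (metis doubleton_eq_iff)
  show "linked r' x e = linked r x e"
  proof (cases "x \<in> I \<and> e \<in> I \<and> red x \<and> \<not> red e \<and> r x e")
    case False
    then show ?thesis using ordxe unfolding linked_def by blast
  next
    case True
    then have xe: "x \<in> I" "e \<in> I" "red x" "\<not> red e" "r x e" "r' x e" "x \<noteq> b" "e \<noteq> a"
      using ordxe col by auto
    show ?thesis
    proof (cases "swap_lev r a b < j")
      case True
      have act: "lev r' v \<le> j \<longleftrightarrow> lev r v \<le> j" if "v \<in> I" for v
        using act_other[OF that] levs True by (cases "v = a \<or> v = b") auto
      have "Areds r' x = Areds r x"
        unfolding Areds_def using act ord xe by (intro arg_cong[where f=card]) auto
      moreover have "Ablues r' e = Ablues r e"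
        unfolding Ablues_def using act ord xe by (intro arg_cong[where f=card]) auto
      ultimately show ?thesis unfolding linked_def using act xe by simp
    next
      case False
      then have eq: "swap_lev r a b = j" using low by simp
      \<comment> \<open>In this critical case both points drop out, and their ranks agree. Hence no
        other link involved \<open>a\<close> or \<open>b\<close>; for the remaining pairs both ranks
        drop, or none does, or \<open>e\<close> has too large a rank both before and after.\<close>
      have AB: "Areds r a = Ablues r b" using bal Bab eq by simp
      have inact: "\<not> linked r' x e" if "x = a \<or> e = b"
        using that levs eq by (auto simp: linked_def)
      have below_a: "Areds r u < Areds r a" if "u \<in> I" "red u" "lev r u \<le> j" "r u a" for u
        using Areds_strict_mono[OF so that(1) ab(1) that(4,2,3)] .
      have above_b: "Ablues r b < Ablues r u" if "u \<in> I" "r b u" for u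
        using Ablues_strict_mono[OF so ab(2) that col(2)] levs eq by simp
      have act_red: "lev r' w \<le> j \<longleftrightarrow> w \<noteq> a \<and> lev r w \<le> j" if "w \<in> I" "red w" for w
        using act_other[OF that(1)] that(2) col levs eq by (cases "w = a") auto
      have act_blue: "lev r' w \<le> j \<longleftrightarrow> w \<noteq> b \<and> lev r w \<le> j" if "w \<in> I" "\<not> red w" for w
        using act_other[OF that(1)] that(2) col levs eq by (cases "w = b") auto
      have lowab: "lev r a \<le> j" "lev r b \<le> j" using levs low by auto
      have AR: "Areds r x = Areds r' x + (if r a x then 1 else 0)" if "x \<noteq> a"
      proof -
        have "{w \<in> I. red w \<and> r w x \<and> lev r w \<le> j} =
          (if r a x then insert a {w \<in> I. red w \<and> r' w x \<and> lev r' w \<le> j} else {w \<in> I. red w \<and> r' w x \<and> lev r' w \<le> j})"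
          using act_red ord xe ab(1) col lowab by auto
        moreover have "a \<notin> {w \<in> I. red w \<and> r' w x \<and> lev r' w \<le> j}" using levs eq by simp
        ultimately show ?thesis unfolding Areds_def using finI by simp
      qed
      have BR: "Ablues r e = Ablues r' e + (if r b e then 1 else 0)" if "e \<noteq> b"
      proof -
        have "{w \<in> I. \<not> red w \<and> r w e \<and> lev r w \<le> j} =
          (if r b e then insert b {w \<in> I. \<not> red w \<and> r' w e \<and> lev r' w \<le> j} else {w \<in> I. \<not> red w \<and> r' w e \<and> lev r' w \<le> j})"
          using act_blue ord xe ab(2) col lowab by auto
        moreover have "b \<notin> {w \<in> I. \<not> red w \<and> r' w e \<and> lev r' w \<le> j}" using levs eq by simp
        ultimately show ?thesis unfolding Ablues_def using finI by simp
      qed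
      consider "x = a" "e \<noteq> b" | "e = b" "x \<noteq> a" | "x \<noteq> a" "e \<noteq> b" using ne by blast
      then show ?thesis
      proof cases
        case 1
        then have "r b e" using swap_step_adjacent(1)[OF s xe(2)] xe by auto
        then have "\<not> linked r x e" using above_b[OF xe(2)] AB 1 by (simp add: linked_def)
        then show ?thesis using inact 1 by simp
      next
        case 2
        then have "r x a" using swap_step_adjacent(2)[OF s xe(1)] xe by auto
        then have "\<not> linked r x e" using below_a[OF xe(1,3)] AB 2 by (auto simp: linked_def)
        then show ?thesis using inact 2 by simp
      next
        case 3
        have lv: "lev r' x = lev r x" "lev r' e = lev r e"
          using lev_swap_other[OF s] xe 3 by auto
        show ?thesis
        proof (cases "r a x")
          case True
          then have "r a e" using strict_order_on_trans[OF so ab(1) xe(1,2)] xe by blast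
          then have "r b e" using swap_step_adjacent(1)[OF s xe(2)] xe 3 by auto
          then show ?thesis using AR BR 3 True xe lv by (simp add: linked_def)
        next
          case nax: False
          then have xa: "r x a" using strict_order_on_total[OF so ab(1) xe(1)] 3 by auto
          show ?thesis
          proof (cases "r b e")
            case True
            have "\<not> (lev r x \<le> j \<and> Ablues r e \<le> Areds r x)" "\<not> (lev r x \<le> j \<and> Ablues r' e \<le> Areds r' x)"
              using below_a[OF xe(1,3) _ xa] above_b[OF xe(2) True] AB AR BR 3 nax True by auto
            then show ?thesis unfolding linked_def using lv by auto
          next
            case False
            then show ?thesis using AR BR 3 nax xe lv by (simp add: linked_def)
          qed
        qed
      qed
    qed
  qed
qed

text \<open>Only \<open>b\<close>, which moves down, can lose a link. Either its rank drops by one,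
  so that a lost link had equality of ranks; or \<open>swap_lev r a b\<close> is \<open>j\<close>
  and \<open>b\<close> becomes inactive, and then the balance at level \<open>j\<close> forces the
  same equality.\<close>

lemma linked_swap_red:
  assumes s: "swap_step r r' a b" and col: "red a" "red b" and low: "swap_lev r a b \<le> j"
    and on: "linked r x e" and off: "\<not> linked r' x e"
  shows "x = b \<and> Ablues r e = Areds r b"
proof -
  have so: "strict_order_on I r" "strict_order_on I r'" and ab: "a \<in> I" "b \<in> I" "r a b" "r' b a" "a \<noteq> b"
    using s by (auto simp: swap_step_def)
  have levs: "lev r a = Suc (swap_lev r a b)" "lev r b = swap_lev r a b"
    "lev r' a = swap_lev r a b" "lev r' b = Suc (swap_lev r a b)"
    using lev_swap_before[OF s] lev_swap_after[OF s] col by auto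
  have xe: "x \<in> I" "e \<in> I" "red x" "\<not> red e" "r x e" "lev r x \<le> j" "lev r e \<le> j" "Ablues r e \<le> Areds r x"
    using on by (auto simp: linked_def)
  have blue: "lev r' w = lev r w" if "w \<in> I" "\<not> red w" for w
    using lev_swap_other[OF s that(1)] that col by blast
  have ordb: "r' u w = r u w" "r' w u = r w u" if "w \<in> I" "\<not> red w" "u \<in> I" for u w
    using swap_step_same[OF s] that col by auto
  have Be: "Ablues r' e = Ablues r e"
    unfolding Ablues_def using blue ordb xe by (intro arg_cong[where f=card]) auto
  have offx: "lev r' x \<le> j \<Longrightarrow> Areds r' x < Ablues r e"
    using off xe blue ordb Be by (auto simp: linked_def)
  have adj: "r a w = r b w" "r w a = r w b" if "w \<in> I" "w \<noteq> a" "w \<noteq> b" for w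
    using swap_step_adjacent[OF s that] by auto
  have nb: "\<not> r b a" "\<not> r' a b" using swap_step_not[OF s] swap_step_not[OF swap_step_sym[OF s]] by auto
  have irr: "\<not> r a a" "\<not> r b b" "\<not> r' a a" "\<not> r' b b"
    using strict_order_on_irrefl so ab by metis+
  have other: "r' u w = r u w" if "u \<in> I" "w \<in> I" "u \<notin> {a, b} \<or> w \<notin> {a, b}" for u w
    using swap_step_same[OF s] that by blast
  define C where "C v = {w \<in> I - {a, b}. red w \<and> r w v \<and> lev r w \<le> j}" for v
  have fC: "finite (C v)" for v using finI by (simp add: C_def)
  have C': "{w \<in> I - {a, b}. red w \<and> r' w v \<and> lev r' w \<le> j} = C v" if "v \<in> I" for v
    using other that lev_swap_other[OF s] by (auto simp: C_def)
  have Cab: "C b = C a" using adj by (auto simp: C_def)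
  have split: "Areds r v = card (C v) + (if r a v \<and> lev r a \<le> j then 1 else 0) + (if r b v \<and> lev r b \<le> j then 1 else 0)" for v
  proof -
    have "{w \<in> I. red w \<and> r w v \<and> lev r w \<le> j} =
      C v \<union> ((if r a v \<and> lev r a \<le> j then {a} else {}) \<union> (if r b v \<and> lev r b \<le> j then {b} else {}))"
      using ab col by (auto simp: C_def)
    then show ?thesis
      unfolding Areds_def by (rule card_add_two[OF _ fC _ _ ab(5)]) (simp_all add: C_def)
  qed
  have split': "Areds r' v = card (C v) + (if r' a v \<and> lev r' a \<le> j then 1 else 0) + (if r' b v \<and> lev r' b \<le> j then 1 else 0)"
    if "v \<in> I" for v
  proof -
    have "{w \<in> I. red w \<and> r' w v \<and> lev r' w \<le> j} =
      C v \<union> ((if r' a v \<and> lev r' a \<le> j then {a} else {}) \<union> (if r' b v \<and> lev r' b \<le> j then {b} else {}))"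
      unfolding C'[OF that, symmetric] using ab col by auto
    then show ?thesis
      unfolding Areds_def by (rule card_add_two[OF _ fC _ _ ab(5)]) (simp_all add: C_def)
  qed
  consider "x \<noteq> a" "x \<noteq> b" | "x = a" | "x = b" by blast
  then show ?thesis
  proof cases
    case 1
    then have "Areds r' x = Areds r x"
      using split[of x] split'[of x] adj[of x] other[of a x] other[of b x] xe levs ab low by auto
    then show ?thesis using offx lev_swap_other[OF s xe(1) 1] xe by auto
  next
    case 2
    then show ?thesis
      using split[of a] split'[of a] offx levs xe ab nb irr low by auto
  next
    case 3
    have "Ablues r e \<ge> Areds r b"
    proof (cases "swap_lev r a b < j")
      case True
      then show ?thesis using split[of b] split'[of b] offx levs 3 ab nb irr Cab by auto
    next
      case False
      then have "Areds r b = Ablues r b"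
        using active_balance_below[OF so(1) ab(2)] levs low col by auto
      then show ?thesis using Areds_mono(2)[OF so(1) ab(2) xe(2)] xe 3 by simp
    qed
    then show ?thesis using 3 xe by simp
  qed
qed

text \<open>Now \<open>a\<close>, which moves up, loses: its rank among the blues rises by one, or
  it becomes inactive. In the second case \<open>Areds r a = Suc (Ablues r a)\<close>, and an active
  red below \<open>a\<close> has rank less than \<open>Areds r a\<close>, so again only equality is
  left.\<close>

lemma linked_swap_blue:
  assumes s: "swap_step r r' a b" and col: "\<not> red a" "\<not> red b" and low: "swap_lev r a b \<le> j"
    and on: "linked r x e" and off: "\<not> linked r' x e"
  shows "e = a \<and> Areds r x = Ablues r a"
proof -
  have so: "strict_order_on I r" "strict_order_on I r'" and ab: "a \<in> I" "b \<in> I" "r a b" "r' b a" "a \<noteq> b"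
    using s by (auto simp: swap_step_def)
  have levs: "lev r a = swap_lev r a b" "lev r b = Suc (swap_lev r a b)"
    "lev r' a = Suc (swap_lev r a b)" "lev r' b = swap_lev r a b"
    using lev_swap_before[OF s] lev_swap_after[OF s] col by auto
  have xe: "x \<in> I" "e \<in> I" "red x" "\<not> red e" "r x e" "lev r x \<le> j" "lev r e \<le> j" "Ablues r e \<le> Areds r x"
    using on by (auto simp: linked_def)
  have redl: "lev r' w = lev r w" if "w \<in> I" "red w" for w
    using lev_swap_other[OF s that(1)] that col by blast
  have ordr: "r' u w = r u w" "r' w u = r w u" if "w \<in> I" "red w" "u \<in> I" for u w
    using swap_step_same[OF s] that col by auto
  have Ax: "Areds r' x = Areds r x"
    unfolding Areds_def using redl ordr xe by (intro arg_cong[where f=card]) auto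
  have offe: "lev r' e \<le> j \<Longrightarrow> Areds r x < Ablues r' e"
    using off xe redl ordr Ax by (auto simp: linked_def)
  have adj: "r a w = r b w" "r w a = r w b" if "w \<in> I" "w \<noteq> a" "w \<noteq> b" for w
    using swap_step_adjacent[OF s that] by auto
  have nb: "\<not> r b a" "\<not> r' a b" using swap_step_not[OF s] swap_step_not[OF swap_step_sym[OF s]] by auto
  have irr: "\<not> r a a" "\<not> r b b" "\<not> r' a a" "\<not> r' b b"
    using strict_order_on_irrefl so ab by metis+
  have other: "r' u w = r u w" if "u \<in> I" "w \<in> I" "u \<notin> {a, b} \<or> w \<notin> {a, b}" for u w
    using swap_step_same[OF s] that by blast
  define C where "C v = {w \<in> I - {a, b}. \<not> red w \<and> r w v \<and> lev r w \<le> j}" for v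
  have fC: "finite (C v)" for v using finI by (simp add: C_def)
  have C': "{w \<in> I - {a, b}. \<not> red w \<and> r' w v \<and> lev r' w \<le> j} = C v" if "v \<in> I" for v
    using other that lev_swap_other[OF s] by (auto simp: C_def)
  have Cab: "C b = C a" using adj by (auto simp: C_def)
  have split: "Ablues r v = card (C v) + (if r a v \<and> lev r a \<le> j then 1 else 0) + (if r b v \<and> lev r b \<le> j then 1 else 0)" for v
  proof -
    have "{w \<in> I. \<not> red w \<and> r w v \<and> lev r w \<le> j} =
      C v \<union> ((if r a v \<and> lev r a \<le> j then {a} else {}) \<union> (if r b v \<and> lev r b \<le> j then {b} else {}))"
      using ab col by (auto simp: C_def)
    then show ?thesis
      unfolding Ablues_def by (rule card_add_two[OF _ fC _ _ ab(5)]) (simp_all add: C_def)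
  qed
  have split': "Ablues r' v = card (C v) + (if r' a v \<and> lev r' a \<le> j then 1 else 0) + (if r' b v \<and> lev r' b \<le> j then 1 else 0)"
    if "v \<in> I" for v
  proof -
    have "{w \<in> I. \<not> red w \<and> r' w v \<and> lev r' w \<le> j} =
      C v \<union> ((if r' a v \<and> lev r' a \<le> j then {a} else {}) \<union> (if r' b v \<and> lev r' b \<le> j then {b} else {}))"
      unfolding C'[OF that, symmetric] using ab col by auto
    then show ?thesis
      unfolding Ablues_def by (rule card_add_two[OF _ fC _ _ ab(5)]) (simp_all add: C_def)
  qed
  consider "e \<noteq> a" "e \<noteq> b" | "e = b" | "e = a" by blast
  then show ?thesis
  proof cases
    case 1
    then have "Ablues r' e = Ablues r e"
      using split[of e] split'[of e] adj[of e] other[of a e] other[of b e] xe levs ab low by auto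
    then show ?thesis using offe lev_swap_other[OF s xe(2) 1] xe by auto
  next
    case 2
    then show ?thesis
      using split[of b] split'[of b] offe levs xe ab nb irr low Cab by auto
  next
    case 3
    have "Areds r x \<le> Ablues r a"
    proof (cases "swap_lev r a b < j")
      case True
      then show ?thesis using split[of a] split'[of a] offe levs 3 ab nb irr by auto
    next
      case False
      then have "Areds r a = Suc (Ablues r a)"
        using active_balance_below[OF so(1) ab(1)] levs low col by auto
      then show ?thesis using Areds_strict_mono[OF so(1) xe(1) ab(1)] xe 3 by simp
    qed
    then show ?thesis using 3 xe by simp
  qed
qed

text \<open>One end of the lost link is a swapped point, and the equality of ranks fixes the other
  end, since ranks are injective on the active points of one colour.\<close>

lemma linked_swap_mono_unique:
  assumes s: "swap_step r r' a b" and col: "red a \<longleftrightarrow> red b" and low: "swap_lev r a b \<le> j"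
    and "linked r x e" "\<not> linked r' x e" "linked r x' e'" "\<not> linked r' x' e'"
  shows "(x, e) = (x', e')"
proof -
  have so: "strict_order_on I r" using s by (simp add: swap_step_def)
  have mem: "x \<in> I" "red x" "lev r x \<le> j" "x' \<in> I" "red x'" "lev r x' \<le> j"
    "e \<in> I" "\<not> red e" "lev r e \<le> j" "e' \<in> I" "\<not> red e'" "lev r e' \<le> j"
    using assms(4,6) by (auto simp: linked_def)
  show ?thesis
  proof (cases "red a")
    case True
    then show ?thesis
      using linked_swap_red[OF s _ _ low assms(4,5)] linked_swap_red[OF s _ _ low assms(6,7)] col
        Ablues_inj[OF so, of e e'] mem by simp
  next
    case False
    then show ?thesis
      using linked_swap_blue[OF s _ _ low assms(4,5)] linked_swap_blue[OF s _ _ low assms(6,7)] col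
        Areds_inj[OF so, of x x'] mem by simp
  qed
qed

end

section \<open>Counting low swaps along a closed sweep\<close>

context two_coloured
begin

text \<open>A low swap of a blue \<open>e\<close> below a red \<open>x\<close> creates the link
  \<open>(x, e)\<close>, which must be lost again before the sweep closes. The reverse swap of the
  pair is too high by \<open>opp\<close>, and other swaps of different colours leave the link alone.
  So a low swap of equal colours destroys it, and no such swap destroys two links.\<close>

lemma cyclic_sweep:
  fixes ev :: "nat \<Rightarrow> 'a \<times> 'a"
  assumes steps: "\<And>s. s < m \<Longrightarrow> swap_step (r s) (r (Suc s)) (fst (ev s)) (snd (ev s))"
    and cyc: "r m = r 0"
    and opp: "\<And>s s' x e. s < m \<Longrightarrow> s' < m \<Longrightarrow> red x \<Longrightarrow> \<not> red e \<Longrightarrow> ev s = (e, x) \<Longrightarrow>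
      ev s' = (x, e) \<Longrightarrow> swap_lev (r s) e x \<le> j \<Longrightarrow> j < swap_lev (r s') x e"
  shows "card {(x, e). red x \<and> \<not> red e \<and> (\<exists>s<m. ev s = (e, x) \<and> swap_lev (r s) e x \<le> j)} \<le>
    card {s. s < m \<and> (red (fst (ev s)) \<longleftrightarrow> red (snd (ev s))) \<and> swap_lev (r s) (fst (ev s)) (snd (ev s)) \<le> j}"
    (is "card ?L \<le> card ?M")
proof -
  have "\<exists>s\<in>?M. linked (r s) (fst p) (snd p) \<and> \<not> linked (r (Suc s)) (fst p) (snd p)" if "p \<in> ?L" for p
  proof -
    obtain x e s0 where p: "p = (x, e)" "red x" "\<not> red e" "s0 < m" "ev s0 = (e, x)" "swap_lev (r s0) e x \<le> j"
      using \<open>p \<in> ?L\<close> by auto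
    have st0: "swap_step (r s0) (r (Suc s0)) e x" using steps[OF p(4)] p(5) by simp
    note rs = swap_step_sym[OF st0] swap_lev_sym[OF st0]
    have on: "linked (r (Suc s0)) x e" and off: "\<not> linked (r s0) x e"
      using linked_swap_cross(1,2)[OF rs(1)] p rs(2) by auto
    \<comment> \<open>A link that is never lost would last from \<open>Suc s0\<close> to the end,
      pass through \<open>cyc\<close> to time 0, and then last until \<open>s0\<close>, where it is
      absent.\<close>
    have "\<exists>s<m. linked (r s) x e \<and> \<not> linked (r (Suc s)) x e"
    proof (rule ccontr)
      assume "\<not> ?thesis"
      then have keep: "linked (r (Suc s)) x e" if "s < m" "linked (r s) x e" for s
        using that by blast
      have up: "linked (r t) x e" if "Suc s0 \<le> t" "t \<le> m" for t
        using that by (induction t rule: dec_induct) (auto simp: on intro: keep)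
      then have "linked (r 0) x e" using cyc p(4) by (metis Suc_leI order_refl)
      then have "linked (r t) x e" if "t \<le> m" for t
        using that by (induction t) (auto intro: keep)
      then show False using off p(4) by simp
    qed
    then obtain s where s: "s < m" "linked (r s) x e" "\<not> linked (r (Suc s)) x e" by blast
    obtain a b where ab: "ev s = (a, b)" by fastforce
    have st: "swap_step (r s) (r (Suc s)) a b" using steps[OF s(1)] ab by simp
    have low: "swap_lev (r s) a b \<le> j"
      using linked_swap_high[OF st, of x e] s by (meson not_le)
    have "red a \<longleftrightarrow> red b"
    proof (rule ccontr)
      assume "\<not> ?thesis"
      then consider "red a" "\<not> red b" | "red b" "\<not> red a" by blast
      then show False
      proof cases
        case 1
        then have "(x, e) = (a, b)" using linked_swap_cross(3)[OF st 1 low, of x e] s by blast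
        then show False using opp[OF p(4) s(1) p(2,3,5) _ p(6)] ab low by auto
      next
        case 2
        \<comment> \<open>Read backwards, the swap destroys the link \<open>(b, a)\<close> and
          preserves all others; read forwards it therefore destroys none.\<close>
        note rs = swap_step_sym[OF st] swap_lev_sym[OF st]
        have low': "swap_lev (r (Suc s)) b a \<le> j" using low rs(2) by simp
        show False
          using linked_swap_cross(1)[OF rs(1) 2 low'] linked_swap_cross(3)[OF rs(1) 2 low', of x e] s by blast
      qed
    qed
    then show ?thesis using s ab low p(1) by auto
  qed
  then have "\<forall>p\<in>?L. \<exists>s. s \<in> ?M \<and> linked (r s) (fst p) (snd p) \<and> \<not> linked (r (Suc s)) (fst p) (snd p)"
    by blast
  from bchoice[OF this] obtain f where
    f': "\<forall>p\<in>?L. f p \<in> ?M \<and> linked (r (f p)) (fst p) (snd p) \<and> \<not> linked (r (Suc (f p))) (fst p) (snd p)" ..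
  have f: "f p \<in> ?M" "linked (r (f p)) (fst p) (snd p) \<and> \<not> linked (r (Suc (f p))) (fst p) (snd p)" if "p \<in> ?L" for p
    using bspec[OF f' that] by blast+
  have "inj_on f ?L"
  proof (rule inj_onI)
    fix p q assume pq: "p \<in> ?L" "q \<in> ?L" "f p = f q"
    have M: "f p < m" "red (fst (ev (f p))) \<longleftrightarrow> red (snd (ev (f p)))"
      "swap_lev (r (f p)) (fst (ev (f p))) (snd (ev (f p))) \<le> j"
      using f(1)[OF pq(1)] by auto
    show "p = q"
      using linked_swap_mono_unique[OF steps[OF M(1)] M(2,3), of "fst p" "snd p" "fst q" "snd q"]
        f(2)[OF pq(1)] f(2)[OF pq(2)] pq(3) by (simp add: prod_eq_iff)
  qed
  then show ?thesis
    by (rule card_inj_on_le) (use f(1) in auto)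
qed

end

text \<open>The samples \<open>\<phi>\<close> interleave the increasing enumeration
  \<open>bs\<close>. The bound \<open>c\<close> serves the induction on the largest element: the
  samples for the smaller elements have to end below the new one.\<close>

lemma finite_reals_samples:
  fixes B :: "real set"
  assumes "finite B" "\<And>b. b \<in> B \<Longrightarrow> b < c"
  shows "\<exists>\<phi> bs. bij_betw bs {..<card B} B \<and> (\<forall>s<card B. \<phi> s < bs s \<and> bs s < \<phi> (Suc s)) \<and>
    (\<forall>s<card B. \<forall>b\<in>B. \<phi> s \<le> b \<and> b \<le> \<phi> (Suc s) \<longrightarrow> b = bs s) \<and>
    (\<forall>b\<in>B. \<phi> 0 < b \<and> b < \<phi> (card B)) \<and> (\<phi> (card B) :: real) < c"
  using assms
proof (induction B arbitrary: c rule: finite_linorder_max_induct)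
  case empty
  show ?case by (rule exI[of _ "\<lambda>_. c - 1"]) (auto simp: bij_betw_def)
next
  case (insert b A)
  from insert.IH[of b] insert.hyps obtain \<phi> bs where
    IH: "bij_betw bs {..<card A} A" "\<And>s. s < card A \<Longrightarrow> \<phi> s < bs s \<and> bs s < \<phi> (Suc s)"
      "\<And>s b. s < card A \<Longrightarrow> b \<in> A \<Longrightarrow> \<phi> s \<le> b \<Longrightarrow> b \<le> \<phi> (Suc s) \<Longrightarrow> b = bs s"
      "\<And>b. b \<in> A \<Longrightarrow> \<phi> 0 < b \<and> b < \<phi> (card A)" "\<phi> (card A) < b"
    by blast
  have bA: "b \<notin> A" using insert.hyps by auto
  then have card: "card (insert b A) = Suc (card A)" using insert.hyps by simp
  define \<phi>' where "\<phi>' = \<phi>(Suc (card A) := (b + c) / 2)"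
  define bs' where "bs' = bs(card A := b)"
  have bc: "b < c" using insert.prems by simp
  have \<phi>': "\<phi>' s = \<phi> s" if "s \<le> card A" for s using that by (simp add: \<phi>'_def)
  have \<phi>'1: "\<phi>' (Suc (card A)) = (b + c) / 2" by (simp add: \<phi>'_def)
  have mono: "\<phi> s \<le> \<phi> (card A)" if "s \<le> card A" for s
    using that
  proof (induction s rule: inc_induct)
    case (step n)
    then show ?case using IH(2)[of n] by linarith
  qed simp
  have "bij_betw bs' {..<card (insert b A)} (insert b A)"
  proof -
    have "bij_betw bs' {..<card A} A"
      using IH(1) by (rule bij_betw_cong[THEN iffD1, rotated]) (simp add: bs'_def)
    then have "bij_betw bs' ({..<card A} \<union> {card A}) (A \<union> {b})"
      using bA by (intro bij_betw_combine) (auto simp: bs'_def)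
    moreover have "{..<card (insert b A)} = {..<card A} \<union> {card A}" using card by auto
    ultimately show ?thesis by simp
  qed
  moreover have "\<phi>' s < bs' s \<and> bs' s < \<phi>' (Suc s)" if "s < card (insert b A)" for s
    using that IH(2)[of s] IH(5) bc card by (cases "s = card A") (auto simp: \<phi>' \<phi>'1 bs'_def)
  moreover have "b' = bs' s" if "s < card (insert b A)" "b' \<in> insert b A" "\<phi>' s \<le> b'" "b' \<le> \<phi>' (Suc s)" for s b'
  proof (cases "s = card A")
    case True
    then show ?thesis using that IH(4)[of b'] by (auto simp: \<phi>' bs'_def)
  next
    case False
    then have s: "s < card A" using that card by simp
    then have "b' \<noteq> b" using that(4) mono[of "Suc s"] IH(5) by (auto simp: \<phi>')
    then show ?thesis using IH(3)[OF s] that s by (auto simp: \<phi>' bs'_def)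
  qed
  moreover have "\<phi>' 0 < b' \<and> b' < \<phi>' (card (insert b A))" if "b' \<in> insert b A" for b'
    using that IH(4)[of b'] IH(5) bc mono[of 0] card by (auto simp: \<phi>' \<phi>'1)
  moreover have "\<phi>' (card (insert b A)) < c" using bc card \<phi>'1 by simp
  ultimately show ?case by blast
qed

section \<open>Vector configurations in general position\<close>

lemma cramer_cross3:
  fixes a b c z :: "real^3"
  shows "inner (cross3 a b) c *\<^sub>R z =
    inner (cross3 b c) z *\<^sub>R a + inner (cross3 c a) z *\<^sub>R b + inner (cross3 a b) z *\<^sub>R c"
  by (simp add: vec_eq_iff forall_3 cross3_def inner_vec_def sum_3 vector_3) algebra

text \<open>Moving \<open>g\<close> along the new vector \<open>b0\<close>, each element of the set
  rules out at most one value of the step length.\<close>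

lemma exists_nonorthogonal:
  fixes N :: "'b::real_inner set"
  assumes "finite N" "0 \<notin> N"
  shows "\<exists>g. \<forall>b\<in>N. inner g b \<noteq> 0"
  using assms
proof (induction N)
  case empty
  show ?case by simp
next
  case (insert b0 N)
  then obtain g where g: "\<And>b. b \<in> N \<Longrightarrow> inner g b \<noteq> 0" by auto
  have b0: "inner b0 b0 \<noteq> 0" using insert.prems by simp
  define bad where "bad = (\<lambda>b. - inner g b / inner b0 b) ` insert b0 N"
  have "finite bad" using insert.hyps by (simp add: bad_def)
  then obtain \<epsilon> where \<epsilon>: "\<epsilon> \<notin> bad" "\<epsilon> \<noteq> 0"
    using ex_new_if_finite[of "insert 0 bad"] infinite_UNIV_char_0 by auto
  have "inner (g + \<epsilon> *\<^sub>R b0) b \<noteq> 0" if "b \<in> insert b0 N" for b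
  proof
    assume z: "inner (g + \<epsilon> *\<^sub>R b0) b = 0"
    then have e: "inner g b + \<epsilon> * inner b0 b = 0" by (simp add: inner_add_left)
    show False
    proof (cases "inner b0 b = 0")
      case True
      then show False using e g that b0 by auto
    next
      case False
      then have "\<epsilon> = - inner g b / inner b0 b" using e by (simp add: field_simps add_eq_0_iff)
      then show False using \<epsilon> that by (auto simp: bad_def)
    qed
  qed
  then show ?case by blast
qed

lemma real_linear_same_sign:
  fixes d t c s s' :: real
  assumes "\<not> (s \<le> c \<and> c \<le> s')" "s \<le> t" "t \<le> s'" "s \<le> t'" "t' \<le> s'"
  shows "0 < d * (t - c) \<longleftrightarrow> 0 < d * (t' - c)"
  using assms by (auto simp: zero_less_mult_iff)

locale vector_config =
  fixes n :: nat and V :: "nat \<Rightarrow> real^3"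
  assumes n3: "3 \<le> n"
    and gp: "\<And>a b c. a \<in> {1..n} \<Longrightarrow> b \<in> {1..n} \<Longrightarrow> c \<in> {1..n} \<Longrightarrow> a \<noteq> b \<Longrightarrow> b \<noteq> c \<Longrightarrow> a \<noteq> c \<Longrightarrow>
      inner (cross3 (V a) (V b)) (V c) \<noteq> 0"
begin

definition orient :: "nat \<Rightarrow> nat \<Rightarrow> nat \<Rightarrow> real" where
  "orient a b c = inner (cross3 (V a) (V b)) (V c)"

definition left :: "nat \<Rightarrow> nat \<Rightarrow> nat" where
  "left a b = card {c \<in> {1..n}. 0 < orient a b c}"

lemma orient_refl [simp]: "orient a b a = 0" "orient a b b = 0" "orient a a b = 0"
  by (simp_all add: orient_def dot_cross_self)

lemma orient_swap: "orient b a c = - orient a b c"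
  by (simp add: orient_def cross_skew[of "V b" "V a"])

lemma orient_cycle: "orient b c a = orient a b c"
  by (simp add: orient_def cross3_def inner_vec_def sum_3 vector_3) algebra

lemma orient_nonzero:
  "a \<in> {1..n} \<Longrightarrow> b \<in> {1..n} \<Longrightarrow> c \<in> {1..n} \<Longrightarrow> a \<noteq> b \<Longrightarrow> b \<noteq> c \<Longrightarrow> a \<noteq> c \<Longrightarrow> orient a b c \<noteq> 0"
  using gp by (simp add: orient_def)

lemma left_add_left:
  assumes "a \<in> {1..n}" "b \<in> {1..n}" "a \<noteq> b"
  shows "left a b + left b a = n - 2"
proof -
  have "{c \<in> {1..n}. 0 < orient a b c} \<union> {c \<in> {1..n}. 0 < orient b a c} = {1..n} - {a, b}"
    using orient_nonzero[OF assms(1,2) _ assms(3)] by (auto simp: orient_swap[of b a]) (metis less_linear orient_refl(1,2) neg_0_less_iff_less)+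
  moreover have "{c \<in> {1..n}. 0 < orient a b c} \<inter> {c \<in> {1..n}. 0 < orient b a c} = {}"
    by (auto simp: orient_swap[of b a])
  ultimately have "left a b + left b a = card ({1..n} - {a, b})"
    unfolding left_def by (metis (no_types, lifting) card_Un_disjoint finite_atLeastAtMost finite_subset mem_Collect_eq subsetI)
  then show ?thesis using assms by simp
qed

end

section \<open>The rotational sweep\<close>

text \<open>The normal of the plane spanned by \<open>a\<close> and \<open>b\<close>, expanded in
  the frame \<open>f\<close>, \<open>g\<close>, \<open>w\<close> using only the values of these
  three functionals on \<open>a\<close> and \<open>b\<close>.\<close>

lemma cross3_coordinates:
  fixes a b f g w :: "real^3"
  shows "inner f (cross3 g w) *\<^sub>R cross3 a b =
    (inner f a * inner g b - inner f b * inner g a) *\<^sub>R w +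
    (inner g a * inner w b - inner g b * inner w a) *\<^sub>R f +
    (inner w a * inner f b - inner w b * inner f a) *\<^sub>R g"
  by (simp add: vec_eq_iff forall_3 cross3_def inner_vec_def sum_3 vector_3) algebra

text \<open>The iterated cross product spans the intersection of two planes. In the affine plane
  \<open>inner w x = 1\<close> the condition says that no vector goes to infinity and that no two
  lines through disjoint pairs of points are parallel.\<close>

definition generic_for :: "nat \<Rightarrow> (nat \<Rightarrow> real^3) \<Rightarrow> real^3 \<Rightarrow> bool" where
  "generic_for n V w \<longleftrightarrow> (\<forall>i\<in>{1..n}. inner w (V i) \<noteq> 0) \<and>
    (\<forall>a\<in>{1..n}. \<forall>b\<in>{1..n}. \<forall>c\<in>{1..n}. \<forall>d\<in>{1..n}. a \<noteq> b \<longrightarrow> c \<noteq> d \<longrightarrow> {a, b} \<inter> {c, d} = {} \<longrightarrow>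
      inner w (cross3 (cross3 (V a) (V b)) (cross3 (V c) (V d))) \<noteq> 0)"

text \<open>\<open>slopes\<close> gives every pair of points exactly one finite parameter at which
  their order changes; \<open>frame\<close> fixes the orientation, hence the sign that relates
  heights to \<open>orient\<close>.\<close>

locale planar_sweep = vector_config +
  fixes w f g :: "real^3"
  assumes gen: "generic_for n V w"
    and frame: "0 < inner f (cross3 g w)"
    and slopes: "\<And>a b. a \<in> {1..n} \<Longrightarrow> b \<in> {1..n} \<Longrightarrow> a \<noteq> b \<Longrightarrow>
      inner g (V a) / inner w (V a) \<noteq> inner g (V b) / inner w (V b)"
begin

abbreviation wt :: "nat \<Rightarrow> real" where "wt i \<equiv> inner w (V i)"

text \<open>
  Dividing by \<open>wt i\<close> projects red and blue vectors alike to the affine plane \<open>inner w x = 1\<close>. There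
  \<open>key i t\<close> is the height of the point in direction \<open>f + t g\<close>, and \<open>meet a b\<close> is the parameter at
  which \<open>a\<close> and \<open>b\<close> have the same height. The sign \<open>\<sigma>\<close> in \<open>ord\<close> serves to run through the line of parameters twice, the second
  time with the heights negated, so that the sweep closes up.
\<close>

definition xc :: "nat \<Rightarrow> real" where "xc i = inner f (V i) / wt i"
definition yc :: "nat \<Rightarrow> real" where "yc i = inner g (V i) / wt i"
definition key :: "nat \<Rightarrow> real \<Rightarrow> real" where "key i t = xc i + t * yc i"
definition meet :: "nat \<Rightarrow> nat \<Rightarrow> real" where "meet a b = (xc b - xc a) / (yc a - yc b)"

definition ord :: "real \<Rightarrow> real \<Rightarrow> nat \<Rightarrow> nat \<Rightarrow> bool" where
  "ord \<sigma> t u v \<longleftrightarrow> u \<in> {1..n} \<and> v \<in> {1..n} \<and> 0 < \<sigma> * (key v t - key u t)"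

lemma wt_nonzero: "i \<in> {1..n} \<Longrightarrow> wt i \<noteq> 0"
  using gen by (simp add: generic_for_def)

lemma yc_inj: "a \<in> {1..n} \<Longrightarrow> b \<in> {1..n} \<Longrightarrow> a \<noteq> b \<Longrightarrow> yc a \<noteq> yc b"
  using slopes by (simp add: yc_def)

lemma meet_commute: "meet b a = meet a b"
  by (simp add: meet_def divide_simps) (simp add: algebra_simps)

lemma key_diff:
  assumes "a \<in> {1..n}" "b \<in> {1..n}" "a \<noteq> b"
  shows "key a t - key b t = (yc a - yc b) * (t - meet a b)"
  using yc_inj[OF assms] by (simp add: key_def meet_def field_simps)

text \<open>The sweep functional at the meeting parameter, corrected by a multiple of
  \<open>w\<close> so that it vanishes on \<open>V a\<close> and \<open>V b\<close>; hence it is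
  parallel to their cross product.\<close>

definition axis :: "nat \<Rightarrow> nat \<Rightarrow> real^3" where
  "axis a b = f + meet a b *\<^sub>R g - key a (meet a b) *\<^sub>R w"

lemma cross_axis:
  assumes "a \<in> {1..n}" "b \<in> {1..n}" "a \<noteq> b"
  shows "inner f (cross3 g w) *\<^sub>R cross3 (V a) (V b) = (wt a * wt b * (yc a - yc b)) *\<^sub>R axis a b"
proof -
  note wn = wt_nonzero[OF assms(1)] wt_nonzero[OF assms(2)]
  have F: "inner f (V i) = wt i * xc i" "inner g (V i) = wt i * yc i" if "i \<in> {1..n}" for i
    using wt_nonzero[OF that] by (simp_all add: xc_def yc_def)
  have m: "(yc a - yc b) * meet a b = xc b - xc a" using yc_inj[OF assms] by (simp add: meet_def)
  have k: "(yc a - yc b) * key a (meet a b) = xc b * yc a - xc a * yc b"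
  proof -
    have "(yc a - yc b) * key a (meet a b) = (yc a - yc b) * xc a + ((yc a - yc b) * meet a b) * yc a"
      by (simp add: key_def algebra_simps)
    then show ?thesis unfolding m by (simp add: algebra_simps)
  qed
  have c1: "inner f (V a) * inner g (V b) - inner f (V b) * inner g (V a) =
      - (wt a * wt b * ((yc a - yc b) * key a (meet a b)))"
    unfolding k F[OF assms(1)] F[OF assms(2)] by (simp add: algebra_simps)
  have c2: "inner g (V a) * wt b - inner g (V b) * wt a = wt a * wt b * (yc a - yc b)"
    unfolding F[OF assms(1)] F[OF assms(2)] by (simp add: algebra_simps)
  have c3: "wt a * inner f (V b) - wt b * inner f (V a) = wt a * wt b * ((yc a - yc b) * meet a b)"
    unfolding m F[OF assms(1)] F[OF assms(2)] by (simp add: algebra_simps)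
  show ?thesis
    unfolding cross3_coordinates c1 c2 c3 axis_def
    by (simp add: scaleR_right_diff_distrib scaleR_add_right mult.assoc)
qed

lemma inner_axis:
  "u \<in> {1..n} \<Longrightarrow> inner (axis a b) (V u) = wt u * (key u (meet a b) - key a (meet a b))"
  using wt_nonzero[of u]
  by (simp add: axis_def key_def xc_def yc_def inner_diff_left inner_add_left field_simps)

lemma orient_axis:
  assumes "a \<in> {1..n}" "b \<in> {1..n}" "a \<noteq> b"
  shows "inner f (cross3 g w) * orient a b u = wt a * wt b * (yc a - yc b) * inner (axis a b) (V u)"
  using arg_cong[OF cross_axis[OF assms], of "\<lambda>z. inner z (V u)"] by (simp add: orient_def)

text \<open>For disjoint pairs the two axes would differ by a multiple of \<open>w\<close>, so the
  two lines would be parallel; with a common point, three vectors would lie in a plane. Consequently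
  the sweep passes one adjacent swap at a time.\<close>

lemma meet_inj:
  assumes ab: "a \<in> {1..n}" "b \<in> {1..n}" "a \<noteq> b" and cd: "c \<in> {1..n}" "d \<in> {1..n}" "c \<noteq> d"
    and eq: "meet a b = meet c d"
  shows "{a, b} = {c, d}"
proof (cases "{a, b} \<inter> {c, d} = {}")
  case True
  have ab0: "wt a * wt b * (yc a - yc b) \<noteq> 0" and cd0: "wt c * wt d * (yc c - yc d) \<noteq> 0"
    using wt_nonzero yc_inj ab cd by auto
  let ?\<delta> = "inner f (cross3 g w)"
  have ax: "axis c d = axis a b + (key a (meet a b) - key c (meet a b)) *\<^sub>R w"
    using eq by (simp add: axis_def algebra_simps)
  have "inner w (cross3 (axis a b) (axis c d)) = 0"
    by (simp add: ax cross_add_right cross_mult_right dot_cross_self)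
  then have "inner w (cross3 (?\<delta> *\<^sub>R cross3 (V a) (V b)) (?\<delta> *\<^sub>R cross3 (V c) (V d))) = 0"
    unfolding cross_axis[OF ab] cross_axis[OF cd] by (simp add: cross_mult_left cross_mult_right)
  then have "inner w (cross3 (cross3 (V a) (V b)) (cross3 (V c) (V d))) = 0"
    using frame by (simp add: cross_mult_left cross_mult_right)
  then show ?thesis using gen ab cd True unfolding generic_for_def by blast
next
  case False
  have main: "d \<in> {a, b}" if "c \<in> {a, b}" "d \<in> {1..n}" "c \<in> {1..n}" "meet c d = meet a b" "c \<noteq> d" for c d
  proof (rule ccontr)
    assume d: "d \<notin> {a, b}"
    let ?t = "meet a b"
    have kab: "key a ?t = key b ?t" using key_diff[OF ab, of ?t] by simp
    have "key c ?t = key d ?t" using key_diff[of c d ?t] that by simp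
    then have "key d ?t = key a ?t" using kab that(1) by auto
    then have "inner (axis a b) (V d) = 0" using inner_axis[OF that(2), of a b] by simp
    then have "orient a b d = 0" using orient_axis[OF ab, of d] frame by simp
    then show False using orient_nonzero[of a b d] ab that d by auto
  qed
  show ?thesis
    using False main[of c d] main[of d c] cd eq by (auto simp: meet_commute[of d c])
qed

lemma ord_meet:
  assumes "u \<in> {1..n}" "v \<in> {1..n}" "u \<noteq> v"
  shows "ord \<sigma> t u v \<longleftrightarrow> 0 < \<sigma> * ((yc v - yc u) * (t - meet u v))"
  using assms key_diff[of v u t] by (simp add: ord_def meet_commute)

lemma ord_strict:
  assumes \<sigma>: "\<sigma> \<noteq> 0" and t: "\<And>u v. u \<in> {1..n} \<Longrightarrow> v \<in> {1..n} \<Longrightarrow> u \<noteq> v \<Longrightarrow> t \<noteq> meet u v"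
  shows "strict_order_on {1..n} (ord \<sigma> t)"
  unfolding strict_order_on_def
proof (intro conjI ballI impI)
  fix u v assume uv: "u \<in> {1..n}" "v \<in> {1..n}" "u \<noteq> v"
  have "\<sigma> * (key v t - key u t) \<noteq> 0" using key_diff[of v u t] yc_inj[of v u] t[of v u] uv \<sigma> by auto
  moreover have "\<sigma> * (key u t - key v t) = - (\<sigma> * (key v t - key u t))" by (simp add: algebra_simps)
  ultimately have "0 < \<sigma> * (key v t - key u t) \<or> 0 < \<sigma> * (key u t - key v t)" by linarith
  then show "ord \<sigma> t u v \<or> ord \<sigma> t v u" using uv by (simp add: ord_def)
next
  fix u v w assume "ord \<sigma> t u v" "ord \<sigma> t v w"
  moreover have "\<sigma> * (key w t - key u t) = \<sigma> * (key w t - key v t) + \<sigma> * (key v t - key u t)"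
    by (simp add: algebra_simps)
  ultimately show "ord \<sigma> t u w" by (auto simp: ord_def)
qed (simp add: ord_def)

end

lemma same_sign_iff_mult_pos:
  fixes x k :: real
  shows "x \<noteq> 0 \<Longrightarrow> k \<noteq> 0 \<Longrightarrow> (0 < x \<and> 0 < k) \<or> (\<not> 0 < x \<and> \<not> 0 < k) \<longleftrightarrow> 0 < x * k"
  by (auto simp: zero_less_mult_iff)

lemma pos_iff_of_scaled_eq:
  fixes d s x y z u :: real
  assumes "0 < d" "0 < s" "x \<noteq> 0" "y \<noteq> 0" "d * u = (x * y) * (s * z)"
  shows "0 < z \<longleftrightarrow> (if 0 < x \<longleftrightarrow> 0 < y then 0 < u else 0 < - u)"
proof -
  have p: "0 < x * y \<longleftrightarrow> (0 < x \<longleftrightarrow> 0 < y)" and p0: "x * y \<noteq> 0"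
    using same_sign_iff_mult_pos[OF assms(3,4)] assms(3,4) by (blast, simp)
  have "u = (x * y) * ((s / d) * z)" using assms(1,5) by (simp add: field_simps)
  moreover have "0 < s / d" using assms by simp
  ultimately obtain q k where q: "0 < k" "u = q * (k * z)" "q \<noteq> 0" "0 < q \<longleftrightarrow> (0 < x \<longleftrightarrow> 0 < y)"
    using p p0 by blast
  show ?thesis
  proof (cases "0 < q")
    case True
    then have "0 < u \<longleftrightarrow> 0 < k * z" using q(2) by (metis zero_less_mult_pos mult_pos_pos)
    then have "0 < u \<longleftrightarrow> 0 < z" using q(1) by (metis zero_less_mult_pos mult_pos_pos)
    then show ?thesis using True q(4) by simp
  next
    case False
    then have "0 < - q" using q(3) by simp
    moreover have "- u = (- q) * (k * z)" using q(2) by simp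
    ultimately have "0 < - u \<longleftrightarrow> 0 < k * z" by (metis zero_less_mult_pos mult_pos_pos)
    then have "0 < - u \<longleftrightarrow> 0 < z" using q(1) by (metis zero_less_mult_pos mult_pos_pos)
    then show ?thesis using False q(4) by simp
  qed
qed

section \<open>The rotation of the configuration as a closed sequence of swaps\<close>

locale coloured_sweep = planar_sweep +
  fixes j :: nat
  assumes many: "j < card {u \<in> {1..n}. 0 < inner w (V u)}" and low: "2 * j + 2 < n"
begin

sublocale two_coloured "{1..n}" "\<lambda>u. 0 < inner w (V u)" j
  by unfold_locales (use many in auto)

lemma swap_step_meet:
  assumes ab: "a \<in> {1..n}" "b \<in> {1..n}" "a \<noteq> b" and \<sigma>: "0 < \<sigma> * (yc a - yc b)"
    and t: "t < meet a b" "meet a b < t'"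
    and only: "\<And>u v. u \<in> {1..n} \<Longrightarrow> v \<in> {1..n} \<Longrightarrow> u \<noteq> v \<Longrightarrow> t \<le> meet u v \<Longrightarrow> meet u v \<le> t' \<Longrightarrow> meet u v = meet a b"
  shows "swap_step (ord \<sigma> t) (ord \<sigma> t') a b"
  unfolding swap_step_def
proof (intro conjI ballI impI)
  have "\<sigma> \<noteq> 0" using \<sigma> by auto
  then show "strict_order_on {1..n} (ord \<sigma> t)" "strict_order_on {1..n} (ord \<sigma> t')"
    using only t by (intro ord_strict; force)+
  show "ord \<sigma> t a b"
    using mult_pos_pos[OF \<sigma>, of "meet a b - t"] t ab by (simp add: ord_meet algebra_simps)
  show "ord \<sigma> t' b a"
    using mult_pos_pos[OF \<sigma>, of "t' - meet a b"] t ab by (simp add: ord_meet meet_commute algebra_simps)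
  fix u v assume uv: "u \<in> {1..n}" "v \<in> {1..n}" "{u, v} \<noteq> {a, b}"
  show "ord \<sigma> t' u v = ord \<sigma> t u v"
  proof (cases "u = v")
    case False
    have "\<not> (t \<le> meet u v \<and> meet u v \<le> t')"
      using only[OF uv(1,2) False] meet_inj[OF uv(1,2) False ab] uv(3) by blast
    then show ?thesis
      unfolding ord_meet[OF uv(1,2) False] mult.assoc[symmetric]
      by (rule real_linear_same_sign) (use t in auto)
  qed (simp add: ord_def)
qed (use ab in auto)

text \<open>Red above or blue below means that \<open>\<sigma>\<close> times the functional
  \<open>axis a b\<close> is positive, so the level counts one side of the plane through
  \<open>a\<close> and \<open>b\<close>. As \<open>\<sigma> * (yc a - yc b)\<close> is positive, the
  sign of \<open>wt a * wt b\<close> alone decides which side.\<close>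

lemma swap_lev_meet:
  assumes ab: "a \<in> {1..n}" "b \<in> {1..n}" "a \<noteq> b" and \<sigma>: "0 < \<sigma> * (yc a - yc b)" "\<sigma> = 1 \<or> \<sigma> = -1"
    and t: "t < meet a b" "meet a b < t'"
    and only: "\<And>u v. u \<in> {1..n} \<Longrightarrow> v \<in> {1..n} \<Longrightarrow> u \<noteq> v \<Longrightarrow> t \<le> meet u v \<Longrightarrow> meet u v \<le> t' \<Longrightarrow> meet u v = meet a b"
  shows "swap_lev (ord \<sigma> t) a b = (if 0 < wt a \<longleftrightarrow> 0 < wt b then left a b else left b a)"
proof -
  let ?d = "inner f (cross3 g w)" and ?m = "meet a b"
  \<comment> \<open>No other point meets \<open>a\<close> between \<open>t\<close> and the meeting
    parameter, so \<open>u\<close> compares with \<open>a\<close> in the same way at both.\<close>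
  have key: "0 < \<sigma> * (key u t - key a t) \<longleftrightarrow> 0 < \<sigma> * (key u ?m - key a ?m)"
    if u: "u \<in> {1..n} - {a, b}" for u
  proof -
    have ua: "u \<in> {1..n}" "u \<noteq> a" using u by auto
    have "{u, a} \<noteq> {a, b}" using u by auto
    then have "\<not> (t \<le> meet u a \<and> meet u a \<le> t')"
      using only[OF ua(1) ab(1) ua(2)] meet_inj[OF ua(1) ab(1) ua(2) ab] by blast
    then show ?thesis
      unfolding key_diff[OF ua(1) ab(1) ua(2)] mult.assoc[symmetric]
      by (rule real_linear_same_sign) (use t in auto)
  qed
  have key0: "\<sigma> * (key u t - key a t) \<noteq> 0" if u: "u \<in> {1..n} - {a, b}" for u
  proof -
    have ua: "u \<in> {1..n}" "u \<noteq> a" using u by auto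
    have "meet u a \<noteq> t"
      using only[OF ua(1) ab(1) ua(2)] meet_inj[OF ua(1) ab(1) ua(2) ab] u t by fastforce
    then show ?thesis using key_diff[OF ua(1) ab(1) ua(2)] yc_inj[OF ua(1) ab(1) ua(2)] \<sigma> by auto
  qed
  have "swap_lev (ord \<sigma> t) a b = card {u \<in> {1..n} - {a, b}. 0 < wt u \<and> ord \<sigma> t a u} +
      card {u \<in> {1..n} - {a, b}. \<not> 0 < wt u \<and> ord \<sigma> t u a}"
    by (rule swap_lev_def)
  also have "\<dots> = card ({u \<in> {1..n} - {a, b}. 0 < wt u \<and> ord \<sigma> t a u} \<union>
      {u \<in> {1..n} - {a, b}. \<not> 0 < wt u \<and> ord \<sigma> t u a})"
    by (rule card_Un_disjoint[symmetric]) auto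
  also have "{u \<in> {1..n} - {a, b}. 0 < wt u \<and> ord \<sigma> t a u} \<union>
      {u \<in> {1..n} - {a, b}. \<not> 0 < wt u \<and> ord \<sigma> t u a} =
      {u \<in> {1..n} - {a, b}. 0 < \<sigma> * inner (axis a b) (V u)}"
  proof -
    have "(0 < wt u \<and> ord \<sigma> t a u \<or> \<not> 0 < wt u \<and> ord \<sigma> t u a) \<longleftrightarrow> 0 < \<sigma> * inner (axis a b) (V u)"
      if u: "u \<in> {1..n} - {a, b}" for u
    proof -
      have ua: "u \<in> {1..n}" using u by simp
      let ?k = "\<sigma> * (key u ?m - key a ?m)"
      have "\<sigma> * (key a t - key u t) = - (\<sigma> * (key u t - key a t))" by (simp add: algebra_simps)
      then have "0 < \<sigma> * (key a t - key u t) \<longleftrightarrow> \<not> 0 < \<sigma> * (key u t - key a t)"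
        using key0[OF u] by linarith
      then have "ord \<sigma> t u a \<longleftrightarrow> \<not> 0 < \<sigma> * (key u t - key a t)"
        using ua ab by (simp add: ord_def)
      then have o: "ord \<sigma> t a u \<longleftrightarrow> 0 < ?k" "ord \<sigma> t u a \<longleftrightarrow> \<not> 0 < ?k"
        using key[OF u] ua ab by (simp_all add: ord_def)
      have k0: "?k \<noteq> 0"
      proof
        assume "?k = 0"
        then have "key u ?m - key a ?m = 0" using \<sigma>(2) by auto
        then have "orient a b u = 0" using orient_axis[OF ab, of u] inner_axis[OF ua, of a b] frame by simp
        then show False using orient_nonzero[of a b u] ab u by auto
      qed
      have ia: "\<sigma> * inner (axis a b) (V u) = wt u * ?k" by (simp add: inner_axis[OF ua])
      then show ?thesis
        unfolding o ia by (intro same_sign_iff_mult_pos wt_nonzero[OF ua] k0)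
    qed
    then show ?thesis by blast
  qed
  also have "\<dots> = (if 0 < wt a \<longleftrightarrow> 0 < wt b then {u \<in> {1..n}. 0 < orient a b u} else {u \<in> {1..n}. 0 < orient b a u})"
  proof -
    have "0 < \<sigma> * inner (axis a b) (V u) \<longleftrightarrow> (if 0 < wt a \<longleftrightarrow> 0 < wt b then 0 < orient a b u else 0 < orient b a u)"
      for u
    proof -
      have "0 < ?d * (\<sigma> * \<sigma>)" using frame \<sigma>(2) by auto
      moreover have "(?d * (\<sigma> * \<sigma>)) * orient a b u = (wt a * wt b) * ((\<sigma> * (yc a - yc b)) * (\<sigma> * inner (axis a b) (V u)))"
        using orient_axis[OF ab, of u] \<sigma>(2) by (auto simp: algebra_simps)
      ultimately show ?thesis
        unfolding orient_swap[of b a]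
        by (intro pos_iff_of_scaled_eq[OF _ \<sigma>(1) wt_nonzero[OF ab(1)] wt_nonzero[OF ab(2)]])
    qed
    then show ?thesis using ab by (auto simp: inner_axis)
  qed
  finally show ?thesis by (simp add: left_def)
qed

text \<open>Every unordered pair once, in the orientation of the pass with sign 1: the point with
  the larger \<open>yc\<close> lies below until the two meet.\<close>

definition swaps :: "(nat \<times> nat) set" where
  "swaps = {(a, b). a \<in> {1..n} \<and> b \<in> {1..n} \<and> yc b < yc a}"

lemma finite_swaps: "finite swaps"
  by (rule finite_subset[of _ "{1..n} \<times> {1..n}"]) (auto simp: swaps_def)

lemma meet_inj_on_swaps: "inj_on (\<lambda>p. meet (fst p) (snd p)) swaps"
proof (rule inj_onI)
  fix p q assume pq: "p \<in> swaps" "q \<in> swaps" "meet (fst p) (snd p) = meet (fst q) (snd q)"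
  obtain a b c d where abcd: "p = (a, b)" "q = (c, d)" by fastforce
  have "{a, b} = {c, d}"
    using pq abcd by (intro meet_inj) (auto simp: swaps_def)
  then show "p = q" using pq abcd by (auto simp: swaps_def doubleton_eq_iff)
qed

lemma meet_in_swaps:
  assumes "u \<in> {1..n}" "v \<in> {1..n}" "u \<noteq> v"
  shows "meet u v \<in> (\<lambda>p. meet (fst p) (snd p)) ` swaps"
proof -
  have "(u, v) \<in> swaps \<or> (v, u) \<in> swaps" using yc_inj[OF assms] assms by (auto simp: swaps_def)
  then show ?thesis by (force simp: meet_commute[of v u])
qed

lemma low_cross_le_low_mono:
  "card {(x, e). x \<in> {1..n} \<and> e \<in> {1..n} \<and> 0 < wt x \<and> \<not> 0 < wt e \<and> left x e \<le> j} \<le>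
   card {(a, b). a \<in> {1..n} \<and> b \<in> {1..n} \<and> a \<noteq> b \<and> (0 < wt a \<longleftrightarrow> 0 < wt b) \<and> left a b \<le> j}"
proof -
  define mt where "mt = (\<lambda>p. meet (fst p) (snd p))"
  define B where "B = mt ` swaps"
  define T where "T = card B"
  have finB: "finite B" using finite_swaps by (simp add: B_def)
  have "\<And>b. b \<in> B \<Longrightarrow> b < Max B + 1" using Max_ge[OF finB] by (meson add_pos_nonneg less_add_one order_le_less_trans)
  from finite_reals_samples[OF finB this] obtain \<phi> bs where
    bs: "bij_betw bs {..<T} B" and between: "\<And>s. s < T \<Longrightarrow> \<phi> s < bs s \<and> bs s < \<phi> (Suc s)"
    and only: "\<And>s b. s < T \<Longrightarrow> b \<in> B \<Longrightarrow> \<phi> s \<le> b \<Longrightarrow> b \<le> \<phi> (Suc s) \<Longrightarrow> b = bs s"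
    and ends: "\<And>b. b \<in> B \<Longrightarrow> \<phi> 0 < b \<and> b < \<phi> T"
    unfolding T_def by blast
  have inj: "inj_on mt swaps" using meet_inj_on_swaps by (simp add: mt_def)
  define A where "A s = inv_into swaps mt (bs s)" for s
  have A: "A s \<in> swaps" "mt (A s) = bs s" if "s < T" for s
    using bij_betwE[OF bs] that unfolding A_def B_def by (auto intro: inv_into_into f_inv_into_f)
  have Aonto: "\<exists>s<T. A s = p" if "p \<in> swaps" for p
  proof -
    have "mt p \<in> bs ` {..<T}" using that bs by (simp add: bij_betw_def B_def)
    then obtain s where "s < T" "mt p = bs s" by auto
    then show ?thesis using inj_onD[OF inj, of "A s" p] A that by auto
  qed
  have Ainj: "s = s'" if "s < T" "s' < T" "A s = A s'" for s s'
    using bs that A(2)[of s] A(2)[of s'] by (auto simp: bij_betw_def inj_on_def)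
  \<comment> \<open>Steps below \<open>T\<close> form the pass with sign 1; the next
    \<open>T\<close> steps repeat it with sign -1 and with all swaps reversed. By
    \<open>flip\<close> the last order of each pass is the first order of the other.\<close>
  define \<sigma> where "\<sigma> s = (if s < T then 1 else - 1 :: real)" for s
  define r where "r s = ord (\<sigma> s) (\<phi> (if s < T then s else s - T))" for s
  define ev where "ev s = (if s < T then A s else prod.swap (A (s - T)))" for s
  have flip: "ord \<tau> (\<phi> T) = ord (- \<tau>) (\<phi> 0)" for \<tau>
  proof (intro ext)
    fix u v
    show "ord \<tau> (\<phi> T) u v = ord (- \<tau>) (\<phi> 0) u v"
    proof (cases "u \<in> {1..n} \<and> v \<in> {1..n} \<and> u \<noteq> v")
      case True
      then have "meet u v \<in> B" using meet_in_swaps by (simp add: B_def mt_def)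
      then have "0 < \<phi> T - meet u v" "0 < meet u v - \<phi> 0" using ends by auto
      moreover have "ord (- \<tau>) (\<phi> 0) u v \<longleftrightarrow> 0 < \<tau> * (yc v - yc u) * (meet u v - \<phi> 0)"
        using True by (simp add: ord_meet algebra_simps)
      moreover have "ord \<tau> (\<phi> T) u v \<longleftrightarrow> 0 < \<tau> * (yc v - yc u) * (\<phi> T - meet u v)"
        using True by (simp add: ord_meet mult.assoc)
      ultimately show ?thesis by (metis zero_less_mult_pos2 mult_pos_pos)
    qed (auto simp: ord_def)
  qed
  have T0: "0 < T"
  proof -
    have "(1::nat) \<in> {1..n}" "2 \<in> {1..n}" "(1::nat) \<noteq> 2" using n3 by auto
    then have "meet 1 2 \<in> B" unfolding B_def mt_def by (rule meet_in_swaps)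
    then have "B \<noteq> {}" by auto
    then show ?thesis using finB by (simp add: T_def card_gt_0_iff)
  qed
  have cyc: "r (2 * T) = r 0"
    using T0 flip[of "-1"] by (simp add: r_def \<sigma>_def mult_2)
  have rSuc: "r (Suc s) = ord (\<sigma> s) (\<phi> (Suc (if s < T then s else s - T)))" for s
  proof (cases "Suc s = T")
    case True
    then show ?thesis using flip[of 1] by (auto simp: r_def \<sigma>_def)
  qed (auto simp: r_def \<sigma>_def Suc_diff_le)
  have event: "swap_step (r s) (r (Suc s)) (fst (ev s)) (snd (ev s))"
    "swap_lev (r s) (fst (ev s)) (snd (ev s)) =
      (if 0 < wt (fst (ev s)) \<longleftrightarrow> 0 < wt (snd (ev s)) then left (fst (ev s)) (snd (ev s)) else left (snd (ev s)) (fst (ev s)))"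
    if s: "s < 2 * T" for s
  proof -
    let ?i = "if s < T then s else s - T"
    obtain a b where ab: "ev s = (a, b)" by fastforce
    have i: "?i < T" using s by auto
    have ab': "a \<in> {1..n}" "b \<in> {1..n}" "a \<noteq> b" "0 < \<sigma> s * (yc a - yc b)"
      using A(1)[OF i] ab by (auto simp: ev_def swaps_def \<sigma>_def split: if_splits)
    have m: "meet a b = bs ?i" using A(2)[OF i] ab meet_commute[of a b]
      by (cases "A (s - T)") (auto simp: ev_def mt_def split: if_splits)
    have sg: "\<sigma> s = 1 \<or> \<sigma> s = -1" by (simp add: \<sigma>_def)
    have only': "meet u v = meet a b" if "u \<in> {1..n}" "v \<in> {1..n}" "u \<noteq> v" "\<phi> ?i \<le> meet u v" "meet u v \<le> \<phi> (Suc ?i)" for u v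
      using only[OF i _ that(4,5)] meet_in_swaps[OF that(1-3)] m by (simp add: B_def mt_def)
    have t: "\<phi> ?i < meet a b" "meet a b < \<phi> (Suc ?i)" using between[OF i] m by auto
    have r: "r s = ord (\<sigma> s) (\<phi> ?i)" by (rule r_def)
    show "swap_step (r s) (r (Suc s)) (fst (ev s)) (snd (ev s))"
      unfolding rSuc r ab fst_conv snd_conv by (rule swap_step_meet[OF ab' t only'])
    show "swap_lev (r s) (fst (ev s)) (snd (ev s)) =
      (if 0 < wt (fst (ev s)) \<longleftrightarrow> 0 < wt (snd (ev s)) then left (fst (ev s)) (snd (ev s)) else left (snd (ev s)) (fst (ev s)))"
      unfolding r ab fst_conv snd_conv by (rule swap_lev_meet[OF ab' sg t only'])
  qed
  have evonto: "\<exists>s<2 * T. ev s = (a, b)" if "a \<in> {1..n}" "b \<in> {1..n}" "a \<noteq> b" for a b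
  proof -
    have "(a, b) \<in> swaps \<or> (b, a) \<in> swaps" using yc_inj[OF that] that by (auto simp: swaps_def)
    then consider "(a, b) \<in> swaps" | "(b, a) \<in> swaps" by blast
    then show ?thesis
    proof cases
      case 1
      from Aonto[OF this] obtain s where "s < T" "A s = (a, b)" by blast
      then show ?thesis by (intro exI[of _ s]) (simp add: ev_def)
    next
      case 2
      from Aonto[OF this] obtain s where "s < T" "A s = (b, a)" by blast
      then show ?thesis by (intro exI[of _ "T + s"]) (simp add: ev_def)
    qed
  qed
  have evinj: "s = s'" if "s < 2 * T" "s' < 2 * T" "ev s = ev s'" for s s'
  proof -
    have sw: "p \<noteq> prod.swap q" if "p \<in> swaps" "q \<in> swaps" for p q
      using that by (auto simp: swaps_def)
    consider "s < T" "s' < T" | "s < T" "\<not> s' < T" | "\<not> s < T" "s' < T" | "\<not> s < T" "\<not> s' < T" by blast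
    then show ?thesis
    proof cases
      case 1
      then show ?thesis using that(3) by (intro Ainj) (simp_all add: ev_def)
    next
      case 2
      then have "s' - T < T" using that(2) by linarith
      then have "A s \<noteq> prod.swap (A (s' - T))" using 2 by (intro sw A)
      then show ?thesis using that(3) 2 by (simp add: ev_def)
    next
      case 3
      then have "s - T < T" using that(1) by linarith
      then have "A s' \<noteq> prod.swap (A (s - T))" using 3 by (intro sw A)
      then show ?thesis using that(3) 3 by (simp add: ev_def)
    next
      case 4
      then have "s - T = s' - T" using that by (intro Ainj) (auto simp: ev_def prod_eq_iff)
      then show ?thesis using 4 by linarith
    qed
  qed
  have evin: "fst (ev s) \<in> {1..n}" "snd (ev s) \<in> {1..n}" "fst (ev s) \<noteq> snd (ev s)" if "s < 2 * T" for s
    using event(1)[OF that] unfolding swap_step_def by blast+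
  \<comment> \<open>For different colours these two levels are \<open>left x e\<close> and
    \<open>left e x\<close>. Their sum is \<open>n - 2 > 2 * j\<close>, so at most one of them is
    low.\<close>
  have opp: "j < swap_lev (r s') x e"
    if "s < 2 * T" "s' < 2 * T" "0 < wt x" "\<not> 0 < wt e" "ev s = (e, x)" "ev s' = (x, e)" "swap_lev (r s) e x \<le> j"
    for s s' x e
    using event(2)[OF that(1)] event(2)[OF that(2)] that left_add_left[of x e] evin[OF that(2)] low
    by auto
  have "card {(x, e). x \<in> {1..n} \<and> e \<in> {1..n} \<and> 0 < wt x \<and> \<not> 0 < wt e \<and> left x e \<le> j} \<le>
      card {(x, e). 0 < wt x \<and> \<not> 0 < wt e \<and> (\<exists>s<2 * T. ev s = (e, x) \<and> swap_lev (r s) e x \<le> j)}"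
    (is "card ?L \<le> card ?L'")
  proof (rule card_mono)
    have "?L' \<subseteq> {1..n} \<times> {1..n}"
      using evin by (fastforce simp del: atLeastAtMost_iff)
    then show "finite ?L'" by (rule finite_subset) simp
    show "?L \<subseteq> ?L'"
    proof (clarify)
      fix x e assume xe: "x \<in> {1..n}" "e \<in> {1..n}" "0 < wt x" "\<not> 0 < wt e" "left x e \<le> j"
      then obtain s where s: "s < 2 * T" "ev s = (e, x)" using evonto[of e x] by auto
      then show "\<exists>s<2 * T. ev s = (e, x) \<and> swap_lev (r s) e x \<le> j"
        using event(2)[OF s(1)] xe by (intro exI[of _ s]) simp
    qed
  qed
  also have "\<dots> \<le> card {s. s < 2 * T \<and> (0 < wt (fst (ev s)) \<longleftrightarrow> 0 < wt (snd (ev s))) \<and>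
      swap_lev (r s) (fst (ev s)) (snd (ev s)) \<le> j}" (is "_ \<le> card ?M")
    by (rule cyclic_sweep[OF event(1) cyc opp])
  also have "\<dots> \<le> card {(a, b). a \<in> {1..n} \<and> b \<in> {1..n} \<and> a \<noteq> b \<and> (0 < wt a \<longleftrightarrow> 0 < wt b) \<and> left a b \<le> j}"
    (is "_ \<le> card ?R")
  proof (rule card_inj_on_le[of ev])
    show "inj_on ev ?M" using evinj by (auto intro!: inj_onI)
    show "ev ` ?M \<subseteq> ?R"
    proof (rule image_subsetI)
      fix s assume "s \<in> ?M"
      then show "ev s \<in> ?R" using event(2)[of s] evin[of s] by (auto simp: split_beta)
    qed
    have "?R \<subseteq> {1..n} \<times> {1..n}" by auto
    then show "finite ?R" by (rule finite_subset) simp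
  qed
  finally show ?thesis .
qed

end

section \<open>Pointed and supported subsets\<close>

text \<open>The tilting argument behind all later passages from a plane that touches a set to one
  that strictly separates it.\<close>

lemma exists_small_shift:
  fixes f g :: "'b::real_inner"
  assumes "finite S" and S: "\<And>x. x \<in> S \<Longrightarrow> 0 < inner f x \<or> inner f x = 0 \<and> 0 < inner g x"
  shows "\<exists>\<epsilon>>0. \<forall>x\<in>S. 0 < inner (f + \<epsilon> *\<^sub>R g) x"
proof -
  have "\<forall>\<^sub>F \<epsilon> in at_right 0. 0 < inner (f + \<epsilon> *\<^sub>R g) x" if "x \<in> S" for x
  proof (cases "0 < inner f x")
    case True
    have "((\<lambda>\<epsilon>. inner (f + \<epsilon> *\<^sub>R g) x) \<longlongrightarrow> inner (f + 0 *\<^sub>R g) x) (at_right 0)"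
      by (intro tendsto_intros)
    then show ?thesis using True by (intro order_tendstoD(1)[where a = 0]) auto
  next
    case False
    then have "inner f x = 0" "0 < inner g x" using S[OF that] by auto
    then show ?thesis
      using eventually_at_right_less[of "0::real"] by (auto simp: inner_add_left elim: eventually_mono)
  qed
  then have "\<forall>\<^sub>F \<epsilon> in at_right 0. \<forall>x\<in>S. 0 < inner (f + \<epsilon> *\<^sub>R g) x"
    using assms(1) by (intro eventually_ball_finite) auto
  then have "\<forall>\<^sub>F \<epsilon> in at_right 0. (\<forall>x\<in>S. 0 < inner (f + \<epsilon> *\<^sub>R g) x) \<and> (0::real) < \<epsilon>"
    using eventually_at_right_less[of "0::real"] by (rule eventually_conj)
  then have "\<exists>\<epsilon>. (\<forall>x\<in>S. 0 < inner (f + \<epsilon> *\<^sub>R g) x) \<and> (0::real) < \<epsilon>"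
    by (rule eventually_happens'[OF trivial_limit_at_right_real])
  then show ?thesis by blast
qed

context vector_config
begin

lemma exists_third: "\<exists>c\<in>{1..n}. c \<noteq> a \<and> c \<noteq> b"
proof -
  have "card {a, b} < card {1..n}" using n3 card_insert_le_m1[of 2 "{b}" a] by simp
  then have "\<not> {1..n} \<subseteq> {a, b}" by (metis card_mono finite.emptyI finite.insertI not_le)
  then show ?thesis by blast
qed

lemma exists_values:
  assumes "a \<in> {1..n}" "b \<in> {1..n}" "a \<noteq> b"
  shows "\<exists>g. inner g (V a) = \<alpha> \<and> inner g (V b) = \<beta>"
proof -
  obtain c where c: "c \<in> {1..n}" "c \<noteq> a" "c \<noteq> b" using exists_third by blast
  let ?g = "(\<alpha> / orient a b c) *\<^sub>R cross3 (V b) (V c) + (\<beta> / orient a b c) *\<^sub>R cross3 (V c) (V a)"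
  have "orient a b c \<noteq> 0" using orient_nonzero assms c by metis
  moreover have "inner (cross3 (V b) (V c)) (V a) = orient a b c" "inner (cross3 (V c) (V a)) (V b) = orient a b c"
    using orient_cycle[of b c a] orient_cycle[of c a b] orient_cycle[of a b c] by (simp_all add: orient_def)
  moreover have "inner (cross3 (V b) (V c)) (V b) = 0" "inner (cross3 (V c) (V a)) (V a) = 0"
    by (simp_all add: dot_cross_self inner_commute)
  ultimately have "inner ?g (V a) = \<alpha> \<and> inner ?g (V b) = \<beta>" by (simp add: inner_add_left)
  then show ?thesis by blast
qed

lemma vec_nonzero: "a \<in> {1..n} \<Longrightarrow> V a \<noteq> 0"
proof -
  assume a: "a \<in> {1..n}"
  obtain c where c: "c \<in> {1..n}" "c \<noteq> a" using exists_third by blast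
  from exists_values[OF a c(1) c(2)[symmetric], of 1 1] show "V a \<noteq> 0" by auto
qed

text \<open>The claim involves \<open>w\<close> only, so the frame may be chosen: any
  \<open>g\<close> with distinct values on the affine points, and \<open>cross3 g w\<close> in the
  place of \<open>f\<close>, which turns the frame determinant into a squared norm.\<close>

lemma low_cross_le_low_same:
  assumes gen: "generic_for n V w" and many: "j < card {u \<in> {1..n}. 0 < inner w (V u)}" and low: "2 * j + 2 < n"
  shows "card {(x, e). x \<in> {1..n} \<and> e \<in> {1..n} \<and> 0 < inner w (V x) \<and> \<not> 0 < inner w (V e) \<and> left x e \<le> j} \<le>
   card {(a, b). a \<in> {1..n} \<and> b \<in> {1..n} \<and> a \<noteq> b \<and> (0 < inner w (V a) \<longleftrightarrow> 0 < inner w (V b)) \<and> left a b \<le> j}"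
proof -
  let ?p = "\<lambda>i. V i /\<^sub>R inner w (V i)"
  define D where "D = (\<lambda>(a, b). ?p a - ?p b) ` {(a, b). a \<in> {1..n} \<and> b \<in> {1..n} \<and> a \<noteq> b}"
  have wn: "inner w (V i) \<noteq> 0" if "i \<in> {1..n}" for i using gen that by (simp add: generic_for_def)
  have "finite D" unfolding D_def
    by (rule finite_imageI, rule finite_subset[of _ "{1..n} \<times> {1..n}"]) auto
  moreover have "0 \<notin> D"
  proof
    assume "0 \<in> D"
    then obtain a b where ab: "a \<in> {1..n}" "b \<in> {1..n}" "a \<noteq> b" "?p a = ?p b" by (auto simp: D_def)
    obtain c where c: "c \<in> {1..n}" "c \<noteq> a" "c \<noteq> b" using exists_third by blast
    have "V a = inner w (V a) *\<^sub>R ?p b" using wn[OF ab(1)] ab(4)[symmetric] by simp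
    then have "orient a b c = 0" unfolding orient_def by (metis cross_mult_left cross_refl inner_zero_left scaleR_zero_right)
    then show False using orient_nonzero[of a b c] ab c by auto
  qed
  ultimately have "\<exists>g. \<forall>d\<in>D. inner g d \<noteq> 0" by (rule exists_nonorthogonal)
  then obtain g where g: "\<And>d. d \<in> D \<Longrightarrow> inner g d \<noteq> 0" by blast
  have slopes: "inner g (V a) / inner w (V a) \<noteq> inner g (V b) / inner w (V b)"
    if "a \<in> {1..n}" "b \<in> {1..n}" "a \<noteq> b" for a b
  proof -
    have "?p a - ?p b \<in> D" using that unfolding D_def by force
    then show ?thesis using g[of "?p a - ?p b"] by (auto simp: inner_diff_right divide_inverse mult.commute)
  qed
  have "cross3 g w \<noteq> 0"
  proof
    assume z: "cross3 g w = 0"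
    have m: "(1::nat) \<in> {1..n}" "2 \<in> {1..n}" "(1::nat) \<noteq> 2" using n3 by auto
    have "inner (V i) w *\<^sub>R g = inner (V i) g *\<^sub>R w" for i
      using Lagrange[of "V i" g w] z by simp
    then have "(inner (V i) w * inner g (V k)) = inner (V i) g * inner w (V k)" for i k
      by (metis inner_scaleR_left)
    then have "inner g (V 1) * inner w (V 2) = inner g (V 2) * inner w (V 1)" by (metis inner_commute mult.commute)
    then show False using slopes[OF m] wn[OF m(1)] wn[OF m(2)] by (simp add: field_simps)
  qed
  then have "0 < inner (cross3 g w) (cross3 g w)" by simp
  then interpret coloured_sweep n V w "cross3 g w" g j
    by unfold_locales (use gen slopes many low in auto)
  show ?thesis by (rule low_cross_le_low_mono)
qed

section \<open>Supporting planes of two-coloured pointed sets\<close>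

definition pointed :: "nat set \<Rightarrow> bool" where
  "pointed S \<longleftrightarrow> (\<exists>u. \<forall>i\<in>S. 0 < inner u (V i))"

definition turned :: "nat set \<Rightarrow> nat \<Rightarrow> bool" where
  "turned S x \<longleftrightarrow> (\<exists>u. (\<forall>i\<in>S - {x}. 0 < inner u (V i)) \<and> inner u (V x) < 0)"

definition supports :: "nat \<Rightarrow> nat \<Rightarrow> nat set \<Rightarrow> bool" where
  "supports a b S \<longleftrightarrow> a \<in> S \<and> b \<in> S \<and> (\<forall>c\<in>S - {a, b}. 0 < orient a b c)"

lemma supports_nonneg: "supports a b S \<Longrightarrow> c \<in> S \<Longrightarrow> 0 \<le> orient a b c"
  unfolding supports_def by (cases "c = a"; cases "c = b") (auto intro: less_imp_le)

lemma supports_zero: "supports a b S \<Longrightarrow> c \<in> S \<Longrightarrow> orient a b c = 0 \<Longrightarrow> c = a \<or> c = b"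
  unfolding supports_def by force

text \<open>The plane through \<open>a\<close> and \<open>b\<close> is tilted by a functional
  \<open>g\<close>: values 0 and 1 on \<open>a\<close> and \<open>b\<close> keep \<open>a\<close> on
  the boundary, values 1 and 1 bring both to the positive side.\<close>

lemma supports_imp_values:
  assumes S: "S \<subseteq> {1..n}" and ab: "a \<noteq> b" and sup: "supports a b S"
  shows "\<exists>u. (\<forall>i\<in>S - {a}. 0 < inner u (V i)) \<and> inner u (V a) = 0" and "pointed S"
proof -
  have fin: "finite S" using S finite_subset by blast
  have mem: "a \<in> {1..n}" "b \<in> {1..n}" using S sup by (auto simp: supports_def)
  let ?f = "cross3 (V a) (V b)"
  have f: "inner ?f (V c) = orient a b c" for c by (simp add: orient_def)
  obtain g where g: "inner g (V a) = 0" "inner g (V b) = 1" using exists_values[OF mem ab] by blast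
  have "\<exists>\<epsilon>>0. \<forall>x\<in>V ` (S - {a}). 0 < inner (?f + \<epsilon> *\<^sub>R g) x"
    using fin sup g(2) by (intro exists_small_shift) (auto simp: f supports_def)
  then obtain \<epsilon> where "\<forall>i\<in>S - {a}. 0 < inner (?f + \<epsilon> *\<^sub>R g) (V i)" by blast
  then show "\<exists>u. (\<forall>i\<in>S - {a}. 0 < inner u (V i)) \<and> inner u (V a) = 0"
    using g(1) f[of a] by (intro exI[of _ "?f + \<epsilon> *\<^sub>R g"]) (simp add: inner_add_left)
  obtain g where g: "inner g (V a) = 1" "inner g (V b) = 1" using exists_values[OF mem ab] by blast
  have "\<exists>\<epsilon>>0. \<forall>x\<in>V ` S. 0 < inner (?f + \<epsilon> *\<^sub>R g) x"
    using fin sup g by (intro exists_small_shift) (auto simp: f supports_def)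
  then show "pointed S" unfolding pointed_def by blast
qed

text \<open>In the affine picture \<open>u\<close> separates the red points of \<open>S\<close> from
  the blue ones, and the wanted plane is one of their two inner common tangents: the line in the
  direction of extreme slope among the red-blue differences.\<close>

lemma exists_supports_mixed:
  assumes S: "S \<subseteq> {1..n}" and u: "\<And>i. i \<in> S \<Longrightarrow> 0 < inner u (V i)" and wn: "\<And>i. i \<in> S \<Longrightarrow> inner w (V i) \<noteq> 0"
    and a0: "a0 \<in> S" "0 < inner w (V a0)" and b0: "b0 \<in> S" "inner w (V b0) < 0"
  shows "\<exists>a b. 0 < inner w (V a) \<and> inner w (V b) < 0 \<and> supports a b S"
proof -
  have fin: "finite S" using S finite_subset by blast
  \<comment> \<open>The differences \<open>c p\<close> are killed by \<open>w\<close> and positive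
    under \<open>u\<close>, so the ratio of \<open>h\<close> to \<open>u\<close> measures their
    slope. The minus sign selects the tangent that has \<open>S\<close> to the left of
    \<open>(a, b)\<close>.\<close>
  define h where "h = - cross3 u w"
  define c where "c p = V (fst p) /\<^sub>R inner w (V (fst p)) - V (snd p) /\<^sub>R inner w (V (snd p))" for p
  define M where "M = {(a, b). a \<in> S \<and> b \<in> S \<and> 0 < inner w (V a) \<and> inner w (V b) < 0}"
  have uc: "0 < inner u (c p)" if pM: "p \<in> M" for p
  proof -
    obtain a b where ab: "p = (a, b)" "a \<in> S" "b \<in> S" "0 < inner w (V a)" "inner w (V b) < 0"
      using pM unfolding M_def by blast
    have "0 < inner u (V a) / inner w (V a)" "inner u (V b) / inner w (V b) < 0"
      using divide_pos_pos[OF u[OF ab(2)] ab(4)] divide_pos_neg[OF u[OF ab(3)] ab(5)] by auto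
    then show ?thesis by (simp add: ab(1) c_def inner_diff_right divide_inverse mult.commute)
  qed
  have "finite M" by (rule finite_subset[of _ "S \<times> S"]) (auto simp: M_def fin)
  moreover have "M \<noteq> {}" using a0 b0 by (auto simp: M_def)
  ultimately obtain p where "is_arg_min (\<lambda>p. inner h (c p) / inner u (c p)) (\<lambda>p. p \<in> M) p"
    using ex_is_arg_min_if_finite by blast
  then have p: "p \<in> M" and pmin: "\<And>q. q \<in> M \<Longrightarrow> inner h (c p) / inner u (c p) \<le> inner h (c q) / inner u (c q)"
    by (auto simp: is_arg_min_linorder simp del: split_paired_All)
  obtain a b where ab: "p = (a, b)" "a \<in> S" "b \<in> S" "0 < inner w (V a)" "inner w (V b) < 0"
    using p by (auto simp: M_def)
  define \<rho> where "\<rho> = inner h (c p) / inner u (c p)"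
  define f0 where "f0 = h - \<rho> *\<^sub>R u"
  \<comment> \<open>Subtracting a multiple of \<open>w\<close> leaves all values on the differences
    unchanged and makes \<open>f\<close> vanish at \<open>a\<close>, hence also at
    \<open>b\<close>.\<close>
  define f where "f = f0 - (inner f0 (V a) / inner w (V a)) *\<^sub>R w"
  have wc: "inner w (c q) = 0" if "q \<in> M" for q
    using that by (auto simp: M_def c_def inner_diff_right)
  have fc: "inner f (c q) = inner f0 (c q)" if "q \<in> M" for q
    by (simp add: f_def inner_diff_left wc[OF that])
  have f0c: "0 \<le> inner f0 (c q)" if "q \<in> M" for q
    using pmin[OF that] uc[OF that] by (simp add: f0_def \<rho>_def[symmetric] inner_diff_left pos_le_divide_eq)
  have "inner f0 (c p) = 0" using uc[OF p] by (simp add: f0_def \<rho>_def inner_diff_left)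
  then have fp: "inner f (c p) = 0" using fc[OF p] by simp
  have fa: "inner f (V a) = 0" using ab(4) by (simp add: f_def inner_diff_left)
  then have fb: "inner f (V b) = 0" using fp ab(1,5) by (simp add: c_def inner_diff_right)
  have fS: "0 \<le> inner f (V i)" if "i \<in> S" for i
  proof (cases "0 < inner w (V i)")
    case True
    then have "(i, b) \<in> M" using that ab by (simp add: M_def)
    then have "0 \<le> inner f (c (i, b))" using fc f0c by metis
    then show ?thesis using True fb by (simp add: c_def inner_diff_right zero_le_mult_iff)
  next
    case False
    then have neg: "inner w (V i) < 0" using wn[OF that] by simp
    then have "(a, i) \<in> M" using that ab by (simp add: M_def)
    then have "0 \<le> inner f (c (a, i))" using fc f0c by metis
    then show ?thesis using neg fa by (simp add: c_def inner_diff_right mult_le_0_iff)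
  qed
  \<comment> \<open>The signs of \<open>f\<close> and of \<open>cross3 (V a) (V b)\<close> at
    \<open>?z\<close> are both known to be negative. Since \<open>f\<close> vanishes on
    \<open>V a\<close> and \<open>V b\<close>, Cramer's rule then transfers the sign of
    \<open>f\<close> at each \<open>k\<close> to \<open>orient a b k\<close>.\<close>
  let ?z = "cross3 u w"
  have abz: "inner (cross3 (V a) (V b)) ?z < 0"
    using mult_pos_neg[OF u[OF ab(2)] ab(5)] mult_pos_pos[OF ab(4) u[OF ab(3)]]
    by (simp add: dot_cross inner_commute mult.commute)
  then have "?z \<noteq> 0" by auto
  then have fz: "inner f ?z < 0"
    by (simp add: f_def f0_def h_def inner_diff_left dot_cross_self)
  have "0 < orient a b k" if "k \<in> S - {a, b}" for k
  proof -
    have "orient a b k * inner f ?z = inner (cross3 (V a) (V b)) ?z * inner f (V k)"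
      using arg_cong[OF cramer_cross3[of "V a" "V b" "V k" ?z], of "inner f"] fa fb
      by (simp add: orient_def inner_add_right)
    moreover have "inner (cross3 (V a) (V b)) ?z * inner f (V k) \<le> 0"
      using abz fS[of k] that by (simp add: mult_nonpos_nonneg)
    ultimately have "0 \<le> orient a b k" using fz by (metis mult_le_cancel_right_neg mult_zero_left)
    moreover have "orient a b k \<noteq> 0" using that ab S by (intro orient_nonzero) auto
    ultimately show ?thesis by simp
  qed
  then show ?thesis using ab by (auto simp: supports_def)
qed

text \<open>The triple product of the two normals and \<open>w\<close> changes sign when the two
  pairs are exchanged, whereas the support conditions make it negative in both cases if the pairs
  differ.\<close>

lemma supports_mixed_unique:
  assumes "supports a b S" "0 < inner w (V a)" "inner w (V b) < 0"
    and "supports a' b' S" "0 < inner w (V a')" "inner w (V b') < 0"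
  shows "(a, b) = (a', b')"
proof (rule ccontr)
  assume ne: "(a, b) \<noteq> (a', b')"
  have key: "inner (cross3 (V a) (V b)) (cross3 (cross3 (V a') (V b')) w) < 0"
    if "supports a b S" "0 < inner w (V a)" "inner w (V b) < 0"
      "supports a' b' S" "0 < inner w (V a')" "inner w (V b') < 0" "(a, b) \<noteq> (a', b')" for a b a' b'
  proof -
    have mem: "a \<in> S" "b \<in> S" using that(1) by (auto simp: supports_def)
    have nn: "0 \<le> orient a' b' a" "0 \<le> orient a' b' b" using supports_nonneg[OF that(4)] mem by auto
    have "orient a' b' a \<noteq> 0 \<or> orient a' b' b \<noteq> 0"
      using supports_zero[OF that(4)] mem that(2,3,5-7) by (metis less_asym)
    then have "orient a' b' a * inner w (V b) < 0 \<or> 0 < orient a' b' b * inner w (V a)"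
      using nn that(2,3) by (auto simp: mult_less_0_iff zero_less_mult_iff)
    moreover have "orient a' b' a * inner w (V b) \<le> 0" "0 \<le> orient a' b' b * inner w (V a)"
      using nn that(2,3) by (auto simp: mult_le_0_iff)
    ultimately have "orient a' b' a * inner w (V b) < orient a' b' b * inner w (V a)" by linarith
    then show ?thesis by (simp add: dot_cross orient_def inner_commute mult.commute)
  qed
  have "inner (cross3 (V a') (V b')) (cross3 (cross3 (V a) (V b)) w) =
      - inner (cross3 (V a) (V b)) (cross3 (cross3 (V a') (V b')) w)"
    by (metis cross_skew cross_triple inner_commute inner_minus_left inner_minus_right)
  then show False using key[OF assms ne] key[OF assms(4-6) assms(1-3)] ne by auto
qed

lemma card_supports_mixed:
  assumes S: "S \<subseteq> {1..n}" and wn: "\<And>i. i \<in> {1..n} \<Longrightarrow> inner w (V i) \<noteq> 0"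
  shows "card {(a, b). 0 < inner w (V a) \<and> inner w (V b) < 0 \<and> supports a b S} =
    (if pointed S \<and> (\<exists>i\<in>S. 0 < inner w (V i)) \<and> (\<exists>i\<in>S. inner w (V i) < 0) then 1 else 0)"
    (is "card ?A = _")
proof (cases "pointed S \<and> (\<exists>i\<in>S. 0 < inner w (V i)) \<and> (\<exists>i\<in>S. inner w (V i) < 0)")
  case True
  then obtain u a0 b0 where "\<And>i. i \<in> S \<Longrightarrow> 0 < inner u (V i)" "a0 \<in> S" "0 < inner w (V a0)" "b0 \<in> S" "inner w (V b0) < 0"
    by (auto simp: pointed_def)
  from exists_supports_mixed[OF S this(1) _ this(2-)] wn S obtain a b
    where ab: "0 < inner w (V a)" "inner w (V b) < 0" "supports a b S" by blast
  then have "?A = {(a, b)}" using supports_mixed_unique[OF ab(3,1,2)] by blast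
  then show ?thesis using True by simp
next
  case False
  have "?A = {}"
  proof (rule equals0I, clarify)
    fix a b assume ab: "0 < inner w (V a)" "inner w (V b) < 0" "supports a b S"
    then have "a \<noteq> b" by auto
    then show False using False supports_imp_values(2)[OF S _ ab(3)] ab by (auto simp: supports_def)
  qed
  then show ?thesis using False by (simp only: card.empty if_False)
qed

end

section \<open>Counting pointed subsets\<close>

lemma sum_card_swap:
  assumes "finite A" "finite B"
  shows "(\<Sum>a\<in>A. card {b \<in> B. Q a b}) = (\<Sum>b\<in>B. card {a \<in> A. Q a b})"
proof -
  have "(\<Sum>a\<in>A. card {b \<in> B. Q a b}) = (\<Sum>a\<in>A. \<Sum>b\<in>B. of_bool (Q a b))"
    using assms(2) by (simp add: Collect_conj_eq Int_commute)
  also have "\<dots> = (\<Sum>b\<in>B. \<Sum>a\<in>A. of_bool (Q a b))" by (rule sum.swap)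
  also have "\<dots> = (\<Sum>b\<in>B. card {a \<in> A. Q a b})"
    using assms(1) by (simp add: Collect_conj_eq Int_commute)
  finally show ?thesis .
qed

context vector_config
begin

definition subs :: "nat \<Rightarrow> nat set set" where
  "subs s = {S. S \<subseteq> {1..n} \<and> card S = s}"

definition pcount :: "nat \<Rightarrow> nat" where
  "pcount s = card {S \<in> subs s. pointed S}"

definition qcount :: "nat \<Rightarrow> nat" where
  "qcount s = card {(S, x). S \<in> subs s \<and> x \<in> S \<and> turned S x}"

definition sep :: "real^3 \<Rightarrow> (nat \<times> nat) set" where
  "sep w = {(a, b). a \<in> {1..n} \<and> b \<in> {1..n} \<and> 0 < inner w (V a) \<and> inner w (V b) < 0}"

definition pairs :: "(nat \<times> nat) set" where
  "pairs = {(a, b). a \<in> {1..n} \<and> b \<in> {1..n} \<and> a \<noteq> b}"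

lemma finite_subs: "finite (subs s)"
  by (rule finite_subset[of _ "Pow {1..n}"]) (auto simp: subs_def)

lemma finite_pairs: "finite pairs"
  by (rule finite_subset[of _ "{1..n} \<times> {1..n}"]) (auto simp: pairs_def)

lemma sep_subset: "sep w \<subseteq> pairs"
  by (auto simp: sep_def pairs_def)

lemma finite_sep: "finite (sep w)"
  using finite_subset[OF sep_subset finite_pairs] .

lemma subsD: "S \<in> subs s \<Longrightarrow> S \<subseteq> {1..n}" "S \<in> subs s \<Longrightarrow> finite S" "S \<in> subs s \<Longrightarrow> card S = s"
  using finite_subset by (auto simp: subs_def)

lemma card_supports:
  assumes "(a, b) \<in> pairs" "2 \<le> s"
  shows "card {S \<in> subs s. supports a b S} = left a b choose (s - 2)"
proof -
  define L where "L = {c \<in> {1..n}. 0 < orient a b c}"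
  have ab: "a \<in> {1..n}" "b \<in> {1..n}" "a \<noteq> b" "a \<notin> L" "b \<notin> L" "finite L"
    using assms by (auto simp: pairs_def L_def)
  have "bij_betw (\<lambda>T. insert a (insert b T)) {T. T \<subseteq> L \<and> card T = s - 2} {S \<in> subs s. supports a b S}"
  proof (rule bij_betw_byWitness[where f' = "\<lambda>S. S - {a, b}"])
    show "\<forall>T\<in>{T. T \<subseteq> L \<and> card T = s - 2}. insert a (insert b T) - {a, b} = T" using ab by auto
    show "\<forall>S\<in>{S \<in> subs s. supports a b S}. insert a (insert b (S - {a, b})) = S" by (auto simp: supports_def)
    show "(\<lambda>T. insert a (insert b T)) ` {T. T \<subseteq> L \<and> card T = s - 2} \<subseteq> {S \<in> subs s. supports a b S}"
    proof (rule image_subsetI)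
      fix T assume "T \<in> {T. T \<subseteq> L \<and> card T = s - 2}"
      then have T: "T \<subseteq> L" "card T = s - 2" by auto
      then have "finite T" "a \<notin> T" "b \<notin> T" using ab finite_subset by auto
      then have "card (insert a (insert b T)) = s" using T(2) ab(3) assms(2) by simp
      then show "insert a (insert b T) \<in> {S \<in> subs s. supports a b S}"
        using T(1) ab by (auto simp: subs_def supports_def L_def)
    qed
    show "(\<lambda>S. S - {a, b}) ` {S \<in> subs s. supports a b S} \<subseteq> {T. T \<subseteq> L \<and> card T = s - 2}"
    proof (rule image_subsetI)
      fix S assume S: "S \<in> {S \<in> subs s. supports a b S}"
      then have "{a, b} \<subseteq> S" "finite S" "card S = s" using subsD by (auto simp: supports_def)
      then have "card (S - {a, b}) = s - 2" using ab(3) by (subst card_Diff_subset) auto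
      moreover have "S - {a, b} \<subseteq> L" using S by (auto simp: supports_def L_def subs_def)
      ultimately show "S - {a, b} \<in> {T. T \<subseteq> L \<and> card T = s - 2}" by simp
    qed
  qed
  from bij_betw_same_card[OF this] have "card {S \<in> subs s. supports a b S} = card {T. T \<subseteq> L \<and> card T = s - 2}" ..
  then show ?thesis using n_subsets[OF ab(6)] by (simp add: left_def L_def)
qed

lemma sum_supports:
  assumes "R \<subseteq> pairs" "2 \<le> s"
  shows "(\<Sum>S\<in>subs s. card {p \<in> R. supports (fst p) (snd p) S}) = (\<Sum>(a, b)\<in>R. left a b choose (s - 2))"
proof -
  have "finite R" using assms(1) finite_pairs finite_subset by blast
  from sum_card_swap[OF finite_subs this]
  have "(\<Sum>S\<in>subs s. card {p \<in> R. supports (fst p) (snd p) S}) = (\<Sum>p\<in>R. card {S \<in> subs s. supports (fst p) (snd p) S})" .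
  also have "\<dots> = (\<Sum>(a, b)\<in>R. left a b choose (s - 2))"
    using assms card_supports by (intro sum.cong refl) (auto simp: split_beta)
  finally show ?thesis .
qed

lemma sum_sep:
  assumes wn: "\<And>i. i \<in> {1..n} \<Longrightarrow> inner w (V i) \<noteq> 0" and s: "2 \<le> s"
  shows "(\<Sum>(a, b)\<in>sep w. left a b choose (s - 2)) =
    card {S \<in> subs s. pointed S \<and> (\<exists>i\<in>S. 0 < inner w (V i)) \<and> (\<exists>i\<in>S. inner w (V i) < 0)}"
proof -
  have "card {p \<in> sep w. supports (fst p) (snd p) S} =
      of_bool (pointed S \<and> (\<exists>i\<in>S. 0 < inner w (V i)) \<and> (\<exists>i\<in>S. inner w (V i) < 0))" if "S \<in> subs s" for S
  proof -
    have "{p \<in> sep w. supports (fst p) (snd p) S} = {(a, b). 0 < inner w (V a) \<and> inner w (V b) < 0 \<and> supports a b S}"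
      using subsD(1)[OF that] by (auto simp: sep_def supports_def)
    then show ?thesis using card_supports_mixed[OF subsD(1)[OF that] wn] by (simp add: of_bool_def)
  qed
  then have "(\<Sum>(a, b)\<in>sep w. left a b choose (s - 2)) =
      (\<Sum>S\<in>subs s. of_bool (pointed S \<and> (\<exists>i\<in>S. 0 < inner w (V i)) \<and> (\<exists>i\<in>S. inner w (V i) < 0)))"
    using sum_supports[OF sep_subset s, of w] by simp
  also have "\<dots> = card {S \<in> subs s. pointed S \<and> (\<exists>i\<in>S. 0 < inner w (V i)) \<and> (\<exists>i\<in>S. inner w (V i) < 0)}"
    using finite_subs by (simp add: Collect_conj_eq Int_commute Int_left_commute Int_assoc)
  finally show ?thesis .
qed

text \<open>Both sides count the two-coloured pointed sets, a family that does not change when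
  \<open>w\<close> is replaced by \<open>- w\<close>. This is what allows the summands to be
  symmetrized.\<close>

lemma sum_sep_flip:
  assumes wn: "\<And>i. i \<in> {1..n} \<Longrightarrow> inner w (V i) \<noteq> 0" and s: "2 \<le> s"
  shows "(\<Sum>(a, b)\<in>sep w. left b a choose (s - 2)) = (\<Sum>(a, b)\<in>sep w. left a b choose (s - 2))"
proof -
  have "(\<Sum>(a, b)\<in>sep w. left b a choose (s - 2)) = (\<Sum>(a, b)\<in>sep (- w). left a b choose (s - 2))"
    by (rule sum.reindex_bij_witness[of _ prod.swap prod.swap]) (auto simp: sep_def)
  also have "\<dots> = card {S \<in> subs s. pointed S \<and> (\<exists>i\<in>S. 0 < inner (- w) (V i)) \<and> (\<exists>i\<in>S. inner (- w) (V i) < 0)}"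
    using wn s by (intro sum_sep) auto
  also have "\<dots> = card {S \<in> subs s. pointed S \<and> (\<exists>i\<in>S. 0 < inner w (V i)) \<and> (\<exists>i\<in>S. inner w (V i) < 0)}"
    by (rule arg_cong[of _ _ card]) auto
  also have "\<dots> = (\<Sum>(a, b)\<in>sep w. left a b choose (s - 2))" using sum_sep[OF assms] ..
  finally show ?thesis .
qed

lemma pcount_eq:
  assumes wn: "\<And>i. i \<in> {1..n} \<Longrightarrow> inner w (V i) \<noteq> 0" and s: "2 \<le> s"
  shows "pcount s = (\<Sum>(a, b)\<in>sep w. left a b choose (s - 2)) +
    (card {i \<in> {1..n}. 0 < inner w (V i)} choose s) + (card {i \<in> {1..n}. inner w (V i) < 0} choose s)"
proof -
  let ?M = "{S \<in> subs s. pointed S \<and> (\<exists>i\<in>S. 0 < inner w (V i)) \<and> (\<exists>i\<in>S. inner w (V i) < 0)}"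
  let ?R = "{S. S \<subseteq> {i \<in> {1..n}. 0 < inner w (V i)} \<and> card S = s}"
  let ?B = "{S. S \<subseteq> {i \<in> {1..n}. inner w (V i) < 0} \<and> card S = s}"
  have "{S \<in> subs s. pointed S} = ?M \<union> (?R \<union> ?B)"
  proof (intro equalityI subsetI)
    fix S assume S: "S \<in> {S \<in> subs s. pointed S}"
    then have "S \<subseteq> {1..n}" "card S = s" by (auto simp: subs_def)
    moreover have "S \<subseteq> {1..n} \<Longrightarrow> \<not> (\<exists>i\<in>S. 0 < inner w (V i)) \<Longrightarrow> i \<in> S \<Longrightarrow> inner w (V i) < 0" for i
      using wn[of i] by (meson linorder_neqE subsetD)
    moreover have "S \<subseteq> {1..n} \<Longrightarrow> \<not> (\<exists>i\<in>S. inner w (V i) < 0) \<Longrightarrow> i \<in> S \<Longrightarrow> 0 < inner w (V i)" for i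
      using wn[of i] by (meson linorder_neqE subsetD)
    ultimately show "S \<in> ?M \<union> (?R \<union> ?B)" using S by blast
  next
    fix S assume "S \<in> ?M \<union> (?R \<union> ?B)"
    then consider "S \<in> ?M" | "S \<in> ?R" | "S \<in> ?B" by blast
    then show "S \<in> {S \<in> subs s. pointed S}"
    proof cases
      case 2
      then show ?thesis by (auto simp: subs_def pointed_def intro!: exI[of _ w])
    next
      case 3
      then show ?thesis by (auto simp: subs_def pointed_def intro!: exI[of _ "- w"])
    qed simp
  qed
  moreover have "?R \<inter> ?B = {}"
  proof (rule equals0I)
    fix S assume S: "S \<in> ?R \<inter> ?B"
    then have "S = {}" by force
    then show False using S s by auto
  qed
  moreover have "?M \<inter> (?R \<union> ?B) = {}" by force
  moreover have "finite ?M" "finite ?R" "finite ?B"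
    using finite_subs by (auto intro: finite_subset[of _ "Pow {1..n}"])
  ultimately have "pcount s = card ?M + (card ?R + card ?B)"
    unfolding pcount_def by (simp add: card_Un_disjoint)
  also have "card ?M = (\<Sum>(a, b)\<in>sep w. left a b choose (s - 2))" using sum_sep[OF assms] ..
  finally show ?thesis by (simp add: n_subsets)
qed

text \<open>Modulo \<open>V x\<close> the other vectors lie in an open half-plane, and
  \<open>b\<close> is the extreme one by angle; the ratio of \<open>h\<close> to \<open>u\<close> is
  the cotangent-like measure of that angle.\<close>

lemma exists_supports_at:
  assumes S: "S \<subseteq> {1..n}" and x: "x \<in> S" and u: "\<And>i. i \<in> S - {x} \<Longrightarrow> 0 < inner u (V i)" "inner u (V x) = 0"
    and ne: "S - {x} \<noteq> {}"
  shows "\<exists>b\<in>S - {x}. supports x b S"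
proof -
  have fin: "finite (S - {x})" using S finite_subset by blast
  define h where "h = cross3 (V x) u"
  obtain b where "is_arg_min (\<lambda>b. inner h (V b) / inner u (V b)) (\<lambda>b. b \<in> S - {x}) b"
    using ex_is_arg_min_if_finite[OF fin ne] by blast
  then have b: "b \<in> S - {x}" and bmin: "\<And>c. c \<in> S - {x} \<Longrightarrow> inner h (V b) / inner u (V b) \<le> inner h (V c) / inner u (V c)"
    by (auto simp: is_arg_min_linorder)
  have "0 < orient x b c" if c: "c \<in> S - {x, b}" for c
  proof -
    have cx: "c \<in> S - {x}" using c by blast
    have "inner h (V b) * inner u (V c) \<le> inner h (V c) * inner u (V b)"
      using bmin[OF cx] u(1)[OF b] u(1)[OF cx] by (simp add: divide_simps mult.commute)
    moreover have "orient x b c * inner u u = inner u (V b) * inner h (V c) - inner h (V b) * inner u (V c)"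
    proof -
      have "orient x b c *\<^sub>R u = inner (cross3 (V b) (V c)) u *\<^sub>R V x + inner (cross3 (V c) (V x)) u *\<^sub>R V b +
          inner (cross3 (V x) (V b)) u *\<^sub>R V c"
        unfolding orient_def by (rule cramer_cross3)
      from arg_cong[OF this, of "inner u"] have "orient x b c * inner u u =
          inner (cross3 (V c) (V x)) u * inner u (V b) + inner (cross3 (V x) (V b)) u * inner u (V c)"
        using u(2) by (simp add: inner_add_right)
      moreover have "inner (cross3 (V c) (V x)) u = inner h (V c)" "inner (cross3 (V x) (V b)) u = - inner h (V b)"
        using cross_triple[of "V x" u "V c"] cross_triple[of "V c" "V x" u] cross_triple[of "V x" u "V b"]
          cross_triple[of "V b" "V x" u] cross_skew[of "V b" "V x"]
        by (simp_all add: h_def)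
      ultimately show ?thesis by (simp add: algebra_simps)
    qed
    ultimately have "0 \<le> orient x b c * inner u u" by (simp add: mult.commute)
    moreover have "0 < inner u u" using u(1)[OF b] by auto
    ultimately have "0 \<le> orient x b c" by (simp add: zero_le_mult_iff)
    moreover have "orient x b c \<noteq> 0" using S x b c by (intro orient_nonzero) auto
    ultimately show ?thesis by simp
  qed
  then show ?thesis using b x by (auto simp: supports_def)
qed

text \<open>Inclusion-exclusion. \<open>S - {x}\<close> is pointed iff \<open>S\<close> is pointed
  or turned at \<open>x\<close>. Both hold iff \<open>Z\<close>: a plane through \<open>x\<close>
  can be tilted either way, and conversely two witnesses have a positive combination that vanishes
  at \<open>x\<close>. Finally \<open>Z\<close> amounts to exactly one supporting pair that starts
  at \<open>x\<close>.\<close>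

lemma turned_balance:
  assumes S: "S \<subseteq> {1..n}" and x: "x \<in> S" and ne: "S - {x} \<noteq> {}"
  shows "of_bool (turned S x) + of_bool (pointed S) =
    of_bool (pointed (S - {x})) + card {p \<in> pairs. fst p = x \<and> supports (fst p) (snd p) S}"
proof -
  define Z where "Z \<longleftrightarrow> (\<exists>u. (\<forall>i\<in>S - {x}. 0 < inner u (V i)) \<and> inner u (V x) = 0)"
  have fin: "finite (V ` (S - {x}))" using S finite_subset by blast
  have xI: "x \<in> {1..n}" using S x by blast
  have xx: "0 < inner (V x) (V x)" using vec_nonzero[OF xI] by simp
  have tilt: "\<exists>\<epsilon>>0. \<forall>i\<in>S - {x}. 0 < inner (u + \<epsilon> *\<^sub>R z) (V i)" if "\<forall>i\<in>S - {x}. 0 < inner u (V i)" for u z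
    using exists_small_shift[OF fin, of u z] that by auto
  have Zp: "pointed S" "turned S x" if Z
  proof -
    obtain u where u: "\<forall>i\<in>S - {x}. 0 < inner u (V i)" "inner u (V x) = 0" using \<open>Z\<close> Z_def by blast
    from tilt[OF u(1), of "V x"] obtain \<epsilon> where e: "0 < \<epsilon>" "\<forall>i\<in>S - {x}. 0 < inner (u + \<epsilon> *\<^sub>R V x) (V i)" by blast
    have "0 < inner (u + \<epsilon> *\<^sub>R V x) (V x)" using e(1) xx u(2) by (simp add: inner_add_left)
    then show "pointed S" using e(2) unfolding pointed_def by blast
    from tilt[OF u(1), of "- V x"] obtain \<epsilon> where e: "0 < \<epsilon>" "\<forall>i\<in>S - {x}. 0 < inner (u + \<epsilon> *\<^sub>R - V x) (V i)" by blast
    have "inner (u + \<epsilon> *\<^sub>R - V x) (V x) < 0" using e(1) xx u(2) by (simp add: inner_diff_left)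
    then show "turned S x" using e(2) unfolding turned_def by blast
  qed
  have Zi: Z if pt: "pointed S" "turned S x"
  proof -
    obtain u where u: "\<And>i. i \<in> S \<Longrightarrow> 0 < inner u (V i)" using pt(1) pointed_def by blast
    obtain u' where u': "\<forall>i\<in>S - {x}. 0 < inner u' (V i)" "inner u' (V x) < 0" using pt(2) turned_def by blast
    let ?z = "(- inner u' (V x)) *\<^sub>R u + inner u (V x) *\<^sub>R u'"
    have "inner ?z (V x) = 0" by (simp add: inner_diff_left)
    moreover have "0 < inner ?z (V i)" if "i \<in> S - {x}" for i
    proof -
      have "0 < - inner u' (V x) * inner u (V i)" "0 < inner u (V x) * inner u' (V i)"
        using u[of i] u[OF x] u' that by (auto intro: mult_neg_pos)
      then show ?thesis by (simp add: inner_diff_left)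
    qed
    ultimately show ?thesis unfolding Z_def by blast
  qed
  have or: "pointed (S - {x}) \<longleftrightarrow> pointed S \<or> turned S x"
  proof
    assume "pointed (S - {x})"
    then obtain u where u: "\<forall>i\<in>S - {x}. 0 < inner u (V i)" using pointed_def by blast
    consider "0 < inner u (V x)" | "inner u (V x) < 0" | "inner u (V x) = 0" by linarith
    then show "pointed S \<or> turned S x"
    proof cases
      case 1
      then have "\<forall>i\<in>S. 0 < inner u (V i)" using u by blast
      then show ?thesis unfolding pointed_def by blast
    next
      case 2
      then show ?thesis using u unfolding turned_def by blast
    next
      case 3
      then show ?thesis using Zp u unfolding Z_def by blast
    qed
  qed (auto simp: pointed_def turned_def)
  have card: "card {p \<in> pairs. fst p = x \<and> supports (fst p) (snd p) S} = of_bool Z" (is "card ?P = _")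
  proof (cases Z)
    case True
    then obtain u where "\<forall>i\<in>S - {x}. 0 < inner u (V i)" "inner u (V x) = 0" using Z_def by blast
    then obtain b where b: "b \<in> S - {x}" "supports x b S" using exists_supports_at[OF S x, of u] ne by blast
    have "?P = {(x, b)}"
    proof (intro equalityI subsetI)
      fix p assume p: "p \<in> ?P"
      obtain b' where b': "p = (x, b')" "supports x b' S" "b' \<noteq> x" using p by (cases p) (auto simp: pairs_def)
      have "b' = b"
      proof (rule ccontr)
        assume ne: "b' \<noteq> b"
        have "0 < orient x b b'" "0 < orient x b' b" using b b' ne by (auto simp: supports_def)
        moreover have "orient x b' b = - orient x b b'" using orient_cycle[of x b' b] orient_swap[of b x b'] by simp
        ultimately show False by simp
      qed
      then show "p \<in> {(x, b)}" using b'(1) by simp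
    qed (use b S xI in \<open>auto simp: pairs_def\<close>)
    then show ?thesis using True by simp
  next
    case False
    have "?P = {}"
    proof (rule equals0I)
      fix p assume p: "p \<in> ?P"
      then obtain b where b: "p = (x, b)" "supports x b S" "b \<noteq> x" by (cases p) (auto simp: pairs_def)
      then show False using supports_imp_values(1)[OF S _ b(2)] False unfolding Z_def by blast
    qed
    then show ?thesis using False by (simp only: card.empty of_bool_eq)
  qed
  show ?thesis unfolding card using or Zp Zi by (auto simp: of_bool_def)
qed

text \<open>The sum of \<open>turned_balance\<close> over all marked sets: a pointed set of size
  \<open>s - 1\<close> arises from \<open>n - (s - 1)\<close> of them, and a supporting pair is
  counted only for its first element.\<close>

lemma qcount_eq:
  assumes s: "2 \<le> s"
  shows "qcount s + s * pcount s = (n + 1 - s) * pcount (s - 1) + (\<Sum>(a, b)\<in>pairs. left a b choose (s - 2))"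
proof -
  have inner_sum: "card {x \<in> S. turned S x} + s * of_bool (pointed S) =
      card {x \<in> S. pointed (S - {x})} + card {p \<in> pairs. supports (fst p) (snd p) S}" if "S \<in> subs s" for S
  proof -
    note S = subsD[OF that]
    have ne: "S - {x} \<noteq> {}" if "x \<in> S" for x
    proof
      assume "S - {x} = {}"
      then have "card S \<le> card {x}" by (intro card_mono) auto
      then show False using S(3) s by simp
    qed
    have "(\<Sum>x\<in>S. of_bool (turned S x) + of_bool (pointed S)) =
        (\<Sum>x\<in>S. of_bool (pointed (S - {x})) + card {p \<in> pairs. fst p = x \<and> supports (fst p) (snd p) S})"
      using turned_balance[OF S(1) _ ne] by (intro sum.cong) auto
    moreover have "(\<Sum>x\<in>S. card {p \<in> pairs. fst p = x \<and> supports (fst p) (snd p) S}) =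
        card {p \<in> pairs. supports (fst p) (snd p) S}"
    proof -
      have "{p \<in> pairs. supports (fst p) (snd p) S} = (\<Union>x\<in>S. {p \<in> pairs. fst p = x \<and> supports (fst p) (snd p) S})"
        by (auto simp: supports_def)
      then show ?thesis using S(2) finite_pairs by (simp only:) (rule card_UN_disjoint[symmetric]; auto)
    qed
    ultimately show ?thesis using S(2,3) by (simp add: sum.distrib Collect_conj_eq Int_commute)
  qed
  have q: "qcount s = (\<Sum>S\<in>subs s. card {x \<in> S. turned S x})"
  proof -
    have "{(S, x). S \<in> subs s \<and> x \<in> S \<and> turned S x} = (SIGMA S:subs s. {x \<in> S. turned S x})" by auto
    then show ?thesis unfolding qcount_def using finite_subs subsD(2) by (simp add: card_SigmaI)
  qed
  have p: "s * pcount s = (\<Sum>S\<in>subs s. s * of_bool (pointed S))"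
    unfolding pcount_def using finite_subs by (simp add: sum_distrib_left[symmetric] Collect_conj_eq Int_commute)
  have "(\<Sum>S\<in>subs s. card {x \<in> S. pointed (S - {x})}) = card (SIGMA S:subs s. {x \<in> S. pointed (S - {x})})"
    using finite_subs subsD(2) by (simp add: card_SigmaI)
  also have "\<dots> = card (SIGMA T:{T \<in> subs (s - 1). pointed T}. {1..n} - T)"
  proof (rule bij_betw_same_card[OF bij_betw_byWitness[where f = "\<lambda>(S, x). (S - {x}, x)" and f' = "\<lambda>(T, x). (insert x T, x)"]])
    show "(\<lambda>(S, x). (S - {x}, x)) ` (SIGMA S:subs s. {x \<in> S. pointed (S - {x})}) \<subseteq> (SIGMA T:{T \<in> subs (s - 1). pointed T}. {1..n} - T)"
      using finite_subset by (fastforce simp: subs_def)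
    show "(\<lambda>(T, x). (insert x T, x)) ` (SIGMA T:{T \<in> subs (s - 1). pointed T}. {1..n} - T) \<subseteq> (SIGMA S:subs s. {x \<in> S. pointed (S - {x})})"
      using s finite_subset[of _ "{1..n}"] by (auto simp: subs_def)
  qed auto
  also have "\<dots> = (\<Sum>T\<in>{T \<in> subs (s - 1). pointed T}. card ({1..n} - T))"
    using finite_subs by (simp add: card_SigmaI)
  also have "\<dots> = (\<Sum>T\<in>{T \<in> subs (s - 1). pointed T}. n + 1 - s)"
  proof (rule sum.cong[OF refl])
    fix T assume "T \<in> {T \<in> subs (s - 1). pointed T}"
    then have "T \<subseteq> {1..n}" "finite T" "card T = s - 1" using subsD by auto
    then show "card ({1..n} - T) = n + 1 - s" using s by (simp add: card_Diff_subset)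
  qed
  also have "\<dots> = (n + 1 - s) * pcount (s - 1)" by (simp add: pcount_def)
  finally have r: "(\<Sum>S\<in>subs s. card {x \<in> S. pointed (S - {x})}) = (n + 1 - s) * pcount (s - 1)" .
  show ?thesis
    unfolding q p r[symmetric] sum_supports[OF order_refl s, symmetric] sum.distrib[symmetric]
    using inner_sum by (intro sum.cong refl)
qed

end

section \<open>Halving planes\<close>

context vector_config
begin

lemma cross_cross_nonzero:
  assumes "a \<in> {1..n}" "b \<in> {1..n}" "c \<in> {1..n}" "d \<in> {1..n}" "a \<noteq> b" "c \<noteq> d" "{a, b} \<inter> {c, d} = {}"
  shows "cross3 (cross3 (V a) (V b)) (cross3 (V c) (V d)) \<noteq> 0"
proof
  assume "cross3 (cross3 (V a) (V b)) (cross3 (V c) (V d)) = 0"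
  then have z: "orient a b d *\<^sub>R V c - orient a b c *\<^sub>R V d = 0" by (simp add: Lagrange orient_def)
  obtain g where "inner g (V c) = 1" "inner g (V d) = 0" using exists_values[OF assms(3,4,6)] by blast
  then have "orient a b d = 0" using arg_cong[OF z, of "inner g"] by (simp add: inner_diff_right)
  moreover have "orient a b d \<noteq> 0" using assms by (intro orient_nonzero) auto
  ultimately show False by simp
qed

text \<open>The plane through \<open>a\<close> and \<open>b\<close> is tilted so that both drop to
  the negative side. The positive side of the tilted plane then contains only vectors to the left of
  \<open>(a, b)\<close>.\<close>

lemma coneighborly_left:
  assumes "coneighborly n V" "(a, b) \<in> pairs"
  shows "(n - 2) div 2 \<le> left a b"
proof -
  have ab: "a \<in> {1..n}" "b \<in> {1..n}" "a \<noteq> b" using assms(2) by (auto simp: pairs_def)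
  let ?f = "cross3 (V a) (V b)"
  define L where "L = {c \<in> {1..n}. 0 < orient a b c}"
  obtain g where g: "inner g (V a) = -1" "inner g (V b) = -1" using exists_values[OF ab] by blast
  have "\<exists>\<epsilon>>0. \<forall>x\<in>V ` ({1..n} - L). 0 < inner (- ?f + \<epsilon> *\<^sub>R - g) x"
  proof (rule exists_small_shift)
    fix x assume "x \<in> V ` ({1..n} - L)"
    then obtain c where c: "x = V c" "c \<in> {1..n}" "\<not> 0 < orient a b c" unfolding L_def by blast
    have "c \<noteq> a \<Longrightarrow> c \<noteq> b \<Longrightarrow> orient a b c \<noteq> 0" using orient_nonzero[of a b c] ab c(2) by auto
    moreover have "inner ?f (V c) = orient a b c" by (simp add: orient_def)
    moreover have "orient a b a = 0" "orient a b b = 0" by simp_all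
    ultimately show "0 < inner (- ?f) x \<or> inner (- ?f) x = 0 \<and> 0 < inner (- g) x"
      using g c(1,3) by (cases "c = a"; cases "c = b") auto
  qed simp
  then obtain \<epsilon> where e: "\<And>c. c \<in> {1..n} - L \<Longrightarrow> 0 < inner (- ?f + \<epsilon> *\<^sub>R - g) (V c)" by blast
  let ?u = "?f + \<epsilon> *\<^sub>R g"
  have neg: "inner ?u (V c) < 0" if "c \<in> {1..n} - L" for c
    using e[OF that] by (simp add: inner_add_left inner_diff_left)
  have "a \<in> {1..n} - L" using ab by (simp add: L_def)
  from neg[OF this] have "?u \<noteq> 0" by auto
  then have "(n - 2) div 2 \<le> card {i \<in> {1..n}. 0 < inner ?u (V i)}"
    using assms(1) unfolding coneighborly_def by blast
  also have "\<dots> \<le> card L"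
  proof (rule card_mono)
    show "{i \<in> {1..n}. 0 < inner ?u (V i)} \<subseteq> L"
    proof
      fix i assume i: "i \<in> {i \<in> {1..n}. 0 < inner ?u (V i)}"
      then have "\<not> inner ?u (V i) < 0" by simp
      then have "i \<notin> {1..n} - L" using neg by blast
      then show "i \<in> L" using i by blast
    qed
  qed (simp add: L_def)
  finally show ?thesis by (simp add: left_def L_def)
qed

text \<open>Discrete intermediate values: along the pencil \<open>w0 - t *\<^sub>R w1\<close> the
  positive side changes from that of \<open>w1\<close> to that of \<open>- w1\<close>, and between
  consecutive samples at most one vector changes sides.\<close>

lemma exists_halving:
  "\<exists>w. generic_for n V w \<and> card {i \<in> {1..n}. 0 < inner w (V i)} = n div 2"
proof -
  define Q where "Q = (\<lambda>(a, b, c, d). cross3 (cross3 (V a) (V b)) (cross3 (V c) (V d))) `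
    {(a, b, c, d). a \<in> {1..n} \<and> b \<in> {1..n} \<and> c \<in> {1..n} \<and> d \<in> {1..n} \<and> a \<noteq> b \<and> c \<noteq> d \<and> {a, b} \<inter> {c, d} = {}}"
  define N where "N = V ` {1..n} \<union> Q"
  have "finite Q" unfolding Q_def
    by (rule finite_imageI, rule finite_subset[of _ "{1..n} \<times> {1..n} \<times> {1..n} \<times> {1..n}"]) auto
  then have finN: "finite N" by (simp add: N_def)
  have N0: "0 \<notin> N"
  proof
    assume "0 \<in> N"
    then show False using vec_nonzero cross_cross_nonzero unfolding N_def Q_def by fastforce
  qed
  have genI: "generic_for n V w" if w: "\<And>x. x \<in> N \<Longrightarrow> inner w x \<noteq> 0" for w
  proof -
    have "cross3 (cross3 (V a) (V b)) (cross3 (V c) (V d)) \<in> N"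
      if "a \<in> {1..n}" "b \<in> {1..n}" "c \<in> {1..n}" "d \<in> {1..n}" "a \<noteq> b" "c \<noteq> d" "{a, b} \<inter> {c, d} = {}" for a b c d
      unfolding N_def Q_def using that by (intro UnI2 image_eqI[of _ _ "(a, b, c, d)"]) auto
    moreover have "V i \<in> N" if "i \<in> {1..n}" for i using that by (simp add: N_def)
    ultimately show ?thesis using w unfolding generic_for_def by blast
  qed
  obtain w0 where w0: "\<And>x. x \<in> N \<Longrightarrow> inner w0 x \<noteq> 0" using exists_nonorthogonal[OF finN N0] by blast
  let ?p = "\<lambda>i. V i /\<^sub>R inner w0 (V i)"
  have VN: "V i \<in> N" if "i \<in> {1..n}" for i using that by (simp add: N_def)
  \<comment> \<open>Nonzero values of \<open>w1\<close> on these differences will keep two vectors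
    from changing sides at the same parameter.\<close>
  define D where "D = (\<lambda>(a, b). ?p a - ?p b) ` pairs"
  have D0: "0 \<notin> D"
  proof
    assume "0 \<in> D"
    then obtain a b where ab: "a \<in> {1..n}" "b \<in> {1..n}" "a \<noteq> b" "?p a = ?p b" by (auto simp: D_def pairs_def)
    obtain g where "inner g (V a) = 1" "inner g (V b) = 0" using exists_values[OF ab(1-3)] by blast
    then have "inverse (inner w0 (V a)) = 0" using arg_cong[OF ab(4), of "inner g"] by simp
    then show False using w0[OF VN[OF ab(1)]] by simp
  qed
  have "finite (N \<union> D)" "0 \<notin> N \<union> D" using finN N0 D0 finite_pairs by (auto simp: D_def)
  then have "\<exists>g. \<forall>x\<in>N \<union> D. inner g x \<noteq> 0" by (rule exists_nonorthogonal)
  then obtain v where v: "\<And>x. x \<in> N \<union> D \<Longrightarrow> inner v x \<noteq> 0" by blast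
  have comp: "card {i \<in> {1..n}. 0 < inner v (V i)} + card {i \<in> {1..n}. inner v (V i) < 0} = n"
  proof -
    have "{1..n} = {i \<in> {1..n}. 0 < inner v (V i)} \<union> {i \<in> {1..n}. inner v (V i) < 0}"
      using v VN by (auto simp: not_less_iff_gr_or_eq)
    then have "n = card ({i \<in> {1..n}. 0 < inner v (V i)} \<union> {i \<in> {1..n}. inner v (V i) < 0})"
      by (metis card_atLeastAtMost diff_Suc_1)
    also have "\<dots> = card {i \<in> {1..n}. 0 < inner v (V i)} + card {i \<in> {1..n}. inner v (V i) < 0}"
      by (rule card_Un_disjoint) auto
    finally show ?thesis by simp
  qed
  \<comment> \<open>The sign of \<open>v\<close> is chosen so that the count starts at or below
    \<open>n div 2\<close> and ends at or above it.\<close>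
  obtain w1 where w1: "\<And>x. x \<in> N \<union> D \<Longrightarrow> inner w1 x \<noteq> 0"
      and half: "card {i \<in> {1..n}. 0 < inner w1 (V i)} \<le> n div 2" "n div 2 \<le> card {i \<in> {1..n}. inner w1 (V i) < 0}"
  proof (cases "card {i \<in> {1..n}. 0 < inner v (V i)} \<le> n div 2")
    case True
    then show ?thesis using that[of v] v comp by simp
  next
    case False
    then have "card {i \<in> {1..n}. inner v (V i) < 0} \<le> n div 2" "n div 2 \<le> card {i \<in> {1..n}. 0 < inner v (V i)}"
      using comp by linarith+
    then show ?thesis using that[of "- v"] v by simp
  qed
  define tm where "tm x = inner w0 x / inner w1 x" for x
  have lin: "inner (w0 - t *\<^sub>R w1) x = - inner w1 x * (t - tm x)" if "x \<in> N" for x t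
    using w1[of x] that by (simp add: tm_def inner_diff_left field_simps)
  \<comment> \<open>\<open>N\<close> contains the iterated cross products besides the vectors, so a
    sample, which avoids all of \<open>B\<close>, gives a generic functional.\<close>
  define B where "B = tm ` N"
  have finB: "finite B" using finN by (simp add: B_def)
  have "\<And>b. b \<in> B \<Longrightarrow> b < Max B + 1" using Max_ge[OF finB] by (meson add_pos_nonneg less_add_one order_le_less_trans)
  from finite_reals_samples[OF finB this] obtain \<phi> bs where
    between: "\<And>s. s < card B \<Longrightarrow> \<phi> s < bs s \<and> bs s < \<phi> (Suc s)"
    and only: "\<And>s b. s < card B \<Longrightarrow> b \<in> B \<Longrightarrow> \<phi> s \<le> b \<Longrightarrow> b \<le> \<phi> (Suc s) \<Longrightarrow> b = bs s"
    and ends: "\<And>b. b \<in> B \<Longrightarrow> \<phi> 0 < b \<and> b < \<phi> (card B)"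
    by blast
  have tm_inj: "a = b" if "a \<in> {1..n}" "b \<in> {1..n}" "tm (V a) = tm (V b)" for a b
  proof (rule ccontr)
    assume "a \<noteq> b"
    then have "?p a - ?p b \<in> D" using that by (force simp: D_def pairs_def)
    then have "inner w1 (?p a - ?p b) \<noteq> 0" using w1 by blast
    then show False using that(3) w0[OF VN[OF that(1)]] w0[OF VN[OF that(2)]] w1[of "V a"] w1[of "V b"] VN that(1,2)
      by (simp add: tm_def inner_diff_right field_simps)
  qed
  define P where "P t = {i \<in> {1..n}. 0 < inner (w0 - t *\<^sub>R w1) (V i)}" for t
  have "\<bar>int (card (P (\<phi> (Suc s)))) - int (card (P (\<phi> s)))\<bar> \<le> 1" if s: "s < card B" for s
  proof -
    have same: "i \<in> P (\<phi> (Suc s)) \<longleftrightarrow> i \<in> P (\<phi> s)" if "i \<in> {1..n}" "tm (V i) \<noteq> bs s" for i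
    proof -
      have "tm (V i) \<in> B" using VN[OF that(1)] by (simp add: B_def)
      then have "\<not> (\<phi> s \<le> tm (V i) \<and> tm (V i) \<le> \<phi> (Suc s))" using only[OF s] that(2) by blast
      then have "0 < - inner w1 (V i) * (\<phi> (Suc s) - tm (V i)) \<longleftrightarrow> 0 < - inner w1 (V i) * (\<phi> s - tm (V i))"
        by (rule real_linear_same_sign) (use between[OF s] in auto)
      then show ?thesis using that(1) lin[OF VN[OF that(1)]] by (simp add: P_def)
    qed
    have "\<exists>i. \<forall>k\<in>{1..n}. tm (V k) = bs s \<longrightarrow> k = i"
    proof (cases "\<exists>i\<in>{1..n}. tm (V i) = bs s")
      case True
      then obtain i where i: "i \<in> {1..n}" "tm (V i) = bs s" by blast
      then have "\<forall>k\<in>{1..n}. tm (V k) = bs s \<longrightarrow> k = i" using tm_inj[OF _ i(1)] by simp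
      then show ?thesis by blast
    qed blast
    then obtain i where i: "\<And>k. k \<in> {1..n} \<Longrightarrow> tm (V k) = bs s \<Longrightarrow> k = i" by blast
    have ins: "card X \<le> Suc (card Y)" if "X \<subseteq> insert i Y" "finite Y" for X Y :: "nat set"
      using card_mono[OF _ that(1)] that(2) by (simp add: card_insert_if split: if_splits)
    have "P (\<phi> (Suc s)) \<subseteq> insert i (P (\<phi> s))" "P (\<phi> s) \<subseteq> insert i (P (\<phi> (Suc s)))"
      using same i unfolding P_def by blast+
    moreover have "finite (P t)" for t by (simp add: P_def)
    ultimately have "card (P (\<phi> (Suc s))) \<le> Suc (card (P (\<phi> s)))" "card (P (\<phi> s)) \<le> Suc (card (P (\<phi> (Suc s))))"
      using ins by blast+
    then show ?thesis by linarith
  qed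
  moreover have "P (\<phi> 0) = {i \<in> {1..n}. 0 < inner w1 (V i)}"
  proof -
    have "0 < inner (w0 - \<phi> 0 *\<^sub>R w1) (V i) \<longleftrightarrow> 0 < inner w1 (V i)" if "i \<in> {1..n}" for i
    proof -
      have "0 < tm (V i) - \<phi> 0" using ends[of "tm (V i)"] VN[OF that] by (simp add: B_def)
      moreover have "inner (w0 - \<phi> 0 *\<^sub>R w1) (V i) = inner w1 (V i) * (tm (V i) - \<phi> 0)"
        using lin[OF VN[OF that]] by (simp add: algebra_simps)
      ultimately show ?thesis by (metis mult_pos_pos zero_less_mult_pos2)
    qed
    then show ?thesis by (auto simp: P_def)
  qed
  moreover have "P (\<phi> (card B)) = {i \<in> {1..n}. inner w1 (V i) < 0}"
  proof -
    have "0 < inner (w0 - \<phi> (card B) *\<^sub>R w1) (V i) \<longleftrightarrow> inner w1 (V i) < 0" if "i \<in> {1..n}" for i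
    proof -
      have "0 < \<phi> (card B) - tm (V i)" using ends[of "tm (V i)"] VN[OF that] by (simp add: B_def)
      moreover have "inner (w0 - \<phi> (card B) *\<^sub>R w1) (V i) = (- inner w1 (V i)) * (\<phi> (card B) - tm (V i))"
        using lin[OF VN[OF that]] by simp
      ultimately have "0 < inner (w0 - \<phi> (card B) *\<^sub>R w1) (V i) \<longleftrightarrow> 0 < - inner w1 (V i)"
        by (metis mult_pos_pos zero_less_mult_pos2)
      then show ?thesis by simp
    qed
    then show ?thesis by (auto simp: P_def)
  qed
  ultimately have "\<exists>s\<le>card B. int (card (P (\<phi> s))) = int (n div 2)"
    using half by (intro nat0_intermed_int_val) auto
  then obtain s where s: "s \<le> card B" "card (P (\<phi> s)) = n div 2" by auto
  have "\<phi> s \<notin> B"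
  proof
    assume b: "\<phi> s \<in> B"
    show False
    proof (cases "s < card B")
      case True
      then show False using only[OF True b] between[OF True] by auto
    next
      case False
      then show False using ends[OF b] s(1) by simp
    qed
  qed
  then have "inner (w0 - \<phi> s *\<^sub>R w1) x \<noteq> 0" if "x \<in> N" for x
    using lin[OF that, of "\<phi> s"] w1[of x] that by (auto simp: B_def)
  then show ?thesis using genI s(2) unfolding P_def by blast
qed

end

text \<open>If the triple product vanished, Cramer's rule would give a relation whose coefficients
  must all be 0 by independence. Then the cross product of \<open>v a\<close> and \<open>v b\<close>
  vanishes, and the Lagrange identity makes these two dependent.\<close>

lemma general_position_vector_config:
  assumes "3 \<le> n" "general_position n v"
  shows "vector_config n v"
proof
  fix a b c assume abc: "a \<in> {1..n}" "b \<in> {1..n}" "c \<in> {1..n}" "a \<noteq> b" "b \<noteq> c" "a \<noteq> c"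
  then have "{a, b, c} \<subseteq> {1..n}" "card {a, b, c} = 3" by auto
  then have g: "inj_on v {a, b, c}" "independent (v ` {a, b, c})"
    using assms(2) unfolding general_position_def by blast+
  then have ne: "v a \<noteq> v b" "v b \<noteq> v c" "v a \<noteq> v c" using abc by (auto simp: inj_on_def)
  have lin: "\<alpha> = 0 \<and> \<beta> = 0 \<and> \<gamma> = 0" if "\<alpha> *\<^sub>R v a + \<beta> *\<^sub>R v b + \<gamma> *\<^sub>R v c = 0" for \<alpha> \<beta> \<gamma>
  proof -
    let ?u = "(\<lambda>_. 0)(v a := \<alpha>, v b := \<beta>, v c := \<gamma>)"
    have S: "(\<Sum>x\<in>v ` {a, b, c}. ?u x *\<^sub>R x) = 0" using that ne by (simp add: add.assoc)
    have "?u x = 0" if "x \<in> v ` {a, b, c}" for x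
      by (rule independentD[OF g(2) _ order_refl S that]) simp
    then have "?u (v a) = 0" "?u (v b) = 0" "?u (v c) = 0" by blast+
    then show ?thesis using ne by simp
  qed
  show "inner (cross3 (v a) (v b)) (v c) \<noteq> 0"
  proof
    assume z: "inner (cross3 (v a) (v b)) (v c) = 0"
    have "inner (cross3 (v a) (v b)) x = 0" for x
      using lin cramer_cross3[of "v a" "v b" "v c" x] z by (metis scaleR_zero_left)
    then have "cross3 (v a) (v b) = 0" by (metis inner_eq_zero_iff)
    then have "inner (v a) (v b) *\<^sub>R v a + (- inner (v a) (v a)) *\<^sub>R v b + 0 *\<^sub>R v c = 0"
      using Lagrange[of "v a" "v a" "v b"] by simp
    then have "v a = 0" using lin by fastforce
    then have "1 *\<^sub>R v a + 0 *\<^sub>R v b + 0 *\<^sub>R v c = 0" by simp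
    then show False using lin by fastforce
  qed
qed (use assms in simp)

section \<open>Dependency patterns as non-separable pairs\<close>

definition signs :: "nat \<Rightarrow> nat set \<Rightarrow> nat set \<Rightarrow> nat \<Rightarrow> real" where
  "signs n A B = (\<lambda>i\<in>{1..n}. if i \<in> A then 1 else if i \<in> B then -1 else 0)"

lemma parts_signs:
  assumes "A \<subseteq> {1..n}" "B \<subseteq> {1..n}" "A \<inter> B = {}"
  shows "pos_part n (signs n A B) = A" "neg_part n (signs n A B) = B"
  using assms by (auto simp: pos_part_def neg_part_def signs_def)

lemma dependency_pattern_eq_signs:
  assumes "F \<in> dependency_patterns n v"
  shows "F = signs n (pos_part n F) (neg_part n F)"
proof -
  obtain l where F: "F = (\<lambda>i\<in>{1..n}. sgn (l i))" using assms unfolding dependency_patterns_def by blast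
  show ?thesis
  proof
    fix i
    show "F i = signs n (pos_part n F) (neg_part n F) i"
      by (cases "i \<in> {1..n}") (auto simp: F signs_def pos_part_def neg_part_def sgn_if)
  qed
qed

context vector_config
begin

definition separable :: "nat set \<Rightarrow> nat set \<Rightarrow> bool" where
  "separable A B \<longleftrightarrow> (\<exists>u. (\<forall>i\<in>A. 0 < inner u (V i)) \<and> (\<forall>i\<in>B. inner u (V i) < 0))"

lemma signs_dependency_imp_not_separable:
  assumes A: "A \<subseteq> {1..n}" "B \<subseteq> {1..n}" "A \<inter> B = {}" and F: "signs n A B \<in> dependency_patterns n V"
  shows "\<not> separable A B"
proof
  assume "separable A B"
  then obtain u where u: "\<And>i. i \<in> A \<Longrightarrow> 0 < inner u (V i)" "\<And>i. i \<in> B \<Longrightarrow> inner u (V i) < 0"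
    unfolding separable_def by blast
  obtain l where l: "signs n A B = (\<lambda>i\<in>{1..n}. sgn (l i))" "\<exists>i\<in>{1..n}. l i \<noteq> 0" "(\<Sum>i\<in>{1..n}. l i *\<^sub>R V i) = 0"
    using F unfolding dependency_patterns_def by blast
  have sg: "sgn (l i) = (if i \<in> A then 1 else if i \<in> B then -1 else 0)" if "i \<in> {1..n}" for i
    using fun_cong[OF l(1), of i] that by (simp add: signs_def)
  have pos: "0 < l i * inner u (V i)" if "i \<in> {1..n}" "l i \<noteq> 0" for i
  proof -
    have "i \<in> A \<and> sgn (l i) = 1 \<or> i \<in> B \<and> sgn (l i) = -1"
      using sg[OF that(1)] that(2) by (auto simp: sgn_0_0 split: if_splits)
    then consider "i \<in> A" "sgn (l i) = 1" | "i \<in> B" "sgn (l i) = -1" by blast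
    then show ?thesis
    proof cases
      case 1
      then show ?thesis using u(1)[of i] by (simp add: sgn_1_pos)
    next
      case 2
      then show ?thesis using u(2)[of i] by (simp add: sgn_1_neg mult_neg_neg)
    qed
  qed
  obtain k where k: "k \<in> {1..n}" "l k \<noteq> 0" using l(2) by blast
  have "0 \<le> l i * inner u (V i)" if "i \<in> {1..n}" for i
    using pos[OF that] by (cases "l i = 0") auto
  then have "0 < (\<Sum>i\<in>{1..n}. l i * inner u (V i))"
    using pos[OF k] by (intro sum_pos2[where i = k] k(1)) auto
  also have "(\<Sum>i\<in>{1..n}. l i * inner u (V i)) = inner u (\<Sum>i\<in>{1..n}. l i *\<^sub>R V i)"
    by (simp add: inner_sum_right)
  finally show False using l(3) by simp
qed

text \<open>Gordan's alternative, strengthened to a dependency whose support is all of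
  \<open>A\<close> and \<open>B\<close>. Separation of 0 from the convex hull gives nonnegative
  coefficients only; general position then supplies three positive ones whose vectors form a
  basis.\<close>

lemma signs_dependency_if_not_separable:
  assumes A: "A \<subseteq> {1..n}" "B \<subseteq> {1..n}" "A \<inter> B = {}" and ns: "\<not> separable A B"
  shows "signs n A B \<in> dependency_patterns n V"
proof -
  define S where "S = A \<union> B"
  define \<sigma> where "\<sigma> i = (if i \<in> A then 1 else -1 :: real)" for i
  define y where "y i = \<sigma> i *\<^sub>R V i" for i
  have S: "S \<subseteq> {1..n}" "finite S" using A finite_subset[of _ "{1..n}"] unfolding S_def by auto
  have \<sigma>: "\<sigma> i \<noteq> 0" for i by (simp add: \<sigma>_def)
  have sep: "separable A B" if "\<And>i. i \<in> S \<Longrightarrow> 0 < inner u (y i)" for u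
    unfolding separable_def
  proof (intro exI[of _ u] conjI ballI)
    fix i assume "i \<in> A"
    then show "0 < inner u (V i)" using that[of i] by (simp add: S_def y_def \<sigma>_def)
  next
    fix i assume "i \<in> B"
    moreover from this have "i \<notin> A" using A(3) by blast
    ultimately show "inner u (V i) < 0" using that[of i] by (simp add: S_def y_def \<sigma>_def)
  qed
  have inj: "inj_on y S"
  proof (rule inj_onI, rule ccontr)
    fix i k assume ik: "i \<in> S" "k \<in> S" "y i = y k" "i \<noteq> k"
    then have "i \<in> {1..n}" "k \<in> {1..n}" using S by auto
    from exists_values[OF this ik(4)] obtain g where "inner g (V i) = 1" "inner g (V k) = 0" by blast
    then show False using arg_cong[OF ik(3), of "inner g"] \<sigma>[of i] by (simp add: y_def)
  qed
  have "0 \<in> convex hull (y ` S)"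
  proof (rule ccontr)
    assume z: "0 \<notin> convex hull (y ` S)"
    have "closed (convex hull (y ` S))"
      using S(2) by (intro compact_imp_closed compact_convex_hull finite_imp_compact) simp
    from separating_hyperplane_closed_0[OF convex_convex_hull this z] obtain a b
      where "0 < b" "\<forall>x\<in>convex hull (y ` S). b < inner a x" by blast
    then have "0 < inner a (y i)" if "i \<in> S" for i
      using that hull_subset[of "y ` S" convex] by (meson imageI less_trans subsetD)
    then show False using sep ns by blast
  qed
  then obtain c where c: "\<And>x. x \<in> y ` S \<Longrightarrow> 0 \<le> c x" "(\<Sum>x\<in>y ` S. c x) = 1" "(\<Sum>x\<in>y ` S. c x *\<^sub>R x) = 0"
    using S(2) by (auto simp: convex_hull_finite)
  define \<mu> where "\<mu> i = c (y i)" for i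
  have \<mu>: "\<And>i. i \<in> S \<Longrightarrow> 0 \<le> \<mu> i" "(\<Sum>i\<in>S. \<mu> i) = 1" "(\<Sum>i\<in>S. \<mu> i *\<^sub>R y i) = 0"
    using c sum.reindex[OF inj, of c] sum.reindex[OF inj, of "\<lambda>x. c x *\<^sub>R x"] by (auto simp: \<mu>_def o_def)
  \<comment> \<open>A functional that is 1 at \<open>V a\<close> and 0 at \<open>V b\<close> shows
    that no dependency has its support inside \<open>{a, b}\<close> and a nonzero coefficient at
    \<open>a\<close>.\<close>
  have wide: "\<exists>i\<in>S. i \<noteq> a \<and> i \<noteq> b \<and> 0 < \<mu> i" if ab: "a \<in> S" "0 < \<mu> a" "b \<in> {1..n}" "a \<noteq> b" for a b
  proof (rule ccontr)
    assume no: "\<not> ?thesis"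
    have aI: "a \<in> {1..n}" using ab(1) S(1) by blast
    obtain g where g: "inner g (V a) = 1" "inner g (V b) = 0" using exists_values[OF aI ab(3,4)] by blast
    have "inner g (\<mu> i *\<^sub>R y i) = 0" if "i \<in> S" "i \<noteq> a" for i
      using no \<mu>(1)[OF that(1)] that g by (cases "i = b") (auto simp: y_def order.order_iff_strict)
    then have "(\<Sum>i\<in>S. inner g (\<mu> i *\<^sub>R y i)) = (\<Sum>i\<in>{a}. inner g (\<mu> i *\<^sub>R y i))"
      using ab(1) S(2) by (intro sum.mono_neutral_right) auto
    moreover have "(\<Sum>i\<in>S. inner g (\<mu> i *\<^sub>R y i)) = 0"
      unfolding inner_sum_right[symmetric] \<mu>(3) by simp
    ultimately show False using ab(2) g(1) \<sigma>[of a] by (simp add: y_def)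
  qed
  have "\<exists>a\<in>S. 0 < \<mu> a"
  proof (rule ccontr)
    assume "\<not> ?thesis"
    then have "\<mu> i = 0" if "i \<in> S" for i using \<mu>(1)[OF that] that by (force simp: order.order_iff_strict)
    then show False using \<mu>(2) by simp
  qed
  then obtain a where a: "a \<in> S" "0 < \<mu> a" by blast
  obtain a' where "a' \<in> {1..n}" "a' \<noteq> a" using exists_third by blast
  with wide[OF a] obtain b where b: "b \<in> S" "b \<noteq> a" "0 < \<mu> b" by blast
  with wide[OF a, of b] S(1) obtain d where d: "d \<in> S" "d \<noteq> a" "d \<noteq> b" "0 < \<mu> d" by blast
  define D where "D = inner (cross3 (y a) (y b)) (y d)"
  have "D = \<sigma> a * \<sigma> b * \<sigma> d * orient a b d"
    by (simp add: D_def y_def orient_def cross_mult_left cross_mult_right)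
  moreover have "orient a b d \<noteq> 0" using a b d S(1) by (intro orient_nonzero) auto
  ultimately have D: "D \<noteq> 0" using \<sigma> by simp
  \<comment> \<open>With all coefficients equal to 1 the sum misses 0 by \<open>z\<close>. The
    correction \<open>\<delta>\<close>, supported on the basis \<open>y a\<close>,
    \<open>y b\<close>, \<open>y d\<close>, repairs this, and \<open>K\<close> times the relation
    \<open>\<mu>\<close> makes these three coefficients positive again.\<close>
  define z where "z = - (\<Sum>i\<in>S. y i)"
  obtain \<alpha> \<beta> \<gamma> where "D *\<^sub>R z = \<alpha> *\<^sub>R y a + \<beta> *\<^sub>R y b + \<gamma> *\<^sub>R y d"
    unfolding D_def using cramer_cross3 by blast
  then have "(1 / D) *\<^sub>R (D *\<^sub>R z) = (\<alpha> / D) *\<^sub>R y a + (\<beta> / D) *\<^sub>R y b + (\<gamma> / D) *\<^sub>R y d"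
    by (simp add: scaleR_add_right)
  then have z: "z = (\<alpha> / D) *\<^sub>R y a + (\<beta> / D) *\<^sub>R y b + (\<gamma> / D) *\<^sub>R y d" using D by simp
  define \<delta> where "\<delta> i = (if i = a then \<alpha> / D else if i = b then \<beta> / D else if i = d then \<gamma> / D else 0)" for i
  have "(\<Sum>i\<in>S. \<delta> i *\<^sub>R y i) = (\<Sum>i\<in>{a, b, d}. \<delta> i *\<^sub>R y i)"
    using a b d S(2) by (intro sum.mono_neutral_right) (auto simp: \<delta>_def)
  also have "\<dots> = z" using b(2) d(2,3) by (simp add: z \<delta>_def add.assoc)
  finally have \<delta>z: "(\<Sum>i\<in>S. \<delta> i *\<^sub>R y i) = z" .
  define K where "K = \<bar>\<delta> a\<bar> / \<mu> a + \<bar>\<delta> b\<bar> / \<mu> b + \<bar>\<delta> d\<bar> / \<mu> d"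
  define \<nu> where "\<nu> i = 1 + \<delta> i + K * \<mu> i" for i
  have parts: "0 \<le> \<bar>\<delta> i\<bar> / \<mu> i" if "i \<in> S" for i using \<mu>(1)[OF that] by simp
  have K0: "0 \<le> K" using parts a b d by (simp add: K_def)
  have \<nu>pos: "0 < \<nu> i" if i: "i \<in> S" for i
  proof (cases "i = a \<or> i = b \<or> i = d")
    case True
    then have "0 < \<mu> i" "\<bar>\<delta> i\<bar> / \<mu> i \<le> K" using a b d parts[of a] parts[of b] parts[of d] unfolding K_def by auto
    then have "\<bar>\<delta> i\<bar> \<le> K * \<mu> i" by (simp add: pos_divide_le_eq)
    then show ?thesis unfolding \<nu>_def by linarith
  next
    case False
    then have "\<delta> i = 0" by (simp add: \<delta>_def)
    then show ?thesis using K0 \<mu>(1)[OF i] by (simp add: \<nu>_def add_pos_nonneg)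
  qed
  have "(\<Sum>i\<in>S. \<nu> i *\<^sub>R y i) = (\<Sum>i\<in>S. y i) + (\<Sum>i\<in>S. \<delta> i *\<^sub>R y i) + K *\<^sub>R (\<Sum>i\<in>S. \<mu> i *\<^sub>R y i)"
    by (simp add: \<nu>_def scaleR_add_left sum.distrib scaleR_sum_right)
  then have \<nu>0: "(\<Sum>i\<in>S. \<nu> i *\<^sub>R y i) = 0" using \<delta>z \<mu>(3) by (simp add: z_def)
  define l where "l i = (if i \<in> S then \<nu> i * \<sigma> i else 0)" for i
  have "(\<Sum>i\<in>{1..n}. l i *\<^sub>R V i) = (\<Sum>i\<in>S. l i *\<^sub>R V i)"
    using S by (intro sum.mono_neutral_right) (auto simp: l_def)
  also have "\<dots> = (\<Sum>i\<in>S. \<nu> i *\<^sub>R y i)" by (intro sum.cong) (auto simp: l_def y_def)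
  finally have "(\<Sum>i\<in>{1..n}. l i *\<^sub>R V i) = 0" using \<nu>0 by simp
  moreover have "l a \<noteq> 0" using a(1) \<nu>pos[OF a(1)] \<sigma>[of a] by (simp add: l_def)
  then have "\<exists>i\<in>{1..n}. l i \<noteq> 0" using a(1) S(1) by blast
  moreover have "signs n A B = (\<lambda>i\<in>{1..n}. sgn (l i))"
  proof
    fix i
    have "sgn (l i) = (if i \<in> A then 1 else if i \<in> B then -1 else 0)"
      using \<nu>pos[of i] by (auto simp: l_def S_def \<sigma>_def sgn_1_pos sgn_1_neg)
    then show "signs n A B i = (\<lambda>i\<in>{1..n}. sgn (l i)) i" by (simp add: signs_def)
  qed
  ultimately show ?thesis unfolding dependency_patterns_def by blast
qed

lemma fstar_eq_card:
  "fstar n V s t = card {(A, B). A \<subseteq> {1..n} \<and> B \<subseteq> {1..n} \<and> A \<inter> B = {} \<and> int (card B) = t \<and>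
     int (card A) = s - t \<and> \<not> separable A B}" (is "_ = card ?R")
proof -
  have "bij_betw (\<lambda>F. (pos_part n F, neg_part n F))
      {F \<in> dependency_patterns n V. int (card (neg_part n F)) = t \<and> int (card (pos_part n F)) = s - t} ?R"
  proof (rule bij_betw_byWitness[where f' = "\<lambda>(A, B). signs n A B"])
    show "(\<lambda>F. (pos_part n F, neg_part n F)) `
      {F \<in> dependency_patterns n V. int (card (neg_part n F)) = t \<and> int (card (pos_part n F)) = s - t} \<subseteq> ?R"
    proof (rule image_subsetI)
      fix F assume F: "F \<in> {F \<in> dependency_patterns n V. int (card (neg_part n F)) = t \<and> int (card (pos_part n F)) = s - t}"
      have sub: "pos_part n F \<subseteq> {1..n}" "neg_part n F \<subseteq> {1..n}" "pos_part n F \<inter> neg_part n F = {}"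
        by (auto simp: pos_part_def neg_part_def)
      have "signs n (pos_part n F) (neg_part n F) \<in> dependency_patterns n V"
        using F dependency_pattern_eq_signs[of F n V] by simp
      from signs_dependency_imp_not_separable[OF sub this] show "(pos_part n F, neg_part n F) \<in> ?R"
        using F sub by blast
    qed
    show "(\<lambda>(A, B). signs n A B) ` ?R \<subseteq>
      {F \<in> dependency_patterns n V. int (card (neg_part n F)) = t \<and> int (card (pos_part n F)) = s - t}"
      using signs_dependency_if_not_separable by (auto simp: parts_signs)
  qed (use dependency_pattern_eq_signs in \<open>auto simp: parts_signs\<close>)
  from bij_betw_same_card[OF this] show ?thesis by (simp add: fstar_def)
qed

section \<open>Small supports, and the pattern counts as complements of \<open>pcount\<close> and
  \<open>qcount\<close>\<close>

lemma separable_small: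
  assumes "A \<subseteq> {1..n}" "B \<subseteq> {1..n}" "A \<inter> B = {}" "card (A \<union> B) \<le> 3"
  shows "separable A B"
proof -
  obtain T where T: "A \<union> B \<subseteq> T" "T \<subseteq> {1..n}" "card T = 3"
    using exists_subset_between[of "A \<union> B" 3 "{1..n}"] assms n3 by auto
  obtain a b c where abc: "T = {a, b, c}" "a \<noteq> b" "b \<noteq> c" "a \<noteq> c" using T(3) by (auto simp: card_3_iff)
  then have mem: "a \<in> {1..n}" "b \<in> {1..n}" "c \<in> {1..n}" using T(2) by auto
  define \<sigma> where "\<sigma> i = (if i \<in> A then 1 else -1 :: real)" for i
  define D where "D = orient a b c"
  \<comment> \<open>The dual basis of three independent vectors realizes any choice of signs on
    them.\<close>
  let ?g = "(\<sigma> a / D) *\<^sub>R cross3 (V b) (V c) + (\<sigma> b / D) *\<^sub>R cross3 (V c) (V a) + (\<sigma> c / D) *\<^sub>R cross3 (V a) (V b)"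
  have "D \<noteq> 0" unfolding D_def using abc mem by (intro orient_nonzero) auto
  moreover have "inner (cross3 (V b) (V c)) (V a) = D" "inner (cross3 (V c) (V a)) (V b) = D" "inner (cross3 (V a) (V b)) (V c) = D"
    using orient_cycle[of b c a] orient_cycle[of c a b] orient_cycle[of a b c] by (simp_all add: orient_def D_def)
  ultimately have g: "inner ?g (V a) = \<sigma> a" "inner ?g (V b) = \<sigma> b" "inner ?g (V c) = \<sigma> c"
    by (simp_all add: inner_add_left dot_cross_self)
  show ?thesis unfolding separable_def
  proof (intro exI[of _ ?g] conjI ballI)
    fix i assume "i \<in> A"
    then have "i \<in> {a, b, c}" "\<sigma> i = 1" using T(1) abc(1) by (auto simp: \<sigma>_def)
    then show "0 < inner ?g (V i)" using g by auto
  next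
    fix i assume "i \<in> B"
    then have "i \<in> {a, b, c}" "\<sigma> i = -1" using T(1) abc(1) assms(3) by (auto simp: \<sigma>_def)
    then show "inner ?g (V i) < 0" using g by auto
  qed
qed

lemma fstar_small:
  assumes "s < 4" "t \<ge> 0"
  shows "fstar n V s t = 0"
proof -
  have "separable A B" if "A \<subseteq> {1..n}" "B \<subseteq> {1..n}" "A \<inter> B = {}" "int (card B) = t" "int (card A) = s - t" for A B
  proof (rule separable_small[OF that(1-3)])
    have "card (A \<union> B) \<le> card A + card B" by (rule card_Un_le)
    then show "card (A \<union> B) \<le> 3" using that(4,5) assms(1) by linarith
  qed
  then have "{(A, B). A \<subseteq> {1..n} \<and> B \<subseteq> {1..n} \<and> A \<inter> B = {} \<and> int (card B) = t \<and>
     int (card A) = s - t \<and> \<not> separable A B} = {}" by blast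
  then show ?thesis unfolding fstar_eq_card by (simp only: card.empty)
qed

lemma separable_empty: "separable A {} \<longleftrightarrow> pointed A"
  by (simp add: separable_def pointed_def)

lemma card_subs: "card (subs s) = n choose s"
  unfolding subs_def by (simp add: n_subsets)

lemma fstar_0: "fstar n V (int s) 0 + pcount s = n choose s"
proof -
  have "{(A, B). A \<subseteq> {1..n} \<and> B \<subseteq> {1..n} \<and> A \<inter> B = {} \<and> int (card B) = 0 \<and>
     int (card A) = int s - 0 \<and> \<not> separable A B} = (\<lambda>A. (A, {})) ` {S \<in> subs s. \<not> pointed S}"
    using finite_subset[of _ "{1..n}"] by (auto simp: subs_def separable_empty)
  then have "fstar n V (int s) 0 = card {S \<in> subs s. \<not> pointed S}"
    unfolding fstar_eq_card by (simp only:) (simp add: card_image inj_on_def)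
  moreover have "card {S \<in> subs s. \<not> pointed S} + card {S \<in> subs s. pointed S} = card (subs s)"
    using finite_subs by (subst card_Un_disjoint[symmetric]) (auto intro!: arg_cong[of _ _ card])
  ultimately show ?thesis by (simp add: pcount_def card_subs)
qed

lemma fstar_1:
  assumes "1 \<le> s"
  shows "fstar n V (int s) 1 + qcount s = s * (n choose s)"
proof -
  let ?Z = "SIGMA S:subs s. S"
  have sep: "separable (S - {x}) {x} \<longleftrightarrow> turned S x" for S x
    by (simp add: separable_def turned_def)
  have "bij_betw (\<lambda>(S, x). (S - {x}, {x})) {p \<in> ?Z. \<not> turned (fst p) (snd p)} {(A, B). A \<subseteq> {1..n} \<and> B \<subseteq> {1..n} \<and> A \<inter> B = {} \<and> int (card B) = 1 \<and>
     int (card A) = int s - 1 \<and> \<not> separable A B}" (is "bij_betw _ _ ?R")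
  proof (rule bij_betw_byWitness[where f' = "\<lambda>(A, B). (A \<union> B, the_elem B)"])
    show "(\<lambda>(S, x). (S - {x}, {x})) ` {p \<in> ?Z. \<not> turned (fst p) (snd p)} \<subseteq> ?R"
    proof (rule image_subsetI)
      fix p assume p: "p \<in> {p \<in> ?Z. \<not> turned (fst p) (snd p)}"
      obtain S x where Sx: "p = (S, x)" by fastforce
      then have "S \<in> subs s" "x \<in> S" "\<not> turned S x" using p by auto
      moreover from this have "card (S - {x}) = s - 1" using subsD by simp
      ultimately show "(\<lambda>(S, x). (S - {x}, {x})) p \<in> ?R" using Sx assms by (auto simp: sep subs_def)
    qed
    have R: "\<exists>x. p = (A, {x}) \<and> x \<notin> A \<and> insert x A \<in> subs s \<and> \<not> turned (insert x A) x" if "p \<in> ?R" "p = (A, B)" for p A B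
    proof -
      have A: "A \<subseteq> {1..n}" "B \<subseteq> {1..n}" "A \<inter> B = {}" "card B = 1" "int (card A) = int s - 1" "\<not> separable A B"
        using that by auto
      obtain x where x: "B = {x}" using A(4) by (auto simp: card_1_singleton_iff)
      have "finite A" "x \<notin> A" "insert x A - {x} = A" using A x finite_subset by auto
      moreover from this have "card (insert x A) = s" using A(5) by simp
      ultimately show ?thesis using that(2) x A sep[of "insert x A" x] by (auto simp: subs_def)
    qed
    show "\<forall>a'\<in>?R. (\<lambda>(S, x). (S - {x}, {x})) ((\<lambda>(A, B). (A \<union> B, the_elem B)) a') = a'"
    proof
      fix p assume p: "p \<in> ?R"
      obtain A B where AB: "p = (A, B)" by fastforce
      from R[OF p AB] obtain x where "p = (A, {x})" "x \<notin> A" by blast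
      then show "(\<lambda>(S, x). (S - {x}, {x})) ((\<lambda>(A, B). (A \<union> B, the_elem B)) p) = p" by simp
    qed
    show "(\<lambda>(A, B). (A \<union> B, the_elem B)) ` ?R \<subseteq> {p \<in> ?Z. \<not> turned (fst p) (snd p)}"
    proof (rule image_subsetI)
      fix p assume p: "p \<in> ?R"
      obtain A B where AB: "p = (A, B)" by fastforce
      from R[OF p AB] obtain x where "p = (A, {x})" "insert x A \<in> subs s" "\<not> turned (insert x A) x" by blast
      then show "(\<lambda>(A, B). (A \<union> B, the_elem B)) p \<in> {p \<in> ?Z. \<not> turned (fst p) (snd p)}" by simp
    qed
  qed auto
  from bij_betw_same_card[OF this] have "fstar n V (int s) 1 = card {p \<in> ?Z. \<not> turned (fst p) (snd p)}"
    unfolding fstar_eq_card by simp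
  moreover have "qcount s = card {p \<in> ?Z. turned (fst p) (snd p)}"
    unfolding qcount_def by (rule arg_cong[of _ _ card]) auto
  moreover have finZ: "finite ?Z" using finite_subs subsD(2) by blast
  have "card {p \<in> ?Z. \<not> turned (fst p) (snd p)} + card {p \<in> ?Z. turned (fst p) (snd p)} = card ?Z"
    using finZ by (subst card_Un_disjoint[symmetric]) (auto intro!: arg_cong[of _ _ card])
  moreover have "card ?Z = (\<Sum>S\<in>subs s. card S)"
    using finite_subs subsD(2) by (simp add: card_SigmaI)
  moreover have "(\<Sum>S\<in>subs s. card S) = s * (n choose s)"
    using subsD(3) by (simp add: card_subs)
  ultimately show ?thesis by simp
qed

end

section \<open>Binomial inequalities\<close>

lemma times_binomial_absorb: "int (Suc k) * int (m choose Suc k) = (int m - int k) * int (m choose k)"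
proof (cases "k \<le> m")
  case True
  have "Suc k * (m choose Suc k) = (m - k) * (m choose k)"
    by (simp only: binomial_absorb_comp binomial_absorption)
  then have "int (Suc k * (m choose Suc k)) = int ((m - k) * (m choose k))" by simp
  then show ?thesis using True by (simp only: of_nat_mult of_nat_diff)
qed (simp add: binomial_eq_0)

text \<open>By absorption \<open>(j choose r) / j\<close> equals
  \<open>((j - 1) choose (r - 1)) / r\<close>, which does not decrease with
  \<open>j\<close>.\<close>

lemma times_binomial_mono:
  assumes "j \<le> k" "1 \<le> r"
  shows "k * (j choose r) \<le> j * (k choose r)"
proof (cases "j = 0")
  case False
  obtain r' where r: "r = Suc r'" using assms(2) by (cases r) auto
  obtain j' where j: "j = Suc j'" using False by (cases j) auto
  obtain k' where k: "k = Suc k'" using False assms(1) by (cases k) auto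
  have "r * (k * (j choose r)) = k * (j * (j' choose r'))"
    using Suc_times_binomial_eq[of j' r'] unfolding r j by (simp add: mult.left_commute mult.commute)
  also have "\<dots> \<le> k * (j * (k' choose r'))"
    using assms(1) j k by (intro mult_le_mono2) (simp add: binomial_right_mono)
  also have "\<dots> = r * (j * (k choose r))"
    using Suc_times_binomial_eq[of k' r'] unfolding r k by (simp add: mult.left_commute mult.commute)
  finally show ?thesis using r by (simp only: mult_le_cancel1 zero_less_Suc simp_thms)
qed (use assms in simp)

lemma symmetric_minimum:
  fixes F :: "nat \<Rightarrow> int"
  assumes sym: "\<And>l. l \<le> N \<Longrightarrow> F (N - l) = F l" and dec: "\<And>l. 2 * l < N \<Longrightarrow> F (Suc l) \<le> F l" and "l \<le> N"
  shows "F (N div 2) \<le> F l"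
proof -
  have half: "F (N div 2) \<le> F l" if "l \<le> N div 2" for l
    using that
  proof (induction l rule: inc_induct)
    case (step l)
    then show ?case using dec[of l] by linarith
  qed simp
  show ?thesis
  proof (cases "l \<le> N div 2")
    case False
    then have "N - l \<le> N div 2" by linarith
    then show ?thesis using half sym[OF assms(3)] by metis
  qed (rule half)
qed

section \<open>The symmetrized summands and their minima\<close>

definition Hf :: "nat \<Rightarrow> nat \<Rightarrow> nat \<Rightarrow> int" where
  "Hf N m l = int (l choose m) + int ((N - l) choose m)"

text \<open>For \<open>N = n - 2\<close> and \<open>m = s - 2\<close> this is the share of a
  red-blue pair in twice \<open>pcount s + qcount s\<close>. The factors are
  \<open>n + 1 - s\<close>, from the sets of size \<open>s - 1\<close>, and \<open>3 - s\<close>,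
  which is \<open>1 - s\<close> from the sets of size \<open>s\<close> plus 2 from the two
  orientations of the pair.\<close>

definition Gf :: "nat \<Rightarrow> nat \<Rightarrow> nat \<Rightarrow> int" where
  "Gf N m l = (int N + 1 - int m) * Hf N (m - 1) l - (int m - 1) * Hf N m l"

lemma Hf_sym: "l \<le> N \<Longrightarrow> Hf N m (N - l) = Hf N m l"
  by (simp add: Hf_def)

lemma Gf_sym: "l \<le> N \<Longrightarrow> Gf N m (N - l) = Gf N m l"
  by (simp add: Gf_def Hf_sym)

lemma Hf_diff:
  assumes "2 * l < N"
  shows "Hf N (Suc r) l - Hf N (Suc r) (Suc l) = int ((N - 1 - l) choose r) - int (l choose r)"
proof -
  have e: "N - l = Suc (N - 1 - l)" "N - Suc l = N - 1 - l" using assms by auto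
  show ?thesis unfolding Hf_def e by simp
qed

lemma Hf_min:
  assumes "1 \<le> m" "l \<le> N"
  shows "Hf N m (N div 2) \<le> Hf N m l"
proof (rule symmetric_minimum[where F = "Hf N m", OF Hf_sym _ assms(2)])
  obtain r where r: "m = Suc r" using assms(1) by (cases m) auto
  fix l assume l: "2 * l < N"
  then have "l choose r \<le> (N - 1 - l) choose r" by (intro binomial_right_mono) auto
  then show "Hf N m (Suc l) \<le> Hf N m l" using Hf_diff[OF l, of r] r by simp
qed

text \<open>With \<open>r = m - 2\<close> and \<open>k = N - 1 - l\<close> the decrease from
  \<open>l\<close> to \<open>Suc l\<close> is \<open>l * (k choose r) - k * (l choose r)\<close>. It
  is nonnegative for \<open>r >= 1\<close>, but for \<open>r = 0\<close> it is \<open>l - k\<close>,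
  which is why \<open>s = 4\<close> is treated apart.\<close>

lemma Gf_min:
  assumes "3 \<le> m" "l \<le> N"
  shows "Gf N m (N div 2) \<le> Gf N m l"
proof (rule symmetric_minimum[where F = "Gf N m", OF Gf_sym _ assms(2)])
  define r where "r = m - 2"
  have r: "m = Suc (Suc r)" "1 \<le> r" using assms(1) by (auto simp: r_def)
  fix l assume l: "2 * l < N"
  define k where "k = N - 1 - l"
  have k: "l \<le> k" "int k = int N - 1 - int l" using l by (auto simp: k_def)
  then have N: "int N = int k + int l + 1" by simp
  have "Gf N m l - Gf N m (Suc l) = (int N + 1 - int m) * (Hf N (Suc r) l - Hf N (Suc r) (Suc l)) -
      (int m - 1) * (Hf N (Suc (Suc r)) l - Hf N (Suc (Suc r)) (Suc l))"
    using r(1) by (simp add: Gf_def algebra_simps)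
  also have "\<dots> = (int N - 1 - int r) * (int (k choose r) - int (l choose r)) -
      (int (Suc r) * int (k choose Suc r) - int (Suc r) * int (l choose Suc r))"
    unfolding Hf_diff[OF l] k_def[symmetric] using r(1) by (simp add: algebra_simps)
  also have "\<dots> = int l * int (k choose r) - int k * int (l choose r)"
    unfolding times_binomial_absorb N by (simp add: algebra_simps)
  finally have "Gf N m l - Gf N m (Suc l) = int (l * (k choose r)) - int (k * (l choose r))" by simp
  moreover have "k * (l choose r) \<le> l * (k choose r)" using times_binomial_mono[OF k(1) r(2)] .
  ultimately show "Gf N m (Suc l) \<le> Gf N m l" by linarith
qed

text \<open>A telescoping sum of the differences
  \<open>Hf N 2 j - Hf N 2 (Suc j) = N - 1 - 2 * j\<close>, written with indicators of
  \<open>l <= j\<close> so that summation over pairs produces the counts bounded by the sweep. One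
  of the two sums is for \<open>l\<close> below the middle, the other for \<open>l\<close> above
  it.\<close>

lemma Hf_two:
  assumes "l \<le> N"
  shows "Hf N 2 l = Hf N 2 (N div 2) +
    (\<Sum>j\<in>{j. 2 * j < N}. of_bool (l \<le> j) * (int N - 1 - 2 * int j)) +
    (\<Sum>j\<in>{j. 2 * j < N}. of_bool (N - l \<le> j) * (int N - 1 - 2 * int j))"
proof -
  define K where "K = (N + 1) div 2"
  define S where "S l = (\<Sum>j\<in>{j. 2 * j < N}. of_bool (l \<le> j) * (int N - 1 - 2 * int j))" for l
  have set: "{j. 2 * j < N} = {..<K}" by (auto simp: K_def)
  have S0: "S l = 0" if "K \<le> l" for l
    unfolding S_def set using that by (intro sum.neutral) auto
  have SSuc: "S l = (int N - 1 - 2 * int l) + S (Suc l)" if "l < K" for l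
  proof -
    have "S l = of_bool (l \<le> l) * (int N - 1 - 2 * int l) + (\<Sum>j\<in>{..<K} - {l}. of_bool (l \<le> j) * (int N - 1 - 2 * int j))"
      unfolding S_def set using that by (intro sum.remove) auto
    moreover have "S (Suc l) = of_bool (Suc l \<le> l) * (int N - 1 - 2 * int l) + (\<Sum>j\<in>{..<K} - {l}. of_bool (Suc l \<le> j) * (int N - 1 - 2 * int j))"
      unfolding S_def set using that by (intro sum.remove) auto
    moreover have "(\<Sum>j\<in>{..<K} - {l}. of_bool (Suc l \<le> j) * (int N - 1 - 2 * int j)) = (\<Sum>j\<in>{..<K} - {l}. of_bool (l \<le> j) * (int N - 1 - 2 * int j))"
      by (intro sum.cong) auto
    ultimately show ?thesis by simp
  qed
  have mid: "Hf N 2 K = Hf N 2 (N div 2)"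
  proof -
    have "K = N - N div 2" by (auto simp: K_def)
    then show ?thesis using Hf_sym[of "N div 2" N 2] by simp
  qed
  have low: "Hf N 2 l = Hf N 2 (N div 2) + S l" if "l \<le> K" for l
    using that
  proof (induction l rule: inc_induct)
    case base
    then show ?case using mid S0[of K] by simp
  next
    case (step l)
    have l: "2 * l < N" using step.hyps set by blast
    have "Hf N 2 l - Hf N 2 (Suc l) = int N - 1 - 2 * int l"
      using Hf_diff[OF l, of 1] l by (simp add: numeral_2_eq_2)
    then show ?case using step SSuc[of l] by simp
  qed
  have "Hf N 2 l = Hf N 2 (N div 2) + S l + S (N - l)"
  proof (cases "2 * l \<le> N")
    case True
    then have "l \<le> K" "K \<le> N - l" by (auto simp: K_def)
    then show ?thesis using low S0 by simp
  next
    case False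
    then have "N - l \<le> K" "K \<le> l" by (auto simp: K_def)
    then show ?thesis using low[of "N - l"] S0[of l] Hf_sym[OF assms, of 2] by simp
  qed
  then show ?thesis by (simp add: S_def)
qed

section \<open>Comparison with coneighborly configurations\<close>

context vector_config
begin

abbreviation lf :: "nat \<times> nat \<Rightarrow> nat" where "lf p \<equiv> left (fst p) (snd p)"

definition same :: "real^3 \<Rightarrow> (nat \<times> nat) set" where
  "same w = {(a, b). a \<in> {1..n} \<and> b \<in> {1..n} \<and> a \<noteq> b \<and> (0 < inner w (V a) \<longleftrightarrow> 0 < inner w (V b))}"

lemma finite_same: "finite (same w)"
  by (rule finite_subset[OF _ finite_pairs]) (auto simp: same_def pairs_def)

lemma lf_swap: "p \<in> pairs \<Longrightarrow> lf (prod.swap p) = n - 2 - lf p"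
  using left_add_left[of "fst p" "snd p"] by (auto simp: pairs_def)

lemma lf_le: "p \<in> pairs \<Longrightarrow> lf p \<le> n - 2"
  using left_add_left[of "fst p" "snd p"] by (auto simp: pairs_def)

lemma sum_swap:
  assumes "\<And>p. p \<in> R \<Longrightarrow> prod.swap p \<in> R'" "\<And>p. p \<in> R' \<Longrightarrow> prod.swap p \<in> R" "R \<subseteq> pairs"
  shows "(\<Sum>p\<in>R'. f (lf p)) = (\<Sum>p\<in>R. f (n - 2 - lf p))"
proof -
  have "(\<Sum>p\<in>R'. f (lf p)) = (\<Sum>p\<in>R. f (lf (prod.swap p)))"
    by (rule sum.reindex_bij_witness[of _ prod.swap prod.swap]) (use assms(1,2) in auto)
  also have "\<dots> = (\<Sum>p\<in>R. f (n - 2 - lf p))"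
    using assms(3) lf_swap by (intro sum.cong refl arg_cong[of _ _ f]) blast
  finally show ?thesis .
qed

lemma sum_swap_same: "(\<Sum>p\<in>same w. f (n - 2 - lf p)) = (\<Sum>p\<in>same w. f (lf p))"
  by (rule sum_swap[symmetric]) (auto simp: same_def pairs_def)

lemma sum_swap_sep: "(\<Sum>p\<in>sep w. f (n - 2 - lf p)) = (\<Sum>p\<in>sep (- w). f (lf p))"
  by (rule sum_swap[symmetric]) (auto simp: sep_def pairs_def)

lemma pairs_split:
  assumes wn: "\<And>i. i \<in> {1..n} \<Longrightarrow> inner w (V i) \<noteq> 0"
  shows "(\<Sum>p\<in>pairs. f p) = (\<Sum>p\<in>sep w. f p) + (\<Sum>p\<in>sep (- w). f p) + (\<Sum>p\<in>same w. (f p :: int))"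
proof -
  have "pairs = (sep w \<union> sep (- w)) \<union> same w"
  proof (intro equalityI subsetI)
    fix p assume "p \<in> pairs"
    then obtain a b where "p = (a, b)" "a \<in> {1..n}" "b \<in> {1..n}" "a \<noteq> b" by (auto simp: pairs_def)
    then show "p \<in> sep w \<union> sep (- w) \<union> same w"
      using wn[of a] wn[of b] unfolding sep_def same_def by simp linarith
  qed (auto simp: sep_def same_def pairs_def)
  moreover have "sep w \<inter> sep (- w) = {}" "(sep w \<union> sep (- w)) \<inter> same w = {}"
    by (auto simp: sep_def same_def)
  ultimately show ?thesis
    by (simp add: sum.union_disjoint finite_sep finite_same)
qed

lemma card_red_blue:
  assumes wn: "\<And>i. i \<in> {1..n} \<Longrightarrow> inner w (V i) \<noteq> 0"
  shows "card {i \<in> {1..n}. 0 < inner w (V i)} + card {i \<in> {1..n}. inner w (V i) < 0} = n"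
proof -
  have "card {1..n} = card ({i \<in> {1..n}. 0 < inner w (V i)} \<union> {i \<in> {1..n}. inner w (V i) < 0})"
    using wn by (intro arg_cong[of _ _ card]) (auto simp: not_less_iff_gr_or_eq)
  also have "\<dots> = card {i \<in> {1..n}. 0 < inner w (V i)} + card {i \<in> {1..n}. inner w (V i) < 0}"
    by (rule card_Un_disjoint) auto
  finally show ?thesis by simp
qed

text \<open>After exchanging the sums, layer \<open>j\<close> compares the numbers of pairs with
  \<open>lf p <= j\<close>. The assumption \<open>half\<close> leaves more than \<open>j\<close> red
  vectors for each \<open>j\<close> that occurs.\<close>

lemma sum_same_ge_sum_sep:
  assumes gen: "generic_for n V w" and half: "n div 2 \<le> card {i \<in> {1..n}. 0 < inner w (V i)}"
    and c: "\<And>j. 2 * j < n - 2 \<Longrightarrow> (0::int) \<le> c j"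
    and g: "\<And>l. g l = (\<Sum>j\<in>{j. 2 * j < n - 2}. of_bool (l \<le> j) * c j)"
  shows "(\<Sum>p\<in>sep w. g (lf p)) \<le> (\<Sum>p\<in>same w. g (lf p))"
proof -
  have lay: "(\<Sum>p\<in>R. g (lf p)) = (\<Sum>j\<in>{j. 2 * j < n - 2}. c j * int (card {p \<in> R. lf p \<le> j}))"
    if "finite R" for R
  proof -
    have "(\<Sum>p\<in>R. g (lf p)) = (\<Sum>j\<in>{j. 2 * j < n - 2}. \<Sum>p\<in>R. of_bool (lf p \<le> j) * c j)"
      unfolding g by (rule sum.swap)
    also have "\<dots> = (\<Sum>j\<in>{j. 2 * j < n - 2}. c j * int (card {p \<in> R. lf p \<le> j}))"
      using that by (intro sum.cong refl)
        (simp add: sum_distrib_right[symmetric] Collect_conj_eq Int_commute mult.commute)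
    finally show ?thesis .
  qed
  have "int (card {p \<in> sep w. lf p \<le> j}) \<le> int (card {p \<in> same w. lf p \<le> j})" if j: "2 * j < n - 2" for j
  proof -
    have wn: "inner w (V i) \<noteq> 0" if "i \<in> {1..n}" for i using gen that by (simp add: generic_for_def)
    have "{p \<in> sep w. lf p \<le> j} = {(x, e). x \<in> {1..n} \<and> e \<in> {1..n} \<and> 0 < inner w (V x) \<and> \<not> 0 < inner w (V e) \<and> left x e \<le> j}"
      using wn by (auto simp: sep_def not_less_iff_gr_or_eq)
    moreover have "{p \<in> same w. lf p \<le> j} = {(a, b). a \<in> {1..n} \<and> b \<in> {1..n} \<and> a \<noteq> b \<and> (0 < inner w (V a) \<longleftrightarrow> 0 < inner w (V b)) \<and> left a b \<le> j}"
      by (auto simp: same_def)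
    moreover have "j < card {i \<in> {1..n}. 0 < inner w (V i)}" "2 * j + 2 < n" using j half by auto
    ultimately show ?thesis using low_cross_le_low_same[OF gen] by simp
  qed
  then show ?thesis unfolding lay[OF finite_sep] lay[OF finite_same]
    using c by (intro sum_mono mult_left_mono) auto
qed

end

section \<open>Bounds from a halving plane that are sharp for coneighborly configurations\<close>

locale halved_config = vector_config +
  fixes w :: "real^3"
  assumes generic: "generic_for n V w" and halved: "card {i \<in> {1..n}. 0 < inner w (V i)} = n div 2"
begin

lemma wn: "i \<in> {1..n} \<Longrightarrow> inner w (V i) \<noteq> 0"
  using generic by (simp add: generic_for_def)

lemma halved': "card {i \<in> {1..n}. inner w (V i) < 0} = n - n div 2"
  using card_red_blue[OF wn] halved by simp

lemma card_sep: "card (sep w) = (n div 2) * (n - n div 2)"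
proof -
  have "sep w = {i \<in> {1..n}. 0 < inner w (V i)} \<times> {i \<in> {1..n}. inner w (V i) < 0}" by (auto simp: sep_def)
  then show ?thesis by (simp only: card_cartesian_product halved halved')
qed

lemma card_sep_flip: "card (sep (- w)) = card (sep w)"
  by (rule bij_betw_same_card[of prod.swap], rule bij_betw_byWitness[of _ prod.swap]) (auto simp: sep_def)

lemma card_same: "int (card (same w)) = int n * (int n - 1) - 2 * int ((n div 2) * (n - n div 2))"
proof -
  have "pairs = (SIGMA a:{1..n}. {1..n} - {a})" by (auto simp: pairs_def)
  then have "card pairs = n * (n - 1)" by (simp add: card_SigmaI)
  then have "int (card pairs) = int n * (int n - 1)" using n3 by (simp add: of_nat_diff)
  then show ?thesis using pairs_split[of w "\<lambda>_. 1", OF wn] card_sep card_sep_flip by simp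
qed

text \<open>The contribution of the one-coloured sets to twice \<open>pcount s\<close>.\<close>

definition ends :: "nat \<Rightarrow> int" where
  "ends s = 2 * (int ((n div 2) choose s) + int ((n - n div 2) choose s))"

lemma two_pcount:
  assumes "2 \<le> s"
  shows "2 * int (pcount s) = (\<Sum>p\<in>sep w. Hf (n - 2) (s - 2) (lf p)) + ends s"
proof -
  have "(\<Sum>(a, b)\<in>sep w. left b a choose (s - 2)) = (\<Sum>(a, b)\<in>sep w. left a b choose (s - 2))"
    by (rule sum_sep_flip[OF wn assms])
  moreover have "(\<Sum>(a, b)\<in>sep w. left b a choose (s - 2)) = (\<Sum>p\<in>sep w. (n - 2 - lf p) choose (s - 2))"
    using sep_subset lf_swap by (intro sum.cong refl) (force simp: split_beta)
  ultimately have "int (\<Sum>p\<in>sep w. lf p choose (s - 2)) = int (\<Sum>p\<in>sep w. (n - 2 - lf p) choose (s - 2))"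
    by (simp add: split_beta)
  moreover have "int (pcount s) = int (\<Sum>p\<in>sep w. lf p choose (s - 2)) + int ((n div 2) choose s) + int ((n - n div 2) choose s)"
    using pcount_eq[OF wn assms] unfolding halved halved' by (simp add: split_beta)
  ultimately show ?thesis by (simp add: Hf_def ends_def sum.distrib)
qed

text \<open>In \<open>qcount_eq\<close> all ordered pairs occur. The two orientations of the
  red-blue pairs contribute equally after symmetrization and merge with the \<open>pcount\<close>
  terms into \<open>Gf\<close>; only the pairs of equal colours keep \<open>Hf\<close>.\<close>

lemma two_pcount_qcount:
  assumes s: "3 \<le> s" "s \<le> n"
  shows "2 * int (pcount s + qcount s) = (\<Sum>p\<in>sep w. Gf (n - 2) (s - 2) (lf p)) +
    (\<Sum>p\<in>same w. Hf (n - 2) (s - 2) (lf p)) + (1 - int s) * ends s + (int n + 1 - int s) * ends (s - 1)"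
proof -
  let ?N = "n - 2" and ?m = "s - 2"
  define X where "X = (\<Sum>p\<in>sep w. Hf ?N ?m (lf p))"
  define Y where "Y = (\<Sum>p\<in>sep w. Hf ?N (?m - 1) (lf p))"
  define Z where "Z = (\<Sum>p\<in>same w. Hf ?N ?m (lf p))"
  define C where "C = (\<Sum>p\<in>pairs. int (lf p choose ?m))"
  have "int (qcount s + s * pcount s) = int ((n + 1 - s) * pcount (s - 1) + (\<Sum>(a, b)\<in>pairs. left a b choose ?m))"
    using qcount_eq[of s] s by simp
  then have q: "int (qcount s) + int s * int (pcount s) = (int n + 1 - int s) * int (pcount (s - 1)) + C"
    using s by (simp add: C_def split_beta of_nat_diff)
  have m1: "?m - 1 = s - 1 - 2" by simp
  have p: "2 * int (pcount s) = X + ends s"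
    unfolding X_def by (rule two_pcount) (use s in simp)
  have p1: "2 * int (pcount (s - 1)) = Y + ends (s - 1)"
    unfolding Y_def m1 by (rule two_pcount) (use s in simp)
  have "C = (\<Sum>p\<in>pairs. int ((?N - lf p) choose ?m))"
    unfolding C_def by (rule sum_swap) (auto simp: pairs_def)
  then have "2 * C = (\<Sum>p\<in>pairs. Hf ?N ?m (lf p))" by (simp add: Hf_def C_def sum.distrib)
  also have "\<dots> = X + (\<Sum>p\<in>sep (- w). Hf ?N ?m (lf p)) + Z"
    unfolding X_def Z_def by (rule pairs_split[OF wn])
  also have "(\<Sum>p\<in>sep (- w). Hf ?N ?m (lf p)) = X"
    unfolding sum_swap_sep[symmetric] X_def using lf_le sep_subset by (intro sum.cong refl Hf_sym) blast
  finally have C: "2 * C = 2 * X + Z" by simp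
  have "(\<Sum>p\<in>sep w. Gf ?N ?m (lf p)) = (int n + 1 - int s) * Y - (int s - 3) * X"
  proof -
    have "Gf ?N ?m l = (int n + 1 - int s) * Hf ?N (?m - 1) l - (int s - 3) * Hf ?N ?m l" for l
      using s by (simp add: Gf_def of_nat_diff)
    then show ?thesis by (simp only: sum_subtractf sum_distrib_left X_def Y_def)
  qed
  moreover have "2 * int (pcount s + qcount s) = (1 - int s) * (2 * int (pcount s)) + (int n + 1 - int s) * (2 * int (pcount (s - 1))) + 2 * C"
    using q by (simp add: algebra_simps)
  ultimately show ?thesis unfolding p p1 C Z_def[symmetric] by (simp add: algebra_simps)
qed

text \<open>The value of \<open>two_pcount\<close> when every \<open>lf p\<close> is
  \<open>(n - 2) div 2\<close>. It depends on \<open>n\<close> and \<open>s\<close> alone, and so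
  does \<open>r_bound\<close>; this makes different configurations comparable.\<close>

definition p_bound :: "nat \<Rightarrow> int" where
  "p_bound s = int ((n div 2) * (n - n div 2)) * Hf (n - 2) (s - 2) ((n - 2) div 2) + ends s"

definition r_bound :: "nat \<Rightarrow> int" where
  "r_bound s = int ((n div 2) * (n - n div 2)) * Gf (n - 2) (s - 2) ((n - 2) div 2) +
    (int n * (int n - 1) - 2 * int ((n div 2) * (n - n div 2))) * Hf (n - 2) (s - 2) ((n - 2) div 2) +
    (1 - int s) * ends s + (int n + 1 - int s) * ends (s - 1)"

lemma p_bound_le:
  assumes "3 \<le> s"
  shows "p_bound s \<le> 2 * int (pcount s)"
proof -
  have "(\<Sum>p\<in>sep w. Hf (n - 2) (s - 2) ((n - 2) div 2)) \<le> (\<Sum>p\<in>sep w. Hf (n - 2) (s - 2) (lf p))"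
    using assms lf_le sep_subset by (intro sum_mono Hf_min) auto
  then show ?thesis using two_pcount[of s] assms by (simp add: p_bound_def card_sep)
qed

lemma r_bound_le:
  assumes s: "4 \<le> s" "s \<le> n"
  shows "r_bound s \<le> 2 * int (pcount s + qcount s)"
proof -
  let ?N = "n - 2" and ?m = "s - 2"
  let ?h = "Hf ?N ?m (?N div 2)"
  have pairs: "same w \<subseteq> pairs" by (auto simp: same_def pairs_def)
  have "int (card (sep w)) * Gf ?N ?m (?N div 2) + int (card (same w)) * ?h \<le>
    (\<Sum>p\<in>sep w. Gf ?N ?m (lf p)) + (\<Sum>p\<in>same w. Hf ?N ?m (lf p))"
  proof (cases "s = 4")
    case False
    have "(\<Sum>p\<in>sep w. Gf ?N ?m (?N div 2)) \<le> (\<Sum>p\<in>sep w. Gf ?N ?m (lf p))"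
      using s False lf_le sep_subset by (intro sum_mono Gf_min) auto
    moreover have "(\<Sum>p\<in>same w. ?h) \<le> (\<Sum>p\<in>same w. Hf ?N ?m (lf p))"
      using s lf_le pairs by (intro sum_mono Hf_min) auto
    ultimately show ?thesis by simp
  next
    \<comment> \<open>Here \<open>Gf\<close> is a constant minus \<open>Hf\<close>, so red-blue
      pairs away from the middle lower the sum. After the layer decomposition it remains to bound
      the sums of \<open>g\<close> over \<open>sep w\<close> and \<open>sep (- w)\<close> by twice
      the sum over \<open>same w\<close>.\<close>
    case True
    define g where "g l = (\<Sum>j\<in>{j. 2 * j < ?N}. of_bool (l \<le> j) * (int ?N - 1 - 2 * int j))" for l
    have m: "?m = 2" using True by simp
    have H: "Hf ?N ?m (lf p) = ?h + g (lf p) + g (?N - lf p)" if "p \<in> pairs" for p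
      unfolding m g_def by (rule Hf_two[OF lf_le[OF that]])
    have G: "Gf ?N ?m l = (int ?N - 1) * int ?N - Hf ?N ?m l" if "l \<le> ?N" for l
    proof -
      have "int l + int (?N - l) = int ?N" using that by simp
      then have "Hf ?N 1 l = int ?N" by (simp only: Hf_def choose_one)
      then show ?thesis unfolding m Gf_def by simp
    qed
    have "(\<Sum>p\<in>same w. Hf ?N ?m (lf p)) = (\<Sum>p\<in>same w. ?h + g (lf p) + g (?N - lf p))"
      using H pairs by (intro sum.cong refl) blast
    then have same: "(\<Sum>p\<in>same w. Hf ?N ?m (lf p)) = int (card (same w)) * ?h + 2 * (\<Sum>p\<in>same w. g (lf p))"
      unfolding sum.distrib sum_swap_same by simp
    have "(\<Sum>p\<in>sep w. Hf ?N ?m (lf p)) = (\<Sum>p\<in>sep w. ?h + g (lf p) + g (?N - lf p))"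
      using H sep_subset by (intro sum.cong refl) blast
    then have sep: "(\<Sum>p\<in>sep w. Hf ?N ?m (lf p)) = int (card (sep w)) * ?h + (\<Sum>p\<in>sep w. g (lf p)) + (\<Sum>p\<in>sep (- w). g (lf p))"
      unfolding sum.distrib sum_swap_sep by simp
    have "(\<Sum>p\<in>sep w. Gf ?N ?m (lf p)) = (\<Sum>p\<in>sep w. (int ?N - 1) * int ?N - Hf ?N ?m (lf p))"
      using G lf_le sep_subset by (intro sum.cong refl) blast
    then have Gs: "(\<Sum>p\<in>sep w. Gf ?N ?m (lf p)) = int (card (sep w)) * ((int ?N - 1) * int ?N) - (\<Sum>p\<in>sep w. Hf ?N ?m (lf p))"
      by (simp add: sum_subtractf)
    have gen': "generic_for n V (- w)" using generic by (simp add: generic_for_def)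
    have same': "same (- w) = same w"
      unfolding same_def using wn by (auto; metis linorder_neqE)
    have half: "n div 2 \<le> n - n div 2" by simp
    have c: "0 \<le> int ?N - 1 - 2 * int j" if "2 * j < ?N" for j using that by linarith
    have "(\<Sum>p\<in>sep w. g (lf p)) \<le> (\<Sum>p\<in>same w. g (lf p))"
      by (rule sum_same_ge_sum_sep[OF generic _ c g_def]) (simp only: halved order_refl)
    moreover have "(\<Sum>p\<in>sep (- w). g (lf p)) \<le> (\<Sum>p\<in>same w. g (lf p))"
      unfolding same'[symmetric]
      by (rule sum_same_ge_sum_sep[OF gen' _ c g_def]) (simp only: inner_minus_left neg_0_less_iff_less halved' half)
    moreover have Gm: "Gf ?N ?m (?N div 2) = (int ?N - 1) * int ?N - ?h" by (rule G) simp
    ultimately show ?thesis unfolding Gs same sep Gm right_diff_distrib by linarith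
  qed
  then show ?thesis using two_pcount_qcount[of s] s unfolding r_bound_def card_sep card_same by simp
qed

text \<open>Both orientations of a pair have at least \<open>(n - 2) div 2\<close> vectors to the
  left, and the two numbers add up to \<open>n - 2\<close>. So each is the lower or the upper half
  of \<open>n - 2\<close>, where the symmetric functions \<open>Hf\<close> and \<open>Gf\<close>
  take the same value.\<close>

lemma bounds_attained:
  assumes cn: "coneighborly n V" and s: "4 \<le> s" "s \<le> n"
  shows "2 * int (pcount s) = p_bound s" and "2 * int (pcount s + qcount s) = r_bound s"
proof -
  let ?N = "n - 2" and ?m = "s - 2"
  have mid: "F (lf p) = F (?N div 2)" if pp: "p \<in> pairs" and sym: "\<And>l. l \<le> ?N \<Longrightarrow> F (?N - l) = F l" for p and F :: "nat \<Rightarrow> int"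
  proof -
    obtain a b where ab: "p = (a, b)" "(a, b) \<in> pairs" "(b, a) \<in> pairs" using pp by (cases p) (auto simp: pairs_def)
    have "?N div 2 \<le> left a b" "?N div 2 \<le> left b a" using coneighborly_left[OF cn] ab by auto
    moreover have "left a b + left b a = ?N" using ab(2) by (intro left_add_left) (auto simp: pairs_def)
    ultimately have "lf p = ?N div 2 \<or> lf p = ?N - ?N div 2" unfolding ab(1) fst_conv snd_conv by linarith
    moreover have "F (?N - ?N div 2) = F (?N div 2)" by (rule sym) simp
    ultimately show ?thesis by metis
  qed
  have "(\<Sum>p\<in>sep w. Hf ?N ?m (lf p)) = (\<Sum>p\<in>sep w. Hf ?N ?m (?N div 2))"
    using sep_subset by (intro sum.cong refl mid Hf_sym) auto
  then show "2 * int (pcount s) = p_bound s"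
    using two_pcount[of s] s by (simp add: p_bound_def card_sep)
  have "(\<Sum>p\<in>sep w. Gf ?N ?m (lf p)) = (\<Sum>p\<in>sep w. Gf ?N ?m (?N div 2))"
    using sep_subset by (intro sum.cong refl mid Gf_sym) auto
  moreover have "(\<Sum>p\<in>same w. Hf ?N ?m (lf p)) = (\<Sum>p\<in>same w. Hf ?N ?m (?N div 2))"
    by (intro sum.cong refl mid Hf_sym) (auto simp: same_def pairs_def)
  ultimately show "2 * int (pcount s + qcount s) = r_bound s"
    using two_pcount_qcount[of s] s by (simp add: r_bound_def card_sep card_same)
qed

end

theorem theorem2:
  fixes n :: nat and V V' :: "nat \<Rightarrow> real^3" and s :: int
  assumes "n \<ge> 3"
    and "general_position n V"
    and "s \<le> int n"
    and "general_position n V'"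
    and "coneighborly n V'"
  shows "fstar n V s 0 \<le> fstar n V' s 0 \<and> fstar_le1 n V s \<le> fstar_le1 n V' s"
proof -
  interpret A: vector_config n V using general_position_vector_config assms by blast
  interpret B: vector_config n V' using general_position_vector_config assms by blast
  show ?thesis
  proof (cases "s < 4")
    case True
    then show ?thesis by (simp add: fstar_le1_def A.fstar_small)
  next
    case False
    define k where "k = nat s"
    have k: "s = int k" "4 \<le> k" "k \<le> n" using False assms(3) by (auto simp: k_def)
    obtain w where w: "generic_for n V w" "card {i \<in> {1..n}. 0 < inner w (V i)} = n div 2"
      using A.exists_halving by blast
    obtain w' where w': "generic_for n V' w'" "card {i \<in> {1..n}. 0 < inner w' (V' i)} = n div 2"
      using B.exists_halving by blast
    interpret A: halved_config n V w by unfold_locales (use w in auto)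
    interpret B: halved_config n V' w' by unfold_locales (use w' in auto)
    have "A.p_bound k = B.p_bound k" "A.r_bound k = B.r_bound k"
      unfolding A.p_bound_def B.p_bound_def A.r_bound_def B.r_bound_def A.ends_def B.ends_def by simp_all
    then have "int (B.pcount k) \<le> int (A.pcount k)"
        "int (B.pcount k + B.qcount k) \<le> int (A.pcount k + A.qcount k)"
      using A.p_bound_le[of k] A.r_bound_le[OF k(2,3)] B.bounds_attained[OF assms(5) k(2,3)] k(2) by auto
    then have "B.pcount k \<le> A.pcount k" "B.pcount k + B.qcount k \<le> A.pcount k + A.qcount k"
      by (simp_all only: of_nat_le_iff)
    moreover have "fstar n V s 0 + A.pcount k = n choose k" "fstar n V' s 0 + B.pcount k = n choose k"
      unfolding k(1) by (rule A.fstar_0, rule B.fstar_0)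
    moreover have "fstar n V s 1 + A.qcount k = k * (n choose k)" "fstar n V' s 1 + B.qcount k = k * (n choose k)"
      unfolding k(1) using A.fstar_1[of k] B.fstar_1[of k] k(2) by simp_all
    ultimately show ?thesis unfolding fstar_le1_def by linarith
  qed
qed

end
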